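(* Let $G$ be a finite connected graph with $n$ vertices and $m$ edges, $\Gamma$ a finite group with $|\Gamma|=r$, and $\alpha:D(G)\to\Gamma$ an ordinary voltage assignment. Let ${\bf W}(G)$ be a symmetric weighted matrix of $G$ (weight $w$), and $\tilde w$ the derived weight on $G^\alpha$. Let $\rho_1=1,\rho_2,\dots,\rho_k$ be the inequivalent irreducible representations of $\Gamma$, with $f_i$ the degree of $\rho_i$ ($f_1=1$). Suppose the $\Gamma$-covering $G^\alpha$ is connected (and $\kappa_w(G)\ne0$, $\kappa_{\tilde w}(G^\alpha)\ne0$). For $2\le i\le k$ let \[ K_i(u,t)=\det\Big({\bf I}_{nf_i}-t\sum_{g\in\Gamma}\rho_i(g)\otimes{\bf W}_g+(1-u)t^2\,{\bf I}_{f_i}\otimes({\bf D}_w-(1-u){\bf I}_n)\Big). \] Then, for nonzero $t$ (where the logarithmic derivatives below are defined), <br>1. $Kf^z_{\tilde w}(G^\alpha,t)=|\Gamma|Kf^z_w(G,t)-2|\Gamma|(w(G)t-n)\Big((|\Gamma|-1)nt-t^2\sum_{i=2}^kf_i\frac{\partial}{\partial t}\log K_i(u,t)\big|_{(1-1/t,t)}\Big)$; <br>2. $Kf^z_{\tilde w}(G^\alpha,t)=|\Gamma|Kf^z_w(G,t)+|\Gamma|(n-w(G)t)\Big((|\Gamma|-1)nt-t^2\sum_{i=2}^kf_i\frac{\partial}{\partial t}\log K_i(u,t)\big|_{(1-1/t,t)}+\sum_{i=2}^kf_i\frac{\partial}{\partial u}\log K_i(u,t)\big|_{(1-1/t,t)}\Big)$;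 <br>3. $Kf^z_{\tilde w}(G^\alpha,t)=|\Gamma|Kf^z_w(G,t)-2|\Gamma|(w(G)t-n)\sum_{i=2}^kf_i\frac{\partial}{\partial u}\log K_i(u,t)\big|_{(1-1/t,t)}$.
   Context: $D(G)=\{(u,v),(v,u):uv\in E(G)\}$; for $e=(u,v)$, $o(e)=u$, $e^{-1}=(v,u)$. A symmetric weight $w:D(G)\to\mathbb{C}$ satisfies $w(e^{-1})=w(e)$; ${\bf W}(G)=(w(v_i,v_j))$ (zero for non-arcs); ${\bf D}_w$ diagonal with entries $d^w_i=\sum_{o(e)=v_i}w(e)$; $w(G)=\sum_{uv\in E(G)}w(u,v)$; ${\bf L}={\bf D}_w-{\bf W}$; $\kappa_w(G)=\sum_T\prod_{e\in E(T)}w(e)$ over spanning trees. For a graph with $N$ vertices, $r_{pq}=\det({\bf L}^{(pq)})/\kappa_w$ ($p\ne q$, ${\bf L}^{(pq)}$ = delete rows/columns $p,q$), and $Kf^z_w(G,t)=\sum_{1\le p<q\le N}(d^w_pt-2)(d^w_qt-2)r_{pq}$; $Kf^z_{\tilde w}(G^\alpha,t)$ is the same quantity for $G^\alpha$ with weight $\tilde w$. An ordinary voltage assignment satisfies $\alpha(v,u)=\alpha(u,v)^{-1}$. The derived graph $G^\alpha$ has vertex set $V(G)\times\Gamma$, with $((u,h),(v,k))$ an arc iff $(u,v)\in D(G)$ and $k=h\alpha(u,v)$. The derived weight is $\tilde w((u,g),(v,h))=w(u,v)$ if $(u,v)\in D(G)$ and $h=g\alpha(u,v)$, and $0$ otherwise.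 For $g\in\Gamma$, ${\bf W}_g=(w^{(g)}_{uv})$ with $w^{(g)}_{uv}=w(u,v)$ if $(u,v)\in D(G)$ and $\alpha(u,v)=g$, else $0$. $\otimes$ is the Kronecker product. $\frac{\partial}{\partial t}\log K_i$ means $(\partial K_i/\partial t)/K_i$ (similarly for $u$), and $|_{(1-1/t,t)}$ means evaluation at $u=1-1/t$ with the same $t$. *)

theory Defs
  imports
    "HOL-Analysis.Derivative"
    "HOL-Algebra.Group"
    "Graph_Theory.Digraph_Component"
    "Jordan_Normal_Form.DL_Submatrix"
    "Jordan_Normal_Form.Determinant"
    "Jordan_Normal_Form.VS_Connect"
begin

section \<open>Weighted graphs\<close>

text \<open>
  A finite simple graph \<open>G\<close> is given by its symmetric digraph (\<^locale>\<open>pair_graph\<close>), so that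
  \<open>parcs G\<close> is the arc set \<open>D(G)\<close>; its undirected edges are two-element vertex sets.
\<close>

definition uedges :: "'v pair_pre_digraph \<Rightarrow> 'v set set" where
  "uedges G = (\<lambda>(u, v). {u, v}) ` parcs G"

definition symmetric_weight :: "'v pair_pre_digraph \<Rightarrow> ('v \<times> 'v \<Rightarrow> complex) \<Rightarrow> bool" where
  "symmetric_weight G w \<longleftrightarrow> (\<forall>(u, v) \<in> parcs G. w (v, u) = w (u, v))"

text \<open>The weight of an undirected edge is well defined only for symmetric weights.\<close>

definition uweight :: "('v \<times> 'v \<Rightarrow> complex) \<Rightarrow> 'v set \<Rightarrow> complex" where
  "uweight w e = (THE c. \<exists>u v. e = {u, v} \<and> c = w (u, v))"

definition total_weight :: "'v pair_pre_digraph \<Rightarrow> ('v \<times> 'v \<Rightarrow> complex) \<Rightarrow> complex" where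
  "total_weight G w = (\<Sum>e \<in> uedges G. uweight w e)"

definition wdegree :: "'v pair_pre_digraph \<Rightarrow> ('v \<times> 'v \<Rightarrow> complex) \<Rightarrow> 'v \<Rightarrow> complex" where
  "wdegree G w x = (\<Sum>e \<in> {e \<in> parcs G. fst e = x}. w e)"

text \<open>
  The notion \<^const>\<open>spanning_tree\<close> of the digraph library forbids directed cycles, hence also
  the closed walks \<open>u, v, u\<close> that traverse one undirected edge back and forth. Undirected cycles
  are the cycles of length at least 3 of the symmetric digraph.
\<close>

definition spanning_utrees :: "'v pair_pre_digraph \<Rightarrow> 'v pair_pre_digraph set" where
  "spanning_utrees G = {T. pair_graph T \<and> spanning (with_proj T) (with_proj G) \<and>
     Digraph_Component.connected (with_proj T) \<and>
     \<not> (\<exists>p. pre_digraph.cycle (with_proj T) p \<and> 3 \<le> length p)}"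

definition kappa :: "'v pair_pre_digraph \<Rightarrow> ('v \<times> 'v \<Rightarrow> complex) \<Rightarrow> complex" where
  "kappa G w = (\<Sum>T \<in> spanning_utrees G. \<Prod>e \<in> uedges T. uweight w e)"

text \<open>
  Matrices are taken with respect to an enumeration \<open>vs\<close> of the vertices, with indices starting
  at 0.
\<close>

definition weight_mat ::
  "'v pair_pre_digraph \<Rightarrow> ('v \<times> 'v \<Rightarrow> complex) \<Rightarrow> 'v list \<Rightarrow> complex mat" where
  "weight_mat G w vs = mat (length vs) (length vs)
     (\<lambda>(i, j). if (vs ! i, vs ! j) \<in> parcs G then w (vs ! i, vs ! j) else 0)"

definition degree_mat ::
  "'v pair_pre_digraph \<Rightarrow> ('v \<times> 'v \<Rightarrow> complex) \<Rightarrow> 'v list \<Rightarrow> complex mat" where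
  "degree_mat G w vs = mat (length vs) (length vs)
     (\<lambda>(i, j). if i = j then wdegree G w (vs ! i) else 0)"

definition laplacian ::
  "'v pair_pre_digraph \<Rightarrow> ('v \<times> 'v \<Rightarrow> complex) \<Rightarrow> 'v list \<Rightarrow> complex mat" where
  "laplacian G w vs = degree_mat G w vs - weight_mat G w vs"

definition resistance ::
  "'v pair_pre_digraph \<Rightarrow> ('v \<times> 'v \<Rightarrow> complex) \<Rightarrow> 'v list \<Rightarrow> nat \<Rightarrow> nat \<Rightarrow> complex" where
  "resistance G w vs p q =
     det (submatrix (laplacian G w vs) (- {p, q}) (- {p, q})) / kappa G w"

definition Kfz ::
  "'v pair_pre_digraph \<Rightarrow> ('v \<times> 'v \<Rightarrow> complex) \<Rightarrow> 'v list \<Rightarrow> complex \<Rightarrow> complex" where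
  "Kfz G w vs t = (\<Sum>q < length vs. \<Sum>p < q.
     (wdegree G w (vs ! p) * t - 2) * (wdegree G w (vs ! q) * t - 2) * resistance G w vs p q)"


section \<open>Voltage assignments and derived graphs\<close>

definition ordinary_voltage ::
  "'v pair_pre_digraph \<Rightarrow> ('g, 'b) monoid_scheme \<Rightarrow> ('v \<times> 'v \<Rightarrow> 'g) \<Rightarrow> bool" where
  "ordinary_voltage G \<Gamma> \<alpha> \<longleftrightarrow> (\<forall>(u, v) \<in> parcs G.
     \<alpha> (u, v) \<in> carrier \<Gamma> \<and> \<alpha> (v, u) = inv\<^bsub>\<Gamma>\<^esub> (\<alpha> (u, v)))"

definition derived_graph ::
  "'v pair_pre_digraph \<Rightarrow> ('g, 'b) monoid_scheme \<Rightarrow> ('v \<times> 'v \<Rightarrow> 'g) \<Rightarrow>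
     ('v \<times> 'g) pair_pre_digraph" where
  "derived_graph G \<Gamma> \<alpha> = \<lparr> pverts = pverts G \<times> carrier \<Gamma>,
     parcs = {((u, h), (v, k)) | u v h k. (u, v) \<in> parcs G \<and> h \<in> carrier \<Gamma> \<and>
       k = h \<otimes>\<^bsub>\<Gamma>\<^esub> \<alpha> (u, v)} \<rparr>"

definition derived_weight ::
  "'v pair_pre_digraph \<Rightarrow> ('g, 'b) monoid_scheme \<Rightarrow> ('v \<times> 'v \<Rightarrow> 'g) \<Rightarrow>
     ('v \<times> 'v \<Rightarrow> complex) \<Rightarrow> ('v \<times> 'g) \<times> ('v \<times> 'g) \<Rightarrow> complex" where
  "derived_weight G \<Gamma> \<alpha> w = (\<lambda>((u, g), (v, h)).
     if (u, v) \<in> parcs G \<and> h = g \<otimes>\<^bsub>\<Gamma>\<^esub> \<alpha> (u, v) then w (u, v) else 0)"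

definition voltage_weight_mat ::
  "'v pair_pre_digraph \<Rightarrow> ('v \<times> 'v \<Rightarrow> 'g) \<Rightarrow> ('v \<times> 'v \<Rightarrow> complex) \<Rightarrow> 'v list \<Rightarrow> 'g \<Rightarrow>
     complex mat" where
  "voltage_weight_mat G \<alpha> w vs g = mat (length vs) (length vs)
     (\<lambda>(i, j). if (vs ! i, vs ! j) \<in> parcs G \<and> \<alpha> (vs ! i, vs ! j) = g
       then w (vs ! i, vs ! j) else 0)"


section \<open>Complex matrix representations of a group\<close>

definition matrix_rep ::
  "('g, 'b) monoid_scheme \<Rightarrow> nat \<Rightarrow> ('g \<Rightarrow> complex mat) \<Rightarrow> bool" where
  "matrix_rep \<Gamma> d \<rho> \<longleftrightarrow>
     (\<forall>g \<in> carrier \<Gamma>. \<rho> g \<in> carrier_mat d d \<and> invertible_mat (\<rho> g)) \<and>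
     (\<forall>g \<in> carrier \<Gamma>. \<forall>h \<in> carrier \<Gamma>. \<rho> (g \<otimes>\<^bsub>\<Gamma>\<^esub> h) = \<rho> g * \<rho> h)"

definition irreducible_rep ::
  "('g, 'b) monoid_scheme \<Rightarrow> nat \<Rightarrow> ('g \<Rightarrow> complex mat) \<Rightarrow> bool" where
  "irreducible_rep \<Gamma> d \<rho> \<longleftrightarrow> matrix_rep \<Gamma> d \<rho> \<and> 0 < d \<and>
     (\<forall>U. VectorSpace.subspace class_ring U (module_vec TYPE(complex) d) \<and>
          (\<forall>g \<in> carrier \<Gamma>. \<forall>x \<in> U. \<rho> g *\<^sub>v x \<in> U) \<longrightarrow>
        U = {0\<^sub>v d} \<or> U = carrier_vec d)"

definition equivalent_reps ::
  "('g, 'b) monoid_scheme \<Rightarrow> nat \<Rightarrow> ('g \<Rightarrow> complex mat) \<Rightarrow> nat \<Rightarrow> ('g \<Rightarrow> complex mat) \<Rightarrow> bool"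
  where
  "equivalent_reps \<Gamma> d \<rho> d' \<sigma> \<longleftrightarrow> d = d' \<and>
     (\<exists>P \<in> carrier_mat d d. invertible_mat P \<and> (\<forall>g \<in> carrier \<Gamma>. P * \<rho> g = \<sigma> g * P))"

text \<open>\<open>\<rho> 1, \<dots>, \<rho> k\<close> represent every equivalence class of irreducible representations exactly once.\<close>

definition complete_irreps ::
  "('g, 'b) monoid_scheme \<Rightarrow> nat \<Rightarrow> (nat \<Rightarrow> nat) \<Rightarrow> (nat \<Rightarrow> 'g \<Rightarrow> complex mat) \<Rightarrow> bool" where
  "complete_irreps \<Gamma> k f \<rho> \<longleftrightarrow>
     (\<forall>i \<in> {1..k}. irreducible_rep \<Gamma> (f i) (\<rho> i)) \<and>
     (\<forall>i \<in> {1..k}. \<forall>j \<in> {1..k}. i \<noteq> j \<longrightarrow> \<not> equivalent_reps \<Gamma> (f i) (\<rho> i) (f j) (\<rho> j)) \<and>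
     (\<forall>d \<sigma>. irreducible_rep \<Gamma> d \<sigma> \<longrightarrow> (\<exists>i \<in> {1..k}. equivalent_reps \<Gamma> d \<sigma> (f i) (\<rho> i)))"

definition kronecker :: "complex mat \<Rightarrow> complex mat \<Rightarrow> complex mat" where
  "kronecker A B = mat (dim_row A * dim_row B) (dim_col A * dim_col B)
     (\<lambda>(i, j). A $$ (i div dim_row B, j div dim_col B) * B $$ (i mod dim_row B, j mod dim_col B))"

definition Kdet ::
  "'v pair_pre_digraph \<Rightarrow> ('g, 'b) monoid_scheme \<Rightarrow> ('v \<times> 'v \<Rightarrow> 'g) \<Rightarrow>
     ('v \<times> 'v \<Rightarrow> complex) \<Rightarrow> 'v list \<Rightarrow> nat \<Rightarrow> ('g \<Rightarrow> complex mat) \<Rightarrow>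
     complex \<Rightarrow> complex \<Rightarrow> complex" where
  "Kdet G \<Gamma> \<alpha> w vs d \<rho> u t = (let n = length vs in
     det (1\<^sub>m (n * d)
       - t \<cdot>\<^sub>m finsum (module_mat TYPE(complex) (n * d) (n * d))
             (\<lambda>g. kronecker (\<rho> g) (voltage_weight_mat G \<alpha> w vs g)) (carrier \<Gamma>)
       + ((1 - u) * t\<^sup>2) \<cdot>\<^sub>m
           kronecker (1\<^sub>m d) (degree_mat G w vs - (1 - u) \<cdot>\<^sub>m 1\<^sub>m n)))"

definition dlog :: "(complex \<Rightarrow> complex) \<Rightarrow> complex \<Rightarrow> complex" where
  "dlog F z = deriv F z / F z"

end

theory Submission
  imports Defs "Jordan_Normal_Form.Spectral_Radius"
begin

text \<open>
  Put \<open>c v = d v * t - 2\<close>, let \<open>c\<close> also denote the diagonal matrix with these entries, and consider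
  \<open>det (L + x c)\<close>. By the matrix-tree theorem its expansion starts with
  \<open>\<kappa> (C x + Kf\<^sup>z x\<^sup>2)\<close>, where \<open>C = \<Sum> c = 2 (w(G) t - n)\<close>. For the covering graph the matrix is
  \<open>\<Sum>g. R g \<otimes> X g\<close> with the regular representation \<open>R\<close>, so by Frobenius' factorisation of the group
  determinant it equals \<open>det (L + x c)\<close> times the product of the \<open>det (L\<^sub>i + x c) ^ f i\<close> for \<open>i \<ge> 2\<close>.
  Comparing the coefficients of \<open>x\<close> (for \<open>c = 1\<close>) and of \<open>x\<^sup>2\<close> yields
  \<open>Kf\<^sup>z(G\<^sup>\<alpha>) = r (Kf\<^sup>z(G) + C S)\<close>, where \<open>S\<close> is the logarithmic derivative of the extra factor at \<open>x = 0\<close>.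
  At \<open>u = 1 - 1/t\<close> the matrix defining \<open>K i\<close> is \<open>t L\<^sub>i\<close>, which expresses \<open>S\<close> through the logarithmic
  derivatives of the \<open>K i\<close>.
\<close>

unbundle no vec_syntax

section \<open>Determinants over finite index sets\<close>

text \<open>The sum \<open>C\<close> of the weight \<open>c\<close> can vanish, namely when
  \<open>w(G) t = n\<close>, and then the coefficient of \<open>x\<close> carries no information.
  This is why it is compared for the constant weight 1, whose sum \<open>n\<close> is non-zero. The
  outcome, \<open>r \<kappa>(G\<^sup>\<alpha>) = \<kappa>(G) \<Prod> (det L\<^sub>i) ^ f i\<close>
  with \<open>i \<ge> 2\<close>, also shows that no \<open>L\<^sub>i\<close> is singular, so the
  logarithmic derivatives have non-zero denominators. The entries \<open>d t - 2\<close> of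
  \<open>c\<close> arise by differentiating: at \<open>u = 1 - 1/t\<close> the diagonal entry
  \<open>1 + (1 - u) t\<^sup>2 (d - (1 - u))\<close> has \<open>u\<close>-derivative
  \<open>- t (d t - 2)\<close>. The three formulas are one identity. The weighted
  \<open>u\<close>-derivatives add up to \<open>- S\<close>, and \<open>t\<^sup>2\<close> times the
  weighted \<open>t\<close>-derivatives to \<open>(r - 1) n t + S\<close>, where
  \<open>r - 1\<close> is the sum of the squares \<open>f i * f i\<close> over
  \<open>i \<ge> 2\<close>. The factors built from them are therefore \<open>- S\<close>,
  \<open>- 2 S\<close> and \<open>- S\<close>.\<close>

definition pdet :: "'a set \<Rightarrow> ('a \<Rightarrow> 'a \<Rightarrow> 'c::comm_ring_1) \<Rightarrow> 'c" where
  "pdet S A = (\<Sum>p | p permutes S. of_int (sign p) * (\<Prod>i\<in>S. A i (p i)))"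

text \<open>The directional derivative of the determinant at \<open>A\<close> in direction
  \<open>B\<close>, written out by the product rule.\<close>

definition pdet_deriv :: "'a set \<Rightarrow> ('a \<Rightarrow> 'a \<Rightarrow> 'c::comm_ring_1) \<Rightarrow> ('a \<Rightarrow> 'a \<Rightarrow> 'c) \<Rightarrow> 'c" where
  "pdet_deriv S A B = (\<Sum>p | p permutes S. of_int (sign p) *
     (\<Sum>i\<in>S. B i (p i) * (\<Prod>j\<in>S - {i}. A j (p j))))"

lemma pdet_cong:
  assumes "\<And>i j. i \<in> S \<Longrightarrow> j \<in> S \<Longrightarrow> A i j = B i j"
  shows "pdet S A = pdet S B"
  unfolding pdet_def
  by (intro sum.cong refl arg_cong2[of _ _ _ _ "(*)"] prod.cong)
     (auto simp: assms permutes_in_image)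

text \<open>Conjugation by \<open>h\<close> carries permutations of \<open>S\<close> to permutations
  of \<open>T\<close> and keeps the sign. Determinants can therefore be indexed by vertex sets,
  where a principal minor is a mere restriction to a subset, and be moved to numbered matrices when
  required.\<close>

lemma pdet_reindex:
  assumes "bij_betw h S T" "finite S"
  shows "pdet T A = pdet S (\<lambda>i j. A (h i) (h j))"
proof -
  have inj: "inj_on h S" and im: "h ` S = T" using assms(1) by (auto simp: bij_betw_def)
  have bij: "bij_betw (map_permutation S h) {p. p permutes S} {p. p permutes T}"
  proof (rule bij_betw_byWitness[where f' = "map_permutation T (inv_into S h)"])
    have b': "bij_betw (inv_into S h) T S" using assms(1) by (rule bij_betw_inv_into)
    show "\<forall>p\<in>{p. p permutes S}. map_permutation T (inv_into S h) (map_permutation S h p) = p"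
      using inj by (auto intro!: map_permutation_compose_inv[OF assms(1)])
    show "\<forall>p\<in>{p. p permutes T}. map_permutation S h (map_permutation T (inv_into S h) p) = p"
    proof
      fix p assume "p \<in> {p. p permutes T}"
      hence "p permutes T" by simp
      thus "map_permutation S h (map_permutation T (inv_into S h) p) = p"
        by (rule map_permutation_compose_inv[OF b']) (use im in \<open>auto intro: f_inv_into_f\<close>)
    qed
    show "map_permutation S h ` {p. p permutes S} \<subseteq> {p. p permutes T}"
      using map_permutation_permutes[OF assms(1)] by blast
    show "map_permutation T (inv_into S h) ` {p. p permutes T} \<subseteq> {p. p permutes S}"
      using map_permutation_permutes[OF b'] by blast
  qed
  have sgn: "sign (map_permutation S h p) = sign p" if "p permutes S" for p
    using sign_map_permutation[OF inj that assms(2)] .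
  have "pdet T A = (\<Sum>p | p permutes S. of_int (sign (map_permutation S h p)) *
      (\<Prod>i\<in>T. A i (map_permutation S h p i)))"
    unfolding pdet_def by (rule sum.reindex_bij_betw[OF bij, symmetric])
  also have "\<dots> = pdet S (\<lambda>i j. A (h i) (h j))"
    unfolding pdet_def
  proof (intro sum.cong refl)
    fix p assume p: "p \<in> {p. p permutes S}"
    have "(\<Prod>i\<in>T. A i (map_permutation S h p i)) = (\<Prod>i\<in>S. A (h i) (map_permutation S h p (h i)))"
      unfolding im[symmetric] by (rule prod.reindex_cong[OF inj]) auto
    also have "\<dots> = (\<Prod>i\<in>S. A (h i) (h (p i)))"
      by (intro prod.cong refl) (auto simp: map_permutation_apply[OF inj])
    finally show "of_int (sign (map_permutation S h p)) * (\<Prod>i\<in>T. A i (map_permutation S h p i)) =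
        of_int (sign p) * (\<Prod>i\<in>S. A (h i) (h (p i)))"
      using sgn p by simp
  qed
  finally show ?thesis .
qed

lemma det_eq_pdet:
  "A \<in> carrier_mat N N \<Longrightarrow> det A = pdet {0..<N} (\<lambda>i j. A $$ (i, j))"
  by (simp add: det_def pdet_def)

lemma det_mat_enum:
  assumes "distinct ys"
  shows "det (mat (length ys) (length ys) (\<lambda>(i, j). A (ys ! i) (ys ! j))) = pdet (set ys) A"
proof -
  let ?N = "length ys"
  have "bij_betw (\<lambda>i. ys ! i) {0..<?N} (set ys)"
    using bij_betw_nth[OF assms, of "{..<length ys}" "set ys"] by (simp add: atLeast0LessThan)
  hence "pdet (set ys) A = pdet {0..<?N} (\<lambda>i j. A (ys ! i) (ys ! j))"
    by (rule pdet_reindex) simp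
  also have "\<dots> = pdet {0..<?N} (\<lambda>i j. mat ?N ?N (\<lambda>(i, j). A (ys ! i) (ys ! j)) $$ (i, j))"
    by (rule pdet_cong) auto
  finally show ?thesis by (simp add: det_eq_pdet[of _ ?N])
qed

text \<open>Serves twice: with a constant vector for the full Laplacian, and with the indicator of
  the points trapped in \<open>S\<close> for a function that is not descending.\<close>

lemma pdet_eq_0_if_kernel:
  fixes A :: "'a \<Rightarrow> 'a \<Rightarrow> 'c::field"
  assumes "finite S" "s \<in> S" "x s \<noteq> 0" "\<And>i. i \<in> S \<Longrightarrow> (\<Sum>j\<in>S. A i j * x j) = 0"
  shows "pdet S A = 0"
proof -
  obtain ys where ys: "distinct ys" "set ys = S" using assms(1) finite_distinct_list by blast
  let ?N = "length ys" and ?M = "mat (length ys) (length ys) (\<lambda>(i, j). A (ys ! i) (ys ! j))"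
  let ?v = "vec ?N (\<lambda>i. x (ys ! i))"
  obtain i0 where i0: "i0 < ?N" "ys ! i0 = s" using assms(2) ys by (metis in_set_conv_nth)
  have "?v \<noteq> 0\<^sub>v ?N"
  proof
    assume "?v = 0\<^sub>v ?N"
    hence "?v $ i0 = 0" using i0 by (metis index_zero_vec(1))
    thus False using i0 assms(3) by simp
  qed
  moreover have "?M *\<^sub>v ?v = 0\<^sub>v ?N"
  proof (rule eq_vecI)
    fix i assume "i < dim_vec (0\<^sub>v ?N :: 'c vec)"
    hence i: "i < ?N" by simp
    have "(?M *\<^sub>v ?v) $ i = (\<Sum>j = 0..<?N. A (ys ! i) (ys ! j) * x (ys ! j))"
      using i by (simp add: scalar_prod_def)
    also have "\<dots> = (\<Sum>j\<in>set ys. A (ys ! i) j * x j)"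
      using sum.reindex_bij_betw[OF bij_betw_nth[OF ys(1), of "{0..<?N}" "set ys"], of "\<lambda>j. A (ys ! i) j * x j"]
      by (simp add: atLeast0LessThan)
    also have "\<dots> = 0" using assms(4)[of "ys ! i"] i ys by auto
    finally show "(?M *\<^sub>v ?v) $ i = 0\<^sub>v ?N $ i" using i by simp
  qed simp
  ultimately have "det ?M = 0" using det_0_iff_vec_prod_zero[of ?M ?N] by (metis mat_carrier vec_carrier)
  thus ?thesis using det_mat_enum[OF ys(1), of A] ys(2) by simp
qed

text \<open>Every row chooses between its entry of \<open>A\<close> and the diagonal summand. If the
  rows in \<open>T\<close> choose the diagonal, only permutations fixing \<open>T\<close> pointwise
  survive, which leaves the principal minor on \<open>S - T\<close>. With \<open>x * c i\<close> on
  the diagonal this lists the coefficients of all powers of \<open>x\<close>.\<close>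

lemma pdet_add_diag:
  assumes "finite S"
  shows "pdet S (\<lambda>i j. A i j + (if i = j then c i else 0)) =
    (\<Sum>T\<in>Pow S. prod c T * pdet (S - T) A)"
proof -
  have "pdet S (\<lambda>i j. A i j + (if i = j then c i else 0)) =
     (\<Sum>p | p permutes S. of_int (sign p) * (\<Sum>T\<in>Pow S. (\<Prod>i\<in>T. if i = p i then c i else 0) *
        (\<Prod>i\<in>S-T. A i (p i))))"
    unfolding pdet_def by (subst add.commute) (simp add: prod_add[OF assms])
  also have "\<dots> = (\<Sum>T\<in>Pow S. \<Sum>p | p permutes S. of_int (sign p) *
      ((\<Prod>i\<in>T. if i = p i then c i else 0) * (\<Prod>i\<in>S-T. A i (p i))))"
    unfolding sum_distrib_left by (rule sum.swap)
  also have "\<dots> = (\<Sum>T\<in>Pow S. prod c T * pdet (S - T) A)"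
  proof (rule sum.cong[OF refl])
    fix T assume "T \<in> Pow S"
    hence T: "T \<subseteq> S" "finite T" using assms finite_subset by auto
    have "(\<Sum>p | p permutes S. of_int (sign p) *
        ((\<Prod>i\<in>T. if i = p i then c i else 0) * (\<Prod>i\<in>S-T. A i (p i)))) =
      (\<Sum>p | p permutes (S - T). of_int (sign p) *
        ((\<Prod>i\<in>T. if i = p i then c i else 0) * (\<Prod>i\<in>S-T. A i (p i))))"
    proof (rule sum.mono_neutral_right)
      show "finite {p. p permutes S}" using assms by (rule finite_permutations)
      show "{p. p permutes S - T} \<subseteq> {p. p permutes S}"
        by (auto intro: permutes_subset)
      show "\<forall>p\<in>{p. p permutes S} - {p. p permutes S - T}. of_int (sign p) *
        ((\<Prod>i\<in>T. if i = p i then c i else 0) * (\<Prod>i\<in>S-T. A i (p i))) = 0"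
      proof
        fix p assume p: "p \<in> {p. p permutes S} - {p. p permutes S - T}"
        have "\<exists>i\<in>T. i \<noteq> p i"
        proof (rule ccontr)
          assume "\<not> (\<exists>i\<in>T. i \<noteq> p i)"
          hence "p permutes (S - T)" using p permutes_superset[of p S "S - T"] by auto
          thus False using p by simp
        qed
        hence "(\<Prod>i\<in>T. if i = p i then c i else 0) = 0"
          using T(2) by (intro prod_zero) (auto intro: rev_bexI)
        thus "of_int (sign p) * ((\<Prod>i\<in>T. if i = p i then c i else 0) * (\<Prod>i\<in>S-T. A i (p i))) = 0"
          by simp
      qed
    qed
    also have "\<dots> = (\<Sum>p | p permutes (S - T). of_int (sign p) * (prod c T * (\<Prod>i\<in>S-T. A i (p i))))"
    proof (intro sum.cong refl arg_cong2[of _ _ _ _ "(*)"] prod.cong)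
      fix p i assume "p \<in> {p. p permutes S - T}" "i \<in> T"
      hence "p i = i" by (auto simp: permutes_def)
      thus "(if i = p i then c i else 0) = c i" by simp
    qed
    also have "\<dots> = prod c T * pdet (S - T) A"
      unfolding pdet_def sum_distrib_left by (intro sum.cong refl) (simp add: mult_ac)
    finally show "(\<Sum>p | p permutes S. of_int (sign p) *
        ((\<Prod>i\<in>T. if i = p i then c i else 0) * (\<Prod>i\<in>S-T. A i (p i)))) = prod c T * pdet (S - T) A" .
  qed
  finally show ?thesis .
qed

text \<open>Multilinearity in the rows: row \<open>i\<close> chooses the summand
  \<open>f i\<close>.\<close>

lemma pdet_sum_rows:
  assumes "finite S" "finite V"
  shows "pdet S (\<lambda>i j. \<Sum>x\<in>V. a i x * B i x j) =
    (\<Sum>f\<in>S \<rightarrow>\<^sub>E V. (\<Prod>i\<in>S. a i (f i)) * pdet S (\<lambda>i j. B i (f i) j))"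
proof -
  have "pdet S (\<lambda>i j. \<Sum>x\<in>V. a i x * B i x j) =
    (\<Sum>p | p permutes S. \<Sum>f\<in>S \<rightarrow>\<^sub>E V. of_int (sign p) * (\<Prod>i\<in>S. a i (f i) * B i (f i) (p i)))"
    unfolding pdet_def by (simp add: prod_sum_PiE[OF assms(1) assms(2)] sum_distrib_left)
  also have "\<dots> = (\<Sum>f\<in>S \<rightarrow>\<^sub>E V. (\<Prod>i\<in>S. a i (f i)) * pdet S (\<lambda>i j. B i (f i) j))"
    unfolding pdet_def sum_distrib_left
    by (subst sum.swap) (simp add: prod.distrib mult_ac)
  finally show ?thesis .
qed

lemma has_field_derivative_pdet:
  fixes M :: "complex \<Rightarrow> 'a \<Rightarrow> 'a \<Rightarrow> complex"
  assumes "\<And>i j. i \<in> S \<Longrightarrow> j \<in> S \<Longrightarrow> ((\<lambda>x. M x i j) has_field_derivative M' i j) (at z)"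
  shows "((\<lambda>x. pdet S (M x)) has_field_derivative pdet_deriv S (M z) M') (at z)"
proof -
  have "((\<lambda>x. \<Prod>i\<in>S. M x i (p i)) has_field_derivative
      (\<Sum>i\<in>S. M' i (p i) * (\<Prod>j\<in>S - {i}. M z j (p j)))) (at z)" if "p permutes S" for p
    by (rule has_field_derivative_prod) (use assms that in \<open>auto simp: permutes_in_image\<close>)
  thus ?thesis unfolding pdet_def pdet_deriv_def
    by (intro DERIV_sum DERIV_cmult) auto
qed

lemma pdet_deriv_add:
  "pdet_deriv S A (\<lambda>i j. B i j + C i j) = pdet_deriv S A B + pdet_deriv S A C"
  unfolding pdet_deriv_def by (simp add: algebra_simps sum.distrib)

lemma pdet_deriv_scale:
  "pdet_deriv S A (\<lambda>i j. b * B i j) = b * pdet_deriv S A B"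
  unfolding pdet_deriv_def sum_distrib_left by (simp add: mult_ac)

text \<open>Euler's identity for a form of degree \<open>card S\<close> in the matrix
  entries.\<close>

lemma pdet_deriv_self:
  assumes "finite S"
  shows "pdet_deriv S A A = of_nat (card S) * pdet S A"
proof -
  have "(\<Sum>i\<in>S. A i (p i) * (\<Prod>j\<in>S - {i}. A j (p j))) = of_nat (card S) * (\<Prod>i\<in>S. A i (p i))" for p
  proof -
    have "(\<Sum>i\<in>S. A i (p i) * (\<Prod>j\<in>S - {i}. A j (p j))) = (\<Sum>i\<in>S. \<Prod>j\<in>S. A j (p j))"
      using assms by (intro sum.cong refl) (simp add: prod.remove)
    thus ?thesis by simp
  qed
  hence "pdet_deriv S A A =
      (\<Sum>p | p permutes S. of_int (sign p) * (of_nat (card S) * (\<Prod>i\<in>S. A i (p i))))"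
    unfolding pdet_deriv_def by simp
  also have "\<dots> = of_nat (card S) * pdet S A"
    unfolding pdet_def sum_distrib_left by (simp add: mult_ac)
  finally show ?thesis .
qed

lemma pdet_scale:
  "pdet S (\<lambda>i j. b * A i j) = b ^ card S * pdet S A"
  unfolding pdet_def sum_distrib_left by (simp add: prod.distrib mult_ac)

text \<open>Each term contains one entry of \<open>B\<close> and \<open>card S - 1\<close> entries
  of \<open>A\<close>.\<close>

lemma pdet_deriv_scale_both:
  assumes "finite S"
  shows "pdet_deriv S (\<lambda>i j. b * A i j) (\<lambda>i j. b * B i j) = b ^ card S * pdet_deriv S A B"
proof -
  have "b * B i (p i) * (\<Prod>j\<in>S - {i}. b * A j (p j)) =
      b ^ card S * (B i (p i) * (\<Prod>j\<in>S - {i}. A j (p j)))" if "i \<in> S" for i p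
  proof -
    have "b ^ card S = b * b ^ card (S - {i})"
      using card_Suc_Diff1[OF assms that] by (metis power_Suc)
    thus ?thesis by (simp add: prod.distrib mult_ac)
  qed
  thus ?thesis unfolding pdet_deriv_def sum_distrib_left
    by (intro sum.cong refl) (simp add: mult_ac)
qed

lemma det_submatrix_eq_pdet:
  assumes "A \<in> carrier_mat N N"
  shows "det (submatrix A I I) = pdet ({0..<N} \<inter> I) (\<lambda>i j. A $$ (i, j))"
proof -
  define S where "S = {i. i < N \<and> i \<in> I}"
  define ys where "ys = map (pick S) [0..<card S]"
  \<comment> \<open>\<open>I\<close> may be infinite, as the complement \<open>- {p, q}\<close> is;
    its picks below \<open>N\<close> agree with those of the finite set \<open>S\<close>.\<close>
  have pk: "pick I i = pick S i" if "i < card S" for i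
    using pick_reduce_set[of i N I] that unfolding S_def by simp
  have fin: "finite S" by (simp add: S_def)
  have "inj_on (pick S) {0..<card S}"
  proof (rule linorder_inj_onI')
    fix i j assume "j \<in> {0..<card S}" "i < j"
    thus "pick S i \<noteq> pick S j" using pick_mono_le[of j S i] by simp
  qed
  hence d: "distinct ys" by (simp add: distinct_map ys_def)
  have sub: "set ys \<subseteq> S" unfolding ys_def using pick_in_set_le by auto
  have "card (set ys) = card S" using distinct_card[OF d] by (simp add: ys_def)
  hence st: "set ys = S" using card_subset_eq[OF fin sub] by blast
  have "submatrix A I I = mat (length ys) (length ys) (\<lambda>(i, j). A $$ (ys ! i, ys ! j))"
    using assms pk by (intro eq_matI) (auto simp: submatrix_def S_def[symmetric] ys_def)
  hence "det (submatrix A I I) = pdet S (\<lambda>i j. A $$ (i, j))"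
    using det_mat_enum[OF d, of "\<lambda>i j. A $$ (i, j)"] unfolding st by simp
  moreover have "S = {0..<N} \<inter> I" by (auto simp: S_def)
  ultimately show ?thesis by simp
qed

section \<open>The matrix-tree theorem\<close>

text \<open>Equivalently, no orbit of \<open>f\<close> remains in \<open>S\<close> forever; the exit
  time is then such a height \<open>d\<close>. The existential form provides a measure for
  inductions along \<open>f\<close>.\<close>

definition descending :: "'v set \<Rightarrow> ('v \<Rightarrow> 'v) \<Rightarrow> bool" where
  "descending S f \<longleftrightarrow> (\<exists>d :: 'v \<Rightarrow> nat. \<forall>v\<in>S. d (f v) < d v)"

text \<open>The matrix is \<open>I - F\<close> with the 0/1 matrix \<open>F\<close> of
  \<open>f\<close>. A permutation with a non-zero term agrees with \<open>f\<close> at every point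
  that it moves, so a moved point would start an infinite descent. Only the identity remains, and
  its term is 1 because \<open>f i \<noteq> i\<close>.\<close>

lemma pdet_function_graph_descending:
  fixes f :: "'v \<Rightarrow> 'v"
  assumes "finite S" "descending S f"
  shows "pdet S (\<lambda>i j. (if i = j then 1 else 0) - (if f i = j then 1 else 0)) = (1 :: 'c::comm_ring_1)"
proof -
  obtain d :: "'v \<Rightarrow> nat" where d: "\<forall>v\<in>S. d (f v) < d v"
    using assms(2) by (auto simp: descending_def)
  let ?B = "\<lambda>i j. (if i = j then 1 else 0) - (if f i = j then 1 else 0) :: 'c"
  have 0: "(\<Prod>i\<in>S. ?B i (p i)) = 0" if p: "p permutes S" "p \<noteq> id" for p
  proof (rule ccontr)
    assume nz: "(\<Prod>i\<in>S. ?B i (p i)) \<noteq> 0"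
    have step: "p i = f i" if "i \<in> S" "p i \<noteq> i" for i
    proof (rule ccontr)
      assume "p i \<noteq> f i"
      hence "?B i (p i) = 0" using that by auto
      thus False using nz that(1) assms(1) by (meson prod_zero)
    qed
    obtain i where "p i \<noteq> i" using p(2) by (auto simp: fun_eq_iff)
    thus False
    proof (induction "d i" arbitrary: i rule: less_induct)
      case less
      have i: "i \<in> S" using less.prems p(1) by (auto simp: permutes_def)
      have "p i = f i" using step i less.prems by blast
      hence "d (p i) < d i" using d i by simp
      moreover have "p (p i) \<noteq> p i"
        using less.prems permutes_inj[OF p(1)] by (auto dest: injD)
      ultimately show False using less.hyps by blast
    qed
  qed
  have "pdet S ?B = (\<Sum>p\<in>{id}. of_int (sign p) * (\<Prod>i\<in>S. ?B i (p i)))"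
    unfolding pdet_def
    by (rule sum.mono_neutral_right) (auto simp: finite_permutations[OF assms(1)] permutes_id 0)
  also have "\<dots> = (\<Prod>i\<in>S. 1)"
  proof -
    have "f i \<noteq> i" if "i \<in> S" for i using d that by force
    thus ?thesis by (simp add: sign_id)
  qed
  finally show ?thesis by simp
qed

text \<open>The points whose orbit never leaves \<open>S\<close> form a non-empty set
  \<open>C\<close>. Its indicator is a kernel vector, because for \<open>v\<close> in
  \<open>S\<close> the point \<open>f v\<close> is trapped exactly when \<open>v\<close> is.\<close>

lemma pdet_function_graph_not_descending:
  fixes f :: "'v \<Rightarrow> 'v"
  assumes "finite S" "\<not> descending S f"
  shows "pdet S (\<lambda>i j. (if i = j then 1 else 0) - (if f i = j then 1 else 0)) = (0 :: 'c::field)"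
proof -
  \<comment> \<open>\<open>h\<close> freezes the points outside \<open>S\<close>, so that an orbit
    which has left \<open>S\<close> cannot come back.\<close>
  define h where "h v = (if v \<in> S then f v else v)" for v
  define C where "C = {v. \<forall>k. (h ^^ k) v \<in> S}"
  have CS: "C \<subseteq> S" unfolding C_def by (auto dest: spec[of _ 0])
  have Ciff: "f v \<in> C \<longleftrightarrow> v \<in> C" if "v \<in> S" for v
  proof -
    have "(\<forall>k. (h ^^ k) v \<in> S) \<longleftrightarrow> (\<forall>k. (h ^^ Suc k) v \<in> S)"
      using that by (metis funpow_0 not0_implies_Suc)
    moreover have "(h ^^ Suc k) v = (h ^^ k) (f v)" for k
      using that by (simp add: funpow_swap1 h_def)
    ultimately show ?thesis by (simp add: C_def)
  qed
  have "C \<noteq> {}"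
  proof
    assume "C = {}"
    hence ex: "\<exists>k. (h ^^ k) v \<notin> S" for v by (auto simp: C_def)
    \<comment> \<open>The exit time from \<open>S\<close>, which would be a height for
      \<open>f\<close> if every orbit left \<open>S\<close>.\<close>
    define d where "d v = (LEAST k. (h ^^ k) v \<notin> S)" for v
    have "d (f v) < d v" if v: "v \<in> S" for v
    proof -
      have l: "(h ^^ d v) v \<notin> S" unfolding d_def by (rule LeastI_ex[OF ex])
      then obtain j where j: "d v = Suc j" using v by (cases "d v") auto
      have "(h ^^ j) (f v) \<notin> S" using l v unfolding j by (simp add: funpow_swap1 h_def)
      hence "d (f v) \<le> j" unfolding d_def[of "f v"] by (rule Least_le)
      thus ?thesis using j by simp
    qed
    thus False using assms(2) by (auto simp: descending_def)
  qed
  then obtain s where s: "s \<in> C" by blast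
  let ?x = "\<lambda>v. if v \<in> C then 1 else 0 :: 'c"
  show ?thesis
  proof (rule pdet_eq_0_if_kernel[OF assms(1), where s = s and x = ?x])
    show "s \<in> S" using s CS by blast
    show "?x s \<noteq> 0" using s by simp
    fix i assume i: "i \<in> S"
    have "(\<Sum>j\<in>S. ((if i = j then 1 else 0) - (if f i = j then 1 else 0)) * ?x j) =
        (\<Sum>j\<in>S. (if i = j then ?x j else 0)) - (\<Sum>j\<in>S. (if f i = j then ?x j else 0))"
      unfolding sum_subtractf[symmetric] by (intro sum.cong refl) auto
    also have "\<dots> = ?x i - (if f i \<in> S then ?x (f i) else 0)"
      using assms(1) i by simp
    also have "\<dots> = 0" using Ciff[OF i] CS by auto
    finally show "(\<Sum>j\<in>S. ((if i = j then 1 else 0) - (if f i = j then 1 else 0)) * ?x j) = 0" .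
  qed
qed

text \<open>
  Row \<open>v\<close> of the Laplacian is the sum of the \<open>a v x * (e\<^sub>v - e\<^sub>x)\<close>. Expanding all rows leaves one term
  for every function \<open>f\<close> on the rows, with coefficient 1 or 0 by the two preceding lemmas.
\<close>

lemma pdet_laplacian_minor:
  fixes a :: "'v \<Rightarrow> 'v \<Rightarrow> 'c::field"
  assumes "finite V" "S \<subseteq> V"
  shows "pdet S (\<lambda>i j. (if i = j then \<Sum>x\<in>V. a i x else 0) - a i j) =
    (\<Sum>f\<in>{f \<in> S \<rightarrow>\<^sub>E V. descending S f}. \<Prod>v\<in>S. a v (f v))"
proof -
  have fS: "finite S" using assms finite_subset by blast
  have "pdet S (\<lambda>i j. (if i = j then \<Sum>x\<in>V. a i x else 0) - a i j) =
      pdet S (\<lambda>i j. \<Sum>x\<in>V. a i x * ((if i = j then 1 else 0) - (if x = j then 1 else 0)))"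
  proof (rule pdet_cong)
    fix i j assume ij: "i \<in> S" "j \<in> S"
    have "(\<Sum>x\<in>V. a i x * ((if i = j then 1 else 0) - (if x = j then 1 else 0))) =
       (\<Sum>x\<in>V. a i x * (if i = j then 1 else 0)) - (\<Sum>x\<in>V. if x = j then a i x else 0)"
      unfolding sum_subtractf[symmetric] by (intro sum.cong refl) (auto simp: algebra_simps)
    also have "\<dots> = (if i = j then \<Sum>x\<in>V. a i x else 0) - a i j"
      using ij assms by (auto simp: sum_distrib_right[symmetric])
    finally show "(if i = j then \<Sum>x\<in>V. a i x else 0) - a i j =
      (\<Sum>x\<in>V. a i x * ((if i = j then 1 else 0) - (if x = j then 1 else 0)))" by simp
  qed
  also have "\<dots> = (\<Sum>f\<in>S \<rightarrow>\<^sub>E V. (\<Prod>i\<in>S. a i (f i)) *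
      pdet S (\<lambda>i j. (if i = j then 1 else 0) - (if f i = j then 1 else 0)))"
    by (rule pdet_sum_rows[OF fS assms(1)])
  also have "\<dots> = (\<Sum>f\<in>S \<rightarrow>\<^sub>E V. if descending S f then (\<Prod>i\<in>S. a i (f i)) else 0)"
    by (intro sum.cong refl)
       (simp add: pdet_function_graph_descending[OF fS] pdet_function_graph_not_descending[OF fS])
  also have "\<dots> = (\<Sum>f\<in>{f \<in> S \<rightarrow>\<^sub>E V. descending S f}. \<Prod>v\<in>S. a v (f v))"
    using assms fS by (simp add: sum.If_cases finite_PiE Int_def)
  finally show ?thesis .
qed

section \<open>Spanning trees as parent functions towards a root\<close>

definition parent_graph :: "'v set \<Rightarrow> 'v set \<Rightarrow> ('v \<Rightarrow> 'v) \<Rightarrow> 'v pair_pre_digraph" where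
  "parent_graph V S f = \<lparr> pverts = V, parcs = (\<Union>v\<in>S. {(v, f v), (f v, v)}) \<rparr>"

lemma parent_graph_simps [simp]:
  "pverts (parent_graph V S f) = V"
  "parcs (parent_graph V S f) = (\<Union>v\<in>S. {(v, f v), (f v, v)})"
  by (simp_all add: parent_graph_def)

text \<open>The index wraps around, so the neighbours of any arc on a cycle are addressed without
  treating the two ends separately.\<close>

lemma pcas_closed_nth:
  assumes "pcas u c u" "i < length c"
  shows "snd (c ! i) = fst (c ! (Suc i mod length c))"
proof (cases "Suc i = length c")
  case False
  have "snd (c ! i) = fst (c ! Suc i)" if "pcas u c v" "Suc i < length c" for u v i and c :: "('a \<times> 'a) list"
    using that
  proof (induction c arbitrary: u i)
    case (Cons e c)
    show ?case
    proof (cases i)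
      case 0 thus ?thesis using Cons.prems by (cases c) auto
    next
      case (Suc k) thus ?thesis using Cons.IH[of "snd e" k] Cons.prems by simp
    qed
  qed simp
  thus ?thesis using assms False by auto
next
  case True
  have "snd (last c) = v" if "pcas u c v" "c \<noteq> []" for u v and c :: "('a \<times> 'a) list"
    using that by (induction c arbitrary: u) auto
  moreover have "c \<noteq> []" "fst (c ! 0) = u" using assms by (cases c; auto)+
  moreover have "c ! i = last c" using True \<open>c \<noteq> []\<close> by (metis diff_Suc_1 last_conv_nth)
  ultimately show ?thesis using True assms(1) by simp
qed

context pair_graph
begin

lemma symmetric_arcs: "(u, v) \<in> parcs G \<Longrightarrow> (v, u) \<in> parcs G"
  using pair_sym_arcs by (auto simp: symmetric_def sym_def)

lemma connected_iff_reachable: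
  "Digraph_Component.connected (with_proj G) \<longleftrightarrow>
     pverts G \<noteq> {} \<and> (\<forall>u\<in>pverts G. \<forall>v\<in>pverts G. u \<rightarrow>\<^sup>*\<^bsub>with_proj G\<^esub> v)"
  using reachable_mk_symmetric_eq[OF pair_sym_arcs]
  by (auto simp: connected_def strongly_connected_def)

end

lemma uweight_arc:
  assumes "symmetric_weight G w" "(u, v) \<in> parcs G"
  shows "uweight w {u, v} = w (u, v)"
  unfolding uweight_def
proof (rule the_equality)
  show "\<exists>ua va. {u, v} = {ua, va} \<and> w (u, v) = w (ua, va)" by blast
  fix c assume "\<exists>ua va. {u, v} = {ua, va} \<and> c = w (ua, va)"
  thus "c = w (u, v)" using assms by (auto simp: doubleton_eq_iff symmetric_weight_def)
qed

locale rooted_graph = pair_graph G for G :: "'v pair_pre_digraph" +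
  fixes root :: 'v
  assumes root: "root \<in> pverts G"
begin

abbreviation "nonroot \<equiv> pverts G - {root}"

text \<open>The spanning trees oriented towards \<open>root\<close>: \<open>f v\<close> is the
  parent of \<open>v\<close>, and \<open>descending\<close> forces every chain of parents to end at
  \<open>root\<close>. Extensionality leaves one function for each tree.\<close>

definition parents :: "('v \<Rightarrow> 'v) set" where
  "parents = {f \<in> nonroot \<rightarrow>\<^sub>E pverts G. descending nonroot f \<and> (\<forall>v\<in>nonroot. (v, f v) \<in> parcs G)}"

abbreviation "tree_of \<equiv> parent_graph (pverts G) nonroot"

lemma pair_graph_tree_of:
  assumes "f \<in> parents"
  shows "pair_graph (tree_of f)"
proof -
  have arcs: "(v, f v) \<in> parcs G" "(f v, v) \<in> parcs G" if "v \<in> nonroot" for v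
    using assms that symmetric_arcs by (auto simp: parents_def)
  have fV: "f v \<in> pverts G" if "v \<in> pverts G" "v \<noteq> root" for v
    using assms that by (auto simp: parents_def)
  show ?thesis
  proof
    show "\<And>e. e \<in> parcs (tree_of f) \<Longrightarrow> fst e \<in> pverts (tree_of f)"
      "\<And>e. e \<in> parcs (tree_of f) \<Longrightarrow> snd e \<in> pverts (tree_of f)"
      by (auto intro: fV)
    show "finite (pverts (tree_of f))" "finite (parcs (tree_of f))"
      using pair_finite_verts by auto
    show "\<And>e. e \<in> parcs (tree_of f) \<Longrightarrow> fst e \<noteq> snd e"
      using pair_no_loops[OF arcs(1)] by force
    show "symmetric (with_proj (tree_of f))"
      by (auto simp: symmetric_def sym_def)
  qed
qed

lemma tree_of_reaches_root:
  assumes "f \<in> parents" "v \<in> pverts G"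
  shows "v \<rightarrow>\<^sup>*\<^bsub>with_proj (tree_of f)\<^esub> root"
proof -
  interpret T: pair_graph "tree_of f" by (rule pair_graph_tree_of[OF assms(1)])
  obtain d :: "'v \<Rightarrow> nat" where d: "\<forall>v\<in>nonroot. d (f v) < d v"
    using assms(1) by (auto simp: parents_def descending_def)
  show ?thesis using assms(2)
  proof (induction "d v" arbitrary: v rule: less_induct)
    case less
    show ?case
    proof (cases "v = root")
      case True thus ?thesis using root by (simp add: T.reachable_refl)
    next
      case False
      hence v: "v \<in> nonroot" using less.prems by simp
      hence fv: "f v \<in> pverts G" using assms(1) by (auto simp: parents_def)
      have "f v \<rightarrow>\<^sup>*\<^bsub>with_proj (tree_of f)\<^esub> root" using less.hyps fv d v by blast
      moreover have "(v, f v) \<in> parcs (tree_of f)" using v by auto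
      ultimately show ?thesis by (metis T.adj_reachable_trans with_proj_simps(3))
    qed
  qed
qed

text \<open>At a vertex \<open>x\<close> of maximal height on the cycle, both neighbours
  \<open>y\<close> and \<open>z\<close> are no higher than \<open>x\<close>, hence both are the
  parent \<open>f x\<close>. The vertices of a cycle are distinct, so the positions before and after
  \<open>x\<close> coincide.\<close>

lemma tree_of_no_cycle:
  assumes "f \<in> parents" "pre_digraph.cycle (with_proj (tree_of f)) c"
  shows "length c < 3"
proof (rule ccontr)
  assume len: "\<not> length c < 3"
  interpret T: pair_graph "tree_of f" by (rule pair_graph_tree_of[OF assms(1)])
  obtain d :: "'v \<Rightarrow> nat" where d: "\<forall>v\<in>nonroot. d (f v) < d v"
    using assms(1) by (auto simp: parents_def descending_def)
  obtain u where u: "T.awalk u c u" "distinct (tl (pawalk_verts u c))" "c \<noteq> []"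
    using assms(2) T.cycle_def by auto
  let ?k = "length c"
  have cas: "pcas u c u" and arcs: "set c \<subseteq> parcs (tree_of f)"
    using u(1) T.awalk_def by auto
  have succ: "snd (c ! i) = fst (c ! (Suc i mod ?k))" if "i < ?k" for i
    using pcas_closed_nth[OF cas that] .
  have "tl (pawalk_verts u c) = map snd c"
  proof -
    have "pcas u c v \<Longrightarrow> pawalk_verts u c = u # map snd c" for u v
      by (induction c arbitrary: u) auto
    thus ?thesis using cas by simp
  qed
  hence dist: "distinct (map snd c)" using u(2) by simp
  define M where "M = Max ((\<lambda>e. d (snd e)) ` set c)"
  have max: "d (snd e) \<le> M" if "e \<in> set c" for e unfolding M_def using that by simp
  have "M \<in> (\<lambda>e. d (snd e)) ` set c" unfolding M_def using u(3) by (intro Max_in) auto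
  then obtain a where a: "a < ?k" "d (snd (c ! a)) = M" by (auto simp: in_set_conv_nth)
  define b where "b = Suc a mod ?k"
  have b: "b < ?k" using a(1) unfolding b_def by (intro mod_less_divisor) auto
  have "\<exists>a'<?k. Suc a' mod ?k = a"
  proof (cases a)
    case 0
    hence "Suc (?k - 1) mod ?k = a" using a(1) by simp
    thus ?thesis using a(1) by (intro exI[of _ "?k - 1"]) auto
  next
    case (Suc a') thus ?thesis using a(1) by (intro exI[of _ a']) auto
  qed
  then obtain a' where a': "a' < ?k" "Suc a' mod ?k = a" by blast
  define x y z where "x = snd (c ! a)" and "y = snd (c ! a')" and "z = snd (c ! b)"
  have ea: "c ! a = (y, x)" using succ[OF a'(1)] a'(2) by (simp add: x_def y_def prod_eq_iff)
  have eb: "c ! b = (x, z)" using succ[OF a(1)] by (simp add: x_def z_def b_def prod_eq_iff)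
  have dy: "d y \<le> d x" and dz: "d z \<le> d x"
    using max[of "c ! a'"] max[of "c ! b"] a a' b by (auto simp: x_def y_def z_def)
  have "c ! a \<in> parcs (tree_of f)" "c ! b \<in> parcs (tree_of f)"
    using arcs nth_mem[OF a(1)] nth_mem[OF b] by blast+
  \<comment> \<open>The other way in which this arc can arise, \<open>x' = f y'\<close>, would give
    \<open>d x' < d y'\<close>.\<close>
  moreover have "y' = f x'" if "(y', x') \<in> parcs (tree_of f)" "d y' \<le> d x'" for x' y'
    using that d by (auto simp: not_less[symmetric])
  ultimately have "y = f x" "z = f x"
    unfolding ea eb using dy dz T.symmetric_arcs by blast+
  hence "map snd c ! a' = map snd c ! b" using a' b by (simp add: y_def z_def)
  hence "a' = b" using nth_eq_iff_index_eq[OF dist, of a' b] a'(1) b by simp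
  \<comment> \<open>Two steps along the cycle lead back to position \<open>a\<close>, which is
    impossible for length at least 3.\<close>
  hence "Suc (Suc a mod ?k) mod ?k = a" using a'(2) b_def by simp
  thus False using a(1) len by (auto simp: mod_Suc split: if_splits)
qed

lemma tree_of_in_spanning_utrees:
  assumes "f \<in> parents"
  shows "tree_of f \<in> spanning_utrees G"
proof -
  interpret T: pair_graph "tree_of f" by (rule pair_graph_tree_of[OF assms(1)])
  have "parcs (tree_of f) \<subseteq> parcs G"
    using assms symmetric_arcs by (auto simp: parents_def)
  hence "spanning (with_proj (tree_of f)) (with_proj G)"
    by (auto simp: spanning_def subgraph_def compatible_def
        intro: T.wf_digraph_axioms wf_digraph_axioms)
  moreover have "Digraph_Component.connected (with_proj (tree_of f))"
    unfolding T.connected_iff_reachable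
  proof (intro conjI ballI)
    fix u v assume "u \<in> pverts (tree_of f)" "v \<in> pverts (tree_of f)"
    hence "u \<rightarrow>\<^sup>*\<^bsub>with_proj (tree_of f)\<^esub> root" "v \<rightarrow>\<^sup>*\<^bsub>with_proj (tree_of f)\<^esub> root"
      using tree_of_reaches_root[OF assms] by simp_all
    from this(1) T.symmetric_reachable'[OF this(2)]
    show "u \<rightarrow>\<^sup>*\<^bsub>with_proj (tree_of f)\<^esub> v" by (rule T.reachable_trans)
  qed (use root in auto)
  moreover have "\<not> (\<exists>p. pre_digraph.cycle (with_proj (tree_of f)) p \<and> 3 \<le> length p)"
    using tree_of_no_cycle[OF assms] by (auto simp: not_le[symmetric])
  ultimately show ?thesis using T.pair_graph_axioms by (simp add: spanning_utrees_def)
qed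

text \<open>If \<open>f v \<noteq> g v\<close>, the edge from \<open>v\<close> to \<open>f v\<close>
  occurs in the tree of \<open>g\<close> only as the parent edge of \<open>f v\<close>, so
  \<open>g (f v) = v\<close>. Since \<open>f v\<close> is lower, induction gives
  \<open>f (f v) = v\<close>, against the descent.\<close>

lemma inj_on_tree_of: "inj_on tree_of parents"
proof (rule inj_onI)
  fix f g assume f: "f \<in> parents" and g: "g \<in> parents" and eq: "tree_of f = tree_of g"
  obtain d :: "'v \<Rightarrow> nat" where d: "\<forall>v\<in>nonroot. d (f v) < d v"
    using f by (auto simp: parents_def descending_def)
  have "f v = g v" if "v \<in> nonroot" for v
    using that
  proof (induction "d v" arbitrary: v rule: less_induct)
    case less
    show ?case
    proof (rule ccontr)
      assume ne: "f v \<noteq> g v"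
      have "(v, f v) \<in> parcs (tree_of f)" using less.prems by auto
      hence "(v, f v) \<in> parcs (tree_of g)" using eq by simp
      hence "f v \<in> nonroot \<and> g (f v) = v" using ne by auto
      moreover have "d (f v) < d v" using d less.prems by blast
      ultimately have "f (f v) = v" "f v \<in> nonroot" using less.hyps[of "f v"] by auto
      hence "d v < d (f v)" using d[rule_format, of "f v"] by simp
      thus False using \<open>d (f v) < d v\<close> by simp
    qed
  qed
  thus "f = g" using f g by (intro PiE_ext[of f nonroot "\<lambda>_. pverts G"]) (auto simp: parents_def)
qed

text \<open>The parent of \<open>v\<close> is the next vertex on a shortest walk to the root, with
  the distance \<open>d\<close> as height. An arc \<open>(u, v)\<close> of \<open>T\<close> outside
  the resulting tree closes up with the tree path from \<open>v\<close> to \<open>u\<close>. As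
  \<open>T\<close> has no cycle of length 3 or more, that path is the single arc
  \<open>(v, u)\<close>, whose reverse then lies in the tree after all.\<close>

lemma spanning_utree_is_tree_of:
  assumes "T \<in> spanning_utrees G"
  shows "T \<in> tree_of ` parents"
proof -
  interpret T: pair_graph T using assms by (simp add: spanning_utrees_def)
  have V: "pverts T = pverts G" and sub: "parcs T \<subseteq> parcs G"
    using assms by (auto simp: spanning_utrees_def spanning_def subgraph_def)
  have nocyc: "length c < 3" if "T.cycle c" for c
    using assms that by (auto simp: spanning_utrees_def not_le[symmetric])
  have reach: "v \<rightarrow>\<^sup>*\<^bsub>with_proj T\<^esub> root" if "v \<in> pverts G" for v
    using assms that root unfolding spanning_utrees_def
    by (auto simp: T.connected_iff_reachable V)
  define d where "d v = (LEAST k. \<exists>q. T.awalk v q root \<and> length q = k)" for v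
  have "\<exists>x. (v, x) \<in> parcs T \<and> d x < d v" if v: "v \<in> nonroot" for v
  proof -
    have "\<exists>k q. T.awalk v q root \<and> length q = k"
      using reach[of v] v T.reachable_awalk by auto
    hence "\<exists>q. T.awalk v q root \<and> length q = d v" unfolding d_def by (rule LeastI_ex)
    then obtain q where q: "T.awalk v q root" "length q = d v" by blast
    obtain e es where es: "q = e # es" using q v by (cases q) (auto simp: T.awalk_Nil_iff)
    have e: "e \<in> parcs T" "v = fst e" "T.awalk (snd e) es root"
      using q(1) unfolding es T.awalk_Cons_iff by auto
    have "d (snd e) \<le> length es" unfolding d_def by (rule Least_le) (use e in blast)
    hence "d (snd e) < d v" using q(2) es by simp
    thus ?thesis using e by (metis prod.collapse)
  qed
  then obtain h where h: "\<And>v. v \<in> nonroot \<Longrightarrow> (v, h v) \<in> parcs T \<and> d (h v) < d v" by metis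
  define f where "f = restrict h nonroot"
  have f: "f \<in> parents"
    unfolding parents_def
  proof (intro CollectI conjI ballI)
    show "f \<in> nonroot \<rightarrow>\<^sub>E pverts G"
      unfolding f_def using h T.in_arcsD2 V by (intro PiE_I) auto
    have "\<forall>v\<in>nonroot. d (f v) < d v" using h by (simp add: f_def)
    thus "descending nonroot f" unfolding descending_def by blast
    show "(v, f v) \<in> parcs G" if "v \<in> nonroot" for v
      using that h sub by (auto simp: f_def)
  qed
  interpret F: pair_graph "tree_of f" by (rule pair_graph_tree_of[OF f])
  have FT: "parcs (tree_of f) \<subseteq> parcs T" using h T.symmetric_arcs by (auto simp: f_def)
  have "parcs T \<subseteq> parcs (tree_of f)"
  proof (rule subrelI, rule ccontr)
    fix u v assume uv: "(u, v) \<in> parcs T" and n: "(u, v) \<notin> parcs (tree_of f)"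
    have uvV: "u \<in> pverts G" "v \<in> pverts G" using uv T.wellformed' V by auto
    have "v \<rightarrow>\<^sup>*\<^bsub>with_proj (tree_of f)\<^esub> u"
      using tree_of_reaches_root[OF f uvV(2)] F.symmetric_reachable'[OF tree_of_reaches_root[OF f uvV(1)]]
      by (rule F.reachable_trans)
    then obtain q where q: "F.apath v q u" using F.reachable_apath by blast
    have qT: "T.awalk v q u"
      using q FT V uvV unfolding F.apath_def F.awalk_def T.awalk_def by auto
    have "T.awalk u ((u, v) # q) u" using qT uv by (simp add: T.awalk_Cons_iff)
    moreover have "distinct (tl (pawalk_verts u ((u, v) # q)))"
      using q unfolding F.apath_def by simp
    ultimately have "T.cycle ((u, v) # q)" unfolding T.cycle_def by blast
    hence "length q < 2" using nocyc by fastforce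
    moreover have "q \<noteq> []"
    proof
      assume "q = []"
      hence "v = u" using q by (simp add: F.apath_Nil_iff)
      thus False using uv T.pair_no_loops by fastforce
    qed
    ultimately obtain e where "q = [e]" by (cases q) (auto simp: less_Suc_eq)
    hence "e = (v, u)" "e \<in> parcs (tree_of f)"
      using q by (auto simp: F.apath_def F.awalk_simps prod_eq_iff)
    thus False using n F.symmetric_arcs by blast
  qed
  hence "T = tree_of f" using FT V by (intro pair_pre_digraph.equality) auto
  thus ?thesis using f by blast
qed

text \<open>Each edge belongs to exactly one non-root vertex, since two vertices cannot be the
  parents of each other.\<close>

lemma prod_uedges_tree_of:
  assumes "symmetric_weight G w" "f \<in> parents"
  shows "(\<Prod>e\<in>uedges (tree_of f). uweight w e) = (\<Prod>v\<in>nonroot. w (v, f v))"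
proof -
  obtain d :: "'v \<Rightarrow> nat" where d: "\<forall>v\<in>nonroot. d (f v) < d v"
    using assms(2) by (auto simp: parents_def descending_def)
  have inj: "inj_on (\<lambda>v. {v, f v}) nonroot"
  proof (rule inj_onI, rule ccontr)
    fix v u assume "v \<in> nonroot" "u \<in> nonroot" "{v, f v} = {u, f u}" "v \<noteq> u"
    hence "f v = u" "f u = v" by (auto simp: doubleton_eq_iff)
    thus False using d \<open>v \<in> nonroot\<close> \<open>u \<in> nonroot\<close> by (metis less_asym)
  qed
  have "uedges (tree_of f) = (\<lambda>v. {v, f v}) ` nonroot"
  proof -
    have "{f v, v} = {v, f v}" for v by blast
    thus ?thesis unfolding uedges_def parent_graph_simps image_UN by auto
  qed
  hence "(\<Prod>e\<in>uedges (tree_of f). uweight w e) = (\<Prod>v\<in>nonroot. uweight w {v, f v})"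
    by (simp add: prod.reindex[OF inj])
  also have "\<dots> = (\<Prod>v\<in>nonroot. w (v, f v))"
    using assms by (intro prod.cong refl uweight_arc) (auto simp: parents_def)
  finally show ?thesis .
qed

end

definition lap :: "'v pair_pre_digraph \<Rightarrow> ('v \<times> 'v \<Rightarrow> complex) \<Rightarrow> 'v \<Rightarrow> 'v \<Rightarrow> complex" where
  "lap G w u v = (if u = v then wdegree G w u else 0) - (if (u, v) \<in> parcs G then w (u, v) else 0)"

lemma (in pair_graph) wdegree_eq_sum:
  assumes "u \<in> pverts G"
  shows "wdegree G w u = (\<Sum>x\<in>pverts G. if (u, x) \<in> parcs G then w (u, x) else 0)"
proof -
  have "{e \<in> parcs G. fst e = u} = Pair u ` {x \<in> pverts G. (u, x) \<in> parcs G}"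
    using wellformed' by force
  hence "wdegree G w u = (\<Sum>x\<in>{x \<in> pverts G. (u, x) \<in> parcs G}. w (u, x))"
    unfolding wdegree_def by (simp add: sum.reindex inj_on_def)
  thus ?thesis using pair_finite_verts by (simp add: sum.inter_filter)
qed

text \<open>In the expansion over descending functions, a function using a non-arc has a zero
  factor; the others are the parent functions, which correspond to the spanning trees. As
  \<open>root\<close> is arbitrary, all minors deleting one vertex are equal.\<close>

theorem (in rooted_graph) matrix_tree:
  assumes "symmetric_weight G w"
  shows "pdet (pverts G - {root}) (lap G w) = kappa G w"
proof -
  let ?a = "\<lambda>u v. if (u, v) \<in> parcs G then w (u, v) else 0"
  have "pdet nonroot (lap G w) =
      pdet nonroot (\<lambda>i j. (if i = j then \<Sum>x\<in>pverts G. ?a i x else 0) - ?a i j)"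
  proof (rule pdet_cong)
    fix i j assume "i \<in> nonroot"
    hence "wdegree G w i = (\<Sum>x\<in>pverts G. ?a i x)" using wdegree_eq_sum by blast
    thus "lap G w i j = (if i = j then \<Sum>x\<in>pverts G. ?a i x else 0) - ?a i j"
      by (simp only: lap_def)
  qed
  also have "\<dots> = (\<Sum>f\<in>{f \<in> nonroot \<rightarrow>\<^sub>E pverts G. descending nonroot f}. \<Prod>v\<in>nonroot. ?a v (f v))"
    using pair_finite_verts by (intro pdet_laplacian_minor) auto
  also have "\<dots> = (\<Sum>f\<in>parents. \<Prod>v\<in>nonroot. ?a v (f v))"
  proof (rule sum.mono_neutral_right)
    show "finite {f \<in> nonroot \<rightarrow>\<^sub>E pverts G. descending nonroot f}"
      using pair_finite_verts by (intro finite_subset[OF _ finite_PiE[of nonroot "\<lambda>_. pverts G"]]) auto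
    show "\<forall>f\<in>{f \<in> nonroot \<rightarrow>\<^sub>E pverts G. descending nonroot f} - parents.
        (\<Prod>v\<in>nonroot. ?a v (f v)) = 0"
    proof
      fix f assume "f \<in> {f \<in> nonroot \<rightarrow>\<^sub>E pverts G. descending nonroot f} - parents"
      then obtain v where "v \<in> nonroot" "(v, f v) \<notin> parcs G" by (auto simp: parents_def)
      thus "(\<Prod>v\<in>nonroot. ?a v (f v)) = 0"
        using pair_finite_verts by (intro prod_zero) (auto intro!: bexI[of _ v])
    qed
  qed (auto simp: parents_def)
  also have "\<dots> = (\<Sum>f\<in>parents. \<Prod>e\<in>uedges (tree_of f). uweight w e)"
  proof (rule sum.cong[OF refl])
    fix f assume f: "f \<in> parents"
    have "(\<Prod>v\<in>nonroot. ?a v (f v)) = (\<Prod>v\<in>nonroot. w (v, f v))"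
      using f by (intro prod.cong) (auto simp: parents_def)
    thus "(\<Prod>v\<in>nonroot. ?a v (f v)) = (\<Prod>e\<in>uedges (tree_of f). uweight w e)"
      using prod_uedges_tree_of[OF assms f] by simp
  qed
  also have "\<dots> = (\<Sum>T\<in>tree_of ` parents. \<Prod>e\<in>uedges T. uweight w e)"
    by (simp add: sum.reindex[OF inj_on_tree_of])
  also have "tree_of ` parents = spanning_utrees G"
    using tree_of_in_spanning_utrees spanning_utree_is_tree_of by blast
  finally show ?thesis by (simp add: kappa_def)
qed

section \<open>Schur's lemma\<close>

lemma subspace_module_vec_iff:
  "VectorSpace.subspace class_ring U (module_vec TYPE(complex) d) \<longleftrightarrow>
     U \<subseteq> carrier_vec d \<and> 0\<^sub>v d \<in> U \<and> (\<forall>x\<in>U. \<forall>y\<in>U. x + y \<in> U) \<and> (\<forall>c. \<forall>x\<in>U. c \<cdot>\<^sub>v x \<in> U)"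
  unfolding subspace_def submodule_def
  by (auto simp: vec_vs vec_module module_vec_simps class_ring_simps)

lemma mult_mat_vec_in_subspace:
  assumes U: "VectorSpace.subspace class_ring U (module_vec TYPE(complex) d)"
    and Q: "Q \<in> carrier_mat d e" and y: "y \<in> carrier_vec e"
    and cols: "\<And>j. j < e \<Longrightarrow> col Q j \<in> U"
  shows "Q *\<^sub>v y \<in> U"
proof -
  have "vec d (\<lambda>i. \<Sum>j<m. Q $$ (i, j) * y $ j) \<in> U" if "m \<le> e" for m
    using that
  proof (induction m)
    case 0
    have "vec d (\<lambda>i. \<Sum>j<0. Q $$ (i, j) * y $ j) = 0\<^sub>v d" by auto
    thus ?case using U by (simp add: subspace_module_vec_iff)
  next
    case (Suc m)
    have "vec d (\<lambda>i. \<Sum>j<Suc m. Q $$ (i, j) * y $ j) =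
        vec d (\<lambda>i. \<Sum>j<m. Q $$ (i, j) * y $ j) + y $ m \<cdot>\<^sub>v col Q m"
      using Suc.prems Q by (intro eq_vecI) auto
    thus ?case using Suc U cols[of m] by (simp add: subspace_module_vec_iff)
  qed
  moreover have "Q *\<^sub>v y = vec d (\<lambda>i. \<Sum>j<e. Q $$ (i, j) * y $ j)"
    using Q y by (intro eq_vecI) (auto simp: scalar_prod_def lessThan_atLeast0)
  ultimately show ?thesis by simp
qed

lemma mat_eq_0_if_mult_vec_eq_0:
  fixes T :: "complex mat"
  assumes "T \<in> carrier_mat e d" "\<And>x. x \<in> carrier_vec d \<Longrightarrow> T *\<^sub>v x = 0\<^sub>v e"
  shows "T = 0\<^sub>m e d"
proof (rule eq_matI)
  fix i j assume ij: "i < dim_row (0\<^sub>m e d :: complex mat)" "j < dim_col (0\<^sub>m e d :: complex mat)"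
  hence "T $$ (i, j) = (T *\<^sub>v unit_vec d j) $ i" using assms(1) by simp
  thus "T $$ (i, j) = 0\<^sub>m e d $$ (i, j)" using assms(2)[of "unit_vec d j"] ij by simp
qed (use assms in auto)

lemma mult_mat_unit_vec:
  fixes A :: "complex mat"
  assumes "A \<in> carrier_mat e d" "j < d"
  shows "A *\<^sub>v unit_vec d j = col A j"
  using assms by (intro eq_vecI) auto

lemma det_swap_columns:
  fixes Q :: "complex mat"
  assumes "Q \<in> carrier_mat d d" "a < d" "b < d" "det Q \<noteq> 0"
  shows "det (mat d d (\<lambda>(i, j). Q $$ (i, Transposition.transpose a b j))) \<noteq> 0"
proof -
  let ?p = "Transposition.transpose a b" and ?M = "mat d d (\<lambda>(i, j). Q $$ (i, Transposition.transpose a b j))"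
  have p: "?p permutes {0..<d}" using assms by (simp add: permutes_swap_id)
  have pd: "?p i < d" if "i < d" for i using permutes_in_image[OF p, of i] that by simp
  have "transpose_mat ?M = mat d d (\<lambda>(i, j). transpose_mat Q $$ (?p i, j))"
    using assms pd by (intro eq_matI) auto
  hence "det ?M = det (mat d d (\<lambda>(i, j). transpose_mat Q $$ (?p i, j)))"
    by (metis det_transpose mat_carrier)
  also have "\<dots> = of_int (sign ?p) * det Q"
    using assms by (simp add: det_permute_rows[OF _ p] det_transpose)
  finally show ?thesis using assms(4) by (simp add: sign_def)
qed

text \<open>
  A basis of the whole space adapted to \<open>U\<close>: take an invertible matrix having as many leading
  columns in \<open>U\<close> as possible; by Cramer's rule a further independent vector of \<open>U\<close> could be
  exchanged for one of the remaining columns.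
\<close>

lemma adapted_basis:
  fixes U :: "complex vec set"
  assumes U: "U \<subseteq> carrier_vec d"
  obtains k Q R where "k \<le> d" "Q \<in> carrier_mat d d" "R \<in> carrier_mat d d" "Q * R = 1\<^sub>m d" "R * Q = 1\<^sub>m d"
    "\<And>j. j < k \<Longrightarrow> col Q j \<in> U" "\<And>x i. x \<in> U \<Longrightarrow> k \<le> i \<Longrightarrow> i < d \<Longrightarrow> (R *\<^sub>v x) $ i = 0"
proof -
  define P where "P k \<longleftrightarrow> k \<le> d \<and> (\<exists>Q\<in>carrier_mat d d. det Q \<noteq> 0 \<and> (\<forall>j<k. col Q j \<in> U))" for k
  have "P 0" unfolding P_def by (auto intro!: bexI[of _ "1\<^sub>m d"])
  moreover have "\<And>k. P k \<Longrightarrow> k \<le> d" by (simp add: P_def)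
  ultimately obtain k where k: "P k" "\<And>l. P l \<Longrightarrow> l \<le> k"
    using Nat.ex_has_greatest_nat[of P 0 d] by blast
  then obtain Q where Q: "k \<le> d" "Q \<in> carrier_mat d d" "det Q \<noteq> 0" "\<And>j. j < k \<Longrightarrow> col Q j \<in> U"
    by (auto simp: P_def)
  obtain R where R: "R \<in> carrier_mat d d" "Q * R = 1\<^sub>m d" "R * Q = 1\<^sub>m d"
    using det_non_zero_imp_unit[OF Q(2,3), of undefined] by (auto simp: Units_def ring_mat_simps)
  have "(R *\<^sub>v x) $ i = 0" if x: "x \<in> U" and i: "k \<le> i" "i < d" for x i
  proof (rule ccontr)
    assume nz: "(R *\<^sub>v x) $ i \<noteq> 0"
    have kd: "k < d" using i by simp
    have xc: "x \<in> carrier_vec d" using x U by blast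
    \<comment> \<open>Column \<open>i\<close>, whose coordinate in \<open>x\<close> is non-zero,
      moves to position \<open>k\<close>, the first one beyond the leading columns. These stay in
      place because \<open>k \<le> i\<close>.\<close>
    let ?p = "Transposition.transpose k i"
    define M where "M = mat d d (\<lambda>(a, j). Q $$ (a, ?p j))"
    define y where "y = vec d (\<lambda>j. (R *\<^sub>v x) $ ?p j)"
    have p: "?p permutes {0..<d}" using i by (simp add: permutes_swap_id)
    have pd: "?p j < d" if "j < d" for j using permutes_in_image[OF p, of j] that by simp
    have M: "M \<in> carrier_mat d d" "det M \<noteq> 0"
      using det_swap_columns[OF Q(2) kd i(2) Q(3)] by (simp_all add: M_def)
    have "M *\<^sub>v y = Q *\<^sub>v (R *\<^sub>v x)"
    proof (rule eq_vecI)
      fix a assume "a < dim_vec (Q *\<^sub>v (R *\<^sub>v x))"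
      hence a: "a < d" using Q by simp
      have "(M *\<^sub>v y) $ a = (\<Sum>j\<in>{0..<d}. Q $$ (a, ?p j) * (R *\<^sub>v x) $ ?p j)"
        using a by (simp add: M_def y_def scalar_prod_def)
      also have "\<dots> = (\<Sum>j\<in>{0..<d}. Q $$ (a, j) * (R *\<^sub>v x) $ j)"
        using sum.permute[OF p, of "\<lambda>j. Q $$ (a, j) * (R *\<^sub>v x) $ j"] by (simp add: o_def)
      also have "\<dots> = (Q *\<^sub>v (R *\<^sub>v x)) $ a"
        using a Q R by (simp add: scalar_prod_def)
      finally show "(M *\<^sub>v y) $ a = (Q *\<^sub>v (R *\<^sub>v x)) $ a" .
    qed (use Q M in auto)
    also have "\<dots> = x" using Q R xc by (metis assoc_mult_mat_vec one_mult_mat_vec)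
    finally have My: "M *\<^sub>v y = x" .
    define N where "N = replace_col M x k"
    have N: "N \<in> carrier_mat d d" using M by (simp add: N_def replace_col_def)
    have "det N = y $ k * det M"
      using cramer_lemma_mat[OF M(1) _ kd, of y] unfolding N_def My by (simp add: y_def)
    hence "det N \<noteq> 0" using nz M kd by (simp add: y_def)
    moreover have "col N j \<in> U" if "j < Suc k" for j
    proof (cases "j = k")
      case True
      have "col N j = x" using True M kd xc by (intro eq_vecI) (auto simp: N_def replace_col_def)
      thus ?thesis using x by simp
    next
      case False
      hence "j < k" using that by simp
      hence "col N j = col Q j"
        using Q M kd i by (intro eq_vecI) (auto simp: N_def M_def replace_col_def)
      thus ?thesis using Q(4) \<open>j < k\<close> by simp
    qed
    ultimately have "P (Suc k)" using N kd unfolding P_def by auto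
    thus False using k(2) by fastforce
  qed
  thus ?thesis using that Q R by blast
qed

text \<open>\<open>matrix_rep\<close> asks only for invertibility and multiplicativity; an
  invertible idempotent matrix is the identity.\<close>

lemma matrix_rep_one:
  assumes "group \<Gamma>" "matrix_rep \<Gamma> d \<rho>"
  shows "\<rho> \<one>\<^bsub>\<Gamma>\<^esub> = 1\<^sub>m d"
proof -
  interpret group \<Gamma> by fact
  have c: "\<rho> \<one>\<^bsub>\<Gamma>\<^esub> \<in> carrier_mat d d" and m: "\<rho> \<one>\<^bsub>\<Gamma>\<^esub> * \<rho> \<one>\<^bsub>\<Gamma>\<^esub> = \<rho> \<one>\<^bsub>\<Gamma>\<^esub>"
    and "invertible_mat (\<rho> \<one>\<^bsub>\<Gamma>\<^esub>)"
    using assms(2) unfolding matrix_rep_def by (metis one_closed r_one)+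
  then obtain B where B: "\<rho> \<one>\<^bsub>\<Gamma>\<^esub> * B = 1\<^sub>m d" "B * \<rho> \<one>\<^bsub>\<Gamma>\<^esub> = 1\<^sub>m (dim_row B)"
    by (auto simp: invertible_mat_def inverts_mat_def)
  have "dim_col B = d" using B(1) by (metis index_mult_mat(3) index_one_mat(3))
  moreover have "dim_row B = d" using B(2) c by (metis carrier_matD(2) index_mult_mat(3) index_one_mat(3))
  ultimately have Bc: "B \<in> carrier_mat d d" by auto
  have "\<rho> \<one>\<^bsub>\<Gamma>\<^esub> = \<rho> \<one>\<^bsub>\<Gamma>\<^esub> * (\<rho> \<one>\<^bsub>\<Gamma>\<^esub> * B)" using B c by simp
  also have "\<dots> = 1\<^sub>m d" using assoc_mult_mat[OF c c Bc] m B by simp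
  finally show ?thesis .
qed

lemma matrix_repI:
  assumes "group \<Gamma>" "\<And>g. g \<in> carrier \<Gamma> \<Longrightarrow> \<rho> g \<in> carrier_mat d d" "\<rho> \<one>\<^bsub>\<Gamma>\<^esub> = 1\<^sub>m d"
    "\<And>g h. g \<in> carrier \<Gamma> \<Longrightarrow> h \<in> carrier \<Gamma> \<Longrightarrow> \<rho> (g \<otimes>\<^bsub>\<Gamma>\<^esub> h) = \<rho> g * \<rho> h"
  shows "matrix_rep \<Gamma> d \<rho>"
proof -
  interpret group \<Gamma> by fact
  have "invertible_mat (\<rho> g)" if g: "g \<in> carrier \<Gamma>" for g
  proof -
    have "\<rho> g * \<rho> (inv\<^bsub>\<Gamma>\<^esub> g) = 1\<^sub>m d" "\<rho> (inv\<^bsub>\<Gamma>\<^esub> g) * \<rho> g = 1\<^sub>m d"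
      using g assms(3) by (simp_all flip: assms(4))
    thus ?thesis using assms(2)[OF g] assms(2)[of "inv\<^bsub>\<Gamma>\<^esub> g"] g
      unfolding invertible_mat_def inverts_mat_def by (auto intro!: exI[of _ "\<rho> (inv\<^bsub>\<Gamma>\<^esub> g)"])
  qed
  thus ?thesis using assms(2,4) by (simp add: matrix_rep_def)
qed

definition mtrace :: "complex mat \<Rightarrow> complex" where
  "mtrace A = (\<Sum>i<dim_row A. A $$ (i, i))"

lemma mult_mat_entry:
  assumes "A \<in> carrier_mat a b" "B \<in> carrier_mat b c" "i < a" "j < c"
  shows "(A * B) $$ (i, j) = (\<Sum>l<b. A $$ (i, l) * B $$ (l, j))"
  using assms by (simp add: scalar_prod_def lessThan_atLeast0)

lemma mtrace_comm:
  assumes "A \<in> carrier_mat a b" "B \<in> carrier_mat b a"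
  shows "mtrace (A * B) = mtrace (B * A)"
proof -
  have "mtrace (A * B) = (\<Sum>i<a. \<Sum>l<b. A $$ (i, l) * B $$ (l, i))"
    unfolding mtrace_def using assms by (intro sum.cong) (auto simp: mult_mat_entry simp del: index_mult_mat(1))
  also have "\<dots> = (\<Sum>l<b. \<Sum>i<a. B $$ (l, i) * A $$ (i, l))"
    by (subst sum.swap) (simp add: mult.commute)
  also have "\<dots> = mtrace (B * A)"
    unfolding mtrace_def using assms by (intro sum.cong) (auto simp: mult_mat_entry simp del: index_mult_mat(1))
  finally show ?thesis .
qed

text \<open>The kernel \<open>U\<close> and the image \<open>W\<close> of \<open>T\<close> are
  invariant, so irreducibility makes \<open>T\<close> injective and surjective.\<close>

lemma schur_intertwiner:
  assumes irr: "irreducible_rep \<Gamma> d \<rho>" "irreducible_rep \<Gamma> e \<sigma>"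
    and T: "T \<in> carrier_mat e d" "\<And>g. g \<in> carrier \<Gamma> \<Longrightarrow> T * \<rho> g = \<sigma> g * T"
    and nz: "T \<noteq> 0\<^sub>m e d"
  shows "e = d" "invertible_mat T"
proof -
  have rc: "\<rho> g \<in> carrier_mat d d" "\<sigma> g \<in> carrier_mat e e" if "g \<in> carrier \<Gamma>" for g
    using irr that by (auto simp: irreducible_rep_def matrix_rep_def)
  define U where "U = {x \<in> carrier_vec d. T *\<^sub>v x = 0\<^sub>v e}"
  have "VectorSpace.subspace class_ring U (module_vec TYPE(complex) d)"
    unfolding subspace_module_vec_iff U_def using T(1)
    by (auto simp: mult_add_distrib_mat_vec mult_mat_vec)
  moreover have "\<forall>g\<in>carrier \<Gamma>. \<forall>x\<in>U. \<rho> g *\<^sub>v x \<in> U"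
  proof (intro ballI)
    fix g x assume g: "g \<in> carrier \<Gamma>" and x: "x \<in> U"
    have "T *\<^sub>v (\<rho> g *\<^sub>v x) = (\<sigma> g * T) *\<^sub>v x"
      using T g x rc[OF g] by (simp add: U_def flip: T(2))
    also have "\<dots> = \<sigma> g *\<^sub>v 0\<^sub>v e"
      using T(1) x rc[OF g] by (simp add: U_def)
    also have "\<dots> = 0\<^sub>v e" using rc[OF g] by auto
    finally show "\<rho> g *\<^sub>v x \<in> U" using x rc[OF g] by (auto simp: U_def)
  qed
  ultimately have "U = {0\<^sub>v d} \<or> U = carrier_vec d" using irr(1) by (simp add: irreducible_rep_def)
  moreover have "U \<noteq> carrier_vec d"
    using mat_eq_0_if_mult_vec_eq_0[OF T(1)] nz by (auto simp: U_def)
  ultimately have inj: "x = 0\<^sub>v d" if "x \<in> carrier_vec d" "T *\<^sub>v x = 0\<^sub>v e" for x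
    using that by (auto simp: U_def)
  define W where "W = (\<lambda>x. T *\<^sub>v x) ` carrier_vec d"
  have "VectorSpace.subspace class_ring W (module_vec TYPE(complex) e)"
    unfolding subspace_module_vec_iff
  proof (intro conjI ballI allI)
    show "W \<subseteq> carrier_vec e" using T(1) by (auto simp: W_def)
    have "T *\<^sub>v 0\<^sub>v d = 0\<^sub>v e" using T(1) by auto
    thus "0\<^sub>v e \<in> W" unfolding W_def by (metis image_eqI zero_carrier_vec)
    fix x assume "x \<in> W"
    then obtain x' where x': "x' \<in> carrier_vec d" "x = T *\<^sub>v x'" by (auto simp: W_def)
    show "c \<cdot>\<^sub>v x \<in> W" for c
      using x' T(1) mult_mat_vec[OF T(1) x'(1), of c] unfolding W_def by (metis image_eqI smult_carrier_vec)
    fix y assume "y \<in> W"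
    then obtain y' where y': "y' \<in> carrier_vec d" "y = T *\<^sub>v y'" by (auto simp: W_def)
    show "x + y \<in> W"
      using x' y' mult_add_distrib_mat_vec[OF T(1) x'(1) y'(1)] unfolding W_def
      by (metis add_carrier_vec image_eqI)
  qed
  moreover have "\<forall>g\<in>carrier \<Gamma>. \<forall>x\<in>W. \<sigma> g *\<^sub>v x \<in> W"
  proof (intro ballI)
    fix g x assume g: "g \<in> carrier \<Gamma>" and "x \<in> W"
    then obtain x' where x': "x' \<in> carrier_vec d" "x = T *\<^sub>v x'" by (auto simp: W_def)
    have "\<sigma> g *\<^sub>v x = T *\<^sub>v (\<rho> g *\<^sub>v x')"
      using x' rc[OF g] T(1) by (simp add: T(2)[OF g] flip: assoc_mult_mat_vec)
    moreover have "\<rho> g *\<^sub>v x' \<in> carrier_vec d" using rc[OF g] x' by auto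
    ultimately show "\<sigma> g *\<^sub>v x \<in> W" unfolding W_def by blast
  qed
  ultimately have "W = {0\<^sub>v e} \<or> W = carrier_vec e" using irr(2) by (simp add: irreducible_rep_def)
  moreover have "W \<noteq> {0\<^sub>v e}"
    using mat_eq_0_if_mult_vec_eq_0[OF T(1)] nz by (auto simp: W_def)
  ultimately have "W = carrier_vec e" by blast
  hence "\<exists>x\<in>carrier_vec d. T *\<^sub>v x = y" if "y \<in> carrier_vec e" for y
    using that unfolding W_def by (metis imageE)
  \<comment> \<open>Preimages of the unit vectors are the columns of a right inverse
    \<open>R\<close>. It is also a left inverse, because \<open>T\<close> maps
    \<open>R (T x) - x\<close> to 0 and is injective.\<close>
  hence "\<forall>j<e. \<exists>x. x \<in> carrier_vec d \<and> T *\<^sub>v x = unit_vec e j"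
    by (metis unit_vec_carrier)
  then obtain X where X: "\<And>j. j < e \<Longrightarrow> X j \<in> carrier_vec d \<and> T *\<^sub>v X j = unit_vec e j" by metis
  define R where "R = mat d e (\<lambda>(i, j). X j $ i)"
  have R: "R \<in> carrier_mat d e" by (simp add: R_def)
  have TR: "T * R = 1\<^sub>m e"
  proof (rule eq_matI)
    fix i j assume ij: "i < dim_row (1\<^sub>m e :: complex mat)" "j < dim_col (1\<^sub>m e :: complex mat)"
    have "col R j = X j" using ij X[of j] by (intro eq_vecI) (auto simp: R_def)
    hence "(T * R) $$ (i, j) = (T *\<^sub>v X j) $ i" using ij T R by simp
    also have "\<dots> = unit_vec e j $ i" using X[of j] ij by simp
    finally show "(T * R) $$ (i, j) = 1\<^sub>m e $$ (i, j)" using ij by (auto simp: unit_vec_def)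
  qed (use T R in auto)
  have "R * T - 1\<^sub>m d = 0\<^sub>m d d"
  proof (rule mat_eq_0_if_mult_vec_eq_0)
    show "R * T - 1\<^sub>m d \<in> carrier_mat d d" using R T by auto
    fix x :: "complex vec" assume x: "x \<in> carrier_vec d"
    have Tx: "T *\<^sub>v x \<in> carrier_vec e" using T x by auto
    have RTx: "R *\<^sub>v (T *\<^sub>v x) \<in> carrier_vec d" using R Tx by auto
    have e: "(R * T - 1\<^sub>m d) *\<^sub>v x = R *\<^sub>v (T *\<^sub>v x) - x"
      using R T x by (subst minus_mult_distrib_mat_vec[of _ d d]) auto
    have "T *\<^sub>v (R *\<^sub>v (T *\<^sub>v x)) = (T * R) *\<^sub>v (T *\<^sub>v x)" using R T Tx by simp
    also have "\<dots> = T *\<^sub>v x" using TR Tx by simp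
    finally have TRTx: "T *\<^sub>v (R *\<^sub>v (T *\<^sub>v x)) = T *\<^sub>v x" .
    have "T *\<^sub>v (R *\<^sub>v (T *\<^sub>v x) - x) = T *\<^sub>v (R *\<^sub>v (T *\<^sub>v x)) - T *\<^sub>v x"
      using T RTx x by (intro mult_minus_distrib_mat_vec)
    hence "T *\<^sub>v (R *\<^sub>v (T *\<^sub>v x) - x) = 0\<^sub>v e" using Tx by (simp add: TRTx)
    thus "(R * T - 1\<^sub>m d) *\<^sub>v x = 0\<^sub>v d" unfolding e using inj RTx x by simp
  qed
  hence RT: "R * T = 1\<^sub>m d"
  proof -
    assume 0: "R * T - 1\<^sub>m d = 0\<^sub>m d d"
    show ?thesis
    proof (rule eq_matI)
      fix i j assume "i < dim_row (1\<^sub>m d :: complex mat)" "j < dim_col (1\<^sub>m d :: complex mat)"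
      thus "(R * T) $$ (i, j) = 1\<^sub>m d $$ (i, j)"
        using arg_cong[OF 0, of "\<lambda>A. A $$ (i, j)"] R T by simp
    qed (use R T in auto)
  qed
  \<comment> \<open>The two products are identity matrices of sizes \<open>e\<close> and
    \<open>d\<close> with the same trace, which settles \<open>e = d\<close> in characteristic 0
    without dimension theory.\<close>
  have "mtrace (T * R) = of_nat e" "mtrace (R * T) = of_nat d" by (simp_all add: TR RT mtrace_def)
  hence "of_nat e = (of_nat d :: complex)" using mtrace_comm[OF T(1) R] by simp
  thus ed: "e = d" by simp
  show "invertible_mat T"
    using TR RT T R ed unfolding invertible_mat_def inverts_mat_def by auto
qed

text \<open>Over the complex numbers \<open>T\<close> has an eigenvalue \<open>c\<close>. The
  intertwiner \<open>T - c I\<close> is then singular, hence zero.\<close>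

lemma schur_scalar:
  assumes irr: "irreducible_rep \<Gamma> d \<rho>"
    and T: "T \<in> carrier_mat d d" "\<And>g. g \<in> carrier \<Gamma> \<Longrightarrow> T * \<rho> g = \<rho> g * T"
  obtains c where "T = c \<cdot>\<^sub>m 1\<^sub>m d"
proof -
  have "d > 0" using irr by (simp add: irreducible_rep_def)
  then obtain c where "eigenvalue T c" using spectrum_non_empty[OF T(1)] by (auto simp: spectrum_def)
  then obtain v where v: "v \<in> carrier_vec d" "v \<noteq> 0\<^sub>v d" "T *\<^sub>v v = c \<cdot>\<^sub>v v"
    using T(1) by (auto simp: eigenvalue_def eigenvector_def)
  define S where "S = T - c \<cdot>\<^sub>m 1\<^sub>m d"
  have S: "S \<in> carrier_mat d d" using T by (auto simp: S_def)
  have rc: "\<rho> g \<in> carrier_mat d d" if "g \<in> carrier \<Gamma>" for g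
    using irr that by (auto simp: irreducible_rep_def matrix_rep_def)
  have comm: "S * \<rho> g = \<rho> g * S" if g: "g \<in> carrier \<Gamma>" for g
  proof -
    have "S * \<rho> g = T * \<rho> g - (c \<cdot>\<^sub>m 1\<^sub>m d) * \<rho> g"
      unfolding S_def using T(1) rc[OF g] by (intro minus_mult_distrib_mat) auto
    also have "(c \<cdot>\<^sub>m 1\<^sub>m d) * \<rho> g = \<rho> g * (c \<cdot>\<^sub>m 1\<^sub>m d)"
      using mult_smult_assoc_mat[of "1\<^sub>m d" d d "\<rho> g" d c] mult_smult_distrib[OF rc[OF g] one_carrier_mat, of c]
        rc[OF g] by simp
    also have "T * \<rho> g - \<dots> = \<rho> g * S"
      unfolding S_def T(2)[OF g]
      using T(1) rc[OF g] by (intro mult_minus_distrib_mat[symmetric]) auto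
    finally show ?thesis .
  qed
  have Sv: "S *\<^sub>v v = 0\<^sub>v d"
  proof -
    have "S *\<^sub>v v = T *\<^sub>v v - (c \<cdot>\<^sub>m 1\<^sub>m d) *\<^sub>v v"
      unfolding S_def using T v by (intro minus_mult_distrib_mat_vec) auto
    also have "(c \<cdot>\<^sub>m 1\<^sub>m d) *\<^sub>v v = c \<cdot>\<^sub>v v"
      using v by (intro eq_vecI) auto
    finally show ?thesis using v by simp
  qed
  have "S = 0\<^sub>m d d"
  proof (rule ccontr)
    assume "S \<noteq> 0\<^sub>m d d"
    hence "invertible_mat S" using schur_intertwiner(2)[OF irr irr S comm] by blast
    then obtain B where B: "inverts_mat S B" "inverts_mat B S" unfolding invertible_mat_def by blast
    have "det S = 0" using det_0_iff_vec_prod_zero[OF S] v Sv by blast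
    moreover have "S * B = 1\<^sub>m d" using B S by (simp add: inverts_mat_def)
    moreover have "B \<in> carrier_mat d d"
    proof
      show "dim_col B = d" using \<open>S * B = 1\<^sub>m d\<close> by (metis index_mult_mat(3) index_one_mat(3))
      have "B * S = 1\<^sub>m (dim_row B)" using B(2) by (simp add: inverts_mat_def)
      hence "dim_col (B * S) = dim_row B" by (metis index_one_mat(3))
      thus "dim_row B = d" using S by simp
    qed
    ultimately show False using det_mult[OF S, of B] by simp
  qed
  hence "T = c \<cdot>\<^sub>m 1\<^sub>m d"
  proof -
    assume 0: "S = 0\<^sub>m d d"
    show ?thesis
    proof (rule eq_matI)
      fix i j assume "i < dim_row (c \<cdot>\<^sub>m 1\<^sub>m d)" "j < dim_col (c \<cdot>\<^sub>m 1\<^sub>m d)"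
      thus "T $$ (i, j) = (c \<cdot>\<^sub>m 1\<^sub>m d) $$ (i, j)"
        using arg_cong[OF 0, of "\<lambda>A. A $$ (i, j)"] T by (simp add: S_def)
    qed (use T in auto)
  qed
  thus ?thesis by (rule that)
qed

section \<open>Characters and twisted matrices\<close>

lemma irreducible_rep_carrier:
  "irreducible_rep \<Gamma> d \<rho> \<Longrightarrow> g \<in> carrier \<Gamma> \<Longrightarrow> \<rho> g \<in> carrier_mat d d"
  by (simp add: irreducible_rep_def matrix_rep_def)

lemma irreducible_rep_matrix_rep: "irreducible_rep \<Gamma> d \<rho> \<Longrightarrow> matrix_rep \<Gamma> d \<rho>"
  by (simp add: irreducible_rep_def)

text \<open>\<open>T\<close> is the average, up to the factor
  \<open>card (carrier \<Gamma>)\<close>, of the products of \<open>\<sigma> g\<close>, the matrix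
  unit at \<open>(c, b)\<close> and \<open>\<rho>\<close> of the inverse of \<open>g\<close>.
  Substituting \<open>h g\<close> for \<open>g\<close> moves \<open>\<sigma> h\<close> from the left
  to \<open>\<rho> h\<close> on the right.\<close>

lemma averaged_intertwiner:
  assumes "group \<Gamma>" "matrix_rep \<Gamma> d \<rho>" "matrix_rep \<Gamma> e \<sigma>" "c < e" "b < d" "h \<in> carrier \<Gamma>"
  defines "T \<equiv> mat e d (\<lambda>(i, j). \<Sum>g\<in>carrier \<Gamma>. \<sigma> g $$ (i, c) * \<rho> (inv\<^bsub>\<Gamma>\<^esub> g) $$ (b, j))"
  shows "T * \<rho> h = \<sigma> h * T"
proof -
  interpret group \<Gamma> by fact
  have rc: "\<rho> g \<in> carrier_mat d d" "\<sigma> g \<in> carrier_mat e e" if "g \<in> carrier \<Gamma>" for g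
    using assms(2,3) that by (auto simp: matrix_rep_def)
  have hom: "\<rho> (g \<otimes>\<^bsub>\<Gamma>\<^esub> g') = \<rho> g * \<rho> g'" "\<sigma> (g \<otimes>\<^bsub>\<Gamma>\<^esub> g') = \<sigma> g * \<sigma> g'"
    if "g \<in> carrier \<Gamma>" "g' \<in> carrier \<Gamma>" for g g'
    using assms(2,3) that by (auto simp: matrix_rep_def)
  note h = assms(6)
  have T: "T \<in> carrier_mat e d" by (simp add: T_def)
  show ?thesis
  proof (rule eq_matI)
    fix i j assume "i < dim_row (\<sigma> h * T)" "j < dim_col (\<sigma> h * T)"
    hence ij: "i < e" "j < d" using rc[OF h] T by auto
    have "(\<sigma> h * T) $$ (i, j) =
        (\<Sum>l<e. \<Sum>g\<in>carrier \<Gamma>. \<sigma> h $$ (i, l) * (\<sigma> g $$ (l, c) * \<rho> (inv\<^bsub>\<Gamma>\<^esub> g) $$ (b, j)))"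
      using ij by (subst mult_mat_entry[OF rc(2)[OF h] T]) (auto simp: T_def sum_distrib_left)
    also have "\<dots> = (\<Sum>g\<in>carrier \<Gamma>. (\<Sum>l<e. \<sigma> h $$ (i, l) * \<sigma> g $$ (l, c)) * \<rho> (inv\<^bsub>\<Gamma>\<^esub> g) $$ (b, j))"
      by (subst sum.swap) (simp add: sum_distrib_right mult.assoc)
    also have "\<dots> = (\<Sum>g\<in>carrier \<Gamma>. \<sigma> (h \<otimes>\<^bsub>\<Gamma>\<^esub> g) $$ (i, c) * \<rho> (inv\<^bsub>\<Gamma>\<^esub> (h \<otimes>\<^bsub>\<Gamma>\<^esub> g) \<otimes>\<^bsub>\<Gamma>\<^esub> h) $$ (b, j))"
    proof (rule sum.cong[OF refl])
      fix g assume g: "g \<in> carrier \<Gamma>"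
      have "\<sigma> (h \<otimes>\<^bsub>\<Gamma>\<^esub> g) $$ (i, c) = (\<Sum>l<e. \<sigma> h $$ (i, l) * \<sigma> g $$ (l, c))"
        unfolding hom(2)[OF h g] using mult_mat_entry[OF rc(2)[OF h] rc(2)[OF g] ij(1) assms(4)] .
      moreover have "inv\<^bsub>\<Gamma>\<^esub> (h \<otimes>\<^bsub>\<Gamma>\<^esub> g) \<otimes>\<^bsub>\<Gamma>\<^esub> h = inv\<^bsub>\<Gamma>\<^esub> g"
        using g h by (simp add: inv_mult_group m_assoc)
      ultimately show "(\<Sum>l<e. \<sigma> h $$ (i, l) * \<sigma> g $$ (l, c)) * \<rho> (inv\<^bsub>\<Gamma>\<^esub> g) $$ (b, j) =
          \<sigma> (h \<otimes>\<^bsub>\<Gamma>\<^esub> g) $$ (i, c) * \<rho> (inv\<^bsub>\<Gamma>\<^esub> (h \<otimes>\<^bsub>\<Gamma>\<^esub> g) \<otimes>\<^bsub>\<Gamma>\<^esub> h) $$ (b, j)"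
        by simp
    qed
    also have "\<dots> = (\<Sum>g\<in>carrier \<Gamma>. \<sigma> g $$ (i, c) * \<rho> (inv\<^bsub>\<Gamma>\<^esub> g \<otimes>\<^bsub>\<Gamma>\<^esub> h) $$ (b, j))"
    proof (rule sum.reindex_bij_betw)
      show "bij_betw (\<lambda>g. h \<otimes>\<^bsub>\<Gamma>\<^esub> g) (carrier \<Gamma>) (carrier \<Gamma>)"
        using h by (auto simp: bij_betw_def inj_on_multc inj_on_cmult surj_const_mult)
    qed
    also have "\<dots> = (\<Sum>g\<in>carrier \<Gamma>. \<sigma> g $$ (i, c) * (\<Sum>l<d. \<rho> (inv\<^bsub>\<Gamma>\<^esub> g) $$ (b, l) * \<rho> h $$ (l, j)))"
    proof (rule sum.cong[OF refl])
      fix g assume g: "g \<in> carrier \<Gamma>"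
      hence g': "inv\<^bsub>\<Gamma>\<^esub> g \<in> carrier \<Gamma>" by simp
      show "\<sigma> g $$ (i, c) * \<rho> (inv\<^bsub>\<Gamma>\<^esub> g \<otimes>\<^bsub>\<Gamma>\<^esub> h) $$ (b, j) =
          \<sigma> g $$ (i, c) * (\<Sum>l<d. \<rho> (inv\<^bsub>\<Gamma>\<^esub> g) $$ (b, l) * \<rho> h $$ (l, j))"
        unfolding hom(1)[OF g' h] mult_mat_entry[OF rc(1)[OF g'] rc(1)[OF h] assms(5) ij(2)] ..
    qed
    also have "\<dots> = (\<Sum>l<d. (\<Sum>g\<in>carrier \<Gamma>. \<sigma> g $$ (i, c) * \<rho> (inv\<^bsub>\<Gamma>\<^esub> g) $$ (b, l)) * \<rho> h $$ (l, j))"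
      unfolding sum_distrib_left sum_distrib_right by (subst sum.swap) (simp add: mult.assoc)
    also have "\<dots> = (T * \<rho> h) $$ (i, j)"
      using ij by (subst mult_mat_entry[OF T rc(1)[OF h]]) (auto simp: T_def)
    finally show "(T * \<rho> h) $$ (i, j) = (\<sigma> h * T) $$ (i, j)" by simp
  qed (use T rc[OF h] in auto)
qed

lemma mtrace_one: "mtrace (1\<^sub>m d) = of_nat d"
  by (simp add: mtrace_def)

text \<open>The product of the two characters, summed over the group, is the sum over all
  \<open>c\<close> and \<open>b\<close> of the entry \<open>(c, b)\<close> of the intertwiner
  averaged from the matrix unit at \<open>(c, b)\<close>. For inequivalent representations all these
  intertwiners vanish.\<close>

lemma character_orthogonal:
  assumes "group \<Gamma>" "irreducible_rep \<Gamma> d \<rho>" "irreducible_rep \<Gamma> e \<sigma>"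
    "\<not> equivalent_reps \<Gamma> d \<rho> e \<sigma>"
  shows "(\<Sum>g\<in>carrier \<Gamma>. mtrace (\<sigma> g) * mtrace (\<rho> (inv\<^bsub>\<Gamma>\<^esub> g))) = 0"
proof -
  interpret group \<Gamma> by fact
  define T where "T c b = mat e d (\<lambda>(i, j). \<Sum>g\<in>carrier \<Gamma>. \<sigma> g $$ (i, c) * \<rho> (inv\<^bsub>\<Gamma>\<^esub> g) $$ (b, j))" for c b
  have T0: "T c b = 0\<^sub>m e d" if cb: "c < e" "b < d" for c b
  proof (rule ccontr)
    assume nz: "T c b \<noteq> 0\<^sub>m e d"
    have Tc: "T c b \<in> carrier_mat e d" by (simp add: T_def)
    have com: "T c b * \<rho> h = \<sigma> h * T c b" if "h \<in> carrier \<Gamma>" for h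
      unfolding T_def using averaged_intertwiner[OF assms(1) assms(2,3)[THEN irreducible_rep_matrix_rep] cb that] .
    from schur_intertwiner[OF assms(2,3) Tc com nz]
    have "equivalent_reps \<Gamma> d \<rho> e \<sigma>"
      unfolding equivalent_reps_def using Tc com by (intro conjI bexI[of _ "T c b"]) auto
    thus False using assms(4) by simp
  qed
  have "(\<Sum>g\<in>carrier \<Gamma>. mtrace (\<sigma> g) * mtrace (\<rho> (inv\<^bsub>\<Gamma>\<^esub> g))) =
      (\<Sum>g\<in>carrier \<Gamma>. \<Sum>c<e. \<Sum>b<d. \<sigma> g $$ (c, c) * \<rho> (inv\<^bsub>\<Gamma>\<^esub> g) $$ (b, b))"
  proof (rule sum.cong[OF refl])
    fix g assume g: "g \<in> carrier \<Gamma>"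
    show "mtrace (\<sigma> g) * mtrace (\<rho> (inv\<^bsub>\<Gamma>\<^esub> g)) = (\<Sum>c<e. \<Sum>b<d. \<sigma> g $$ (c, c) * \<rho> (inv\<^bsub>\<Gamma>\<^esub> g) $$ (b, b))"
      using irreducible_rep_carrier[OF assms(2), of "inv\<^bsub>\<Gamma>\<^esub> g"] irreducible_rep_carrier[OF assms(3) g] g
      by (simp add: mtrace_def sum_product)
  qed
  also have "\<dots> = (\<Sum>c<e. \<Sum>b<d. \<Sum>g\<in>carrier \<Gamma>. \<sigma> g $$ (c, c) * \<rho> (inv\<^bsub>\<Gamma>\<^esub> g) $$ (b, b))"
    by (subst sum.swap, intro sum.cong refl, rule sum.swap)
  also have "\<dots> = (\<Sum>c<e. \<Sum>b<d. T c b $$ (c, b))"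
    by (intro sum.cong refl) (simp add: T_def)
  also have "\<dots> = 0" using T0 by simp
  finally show ?thesis .
qed

text \<open>The intertwiners used for orthogonality are now scalar matrices \<open>z I\<close>, with
  \<open>z = r / d\<close> for \<open>c = b\<close> and 0 otherwise; the \<open>d\<close> diagonal
  choices add up to \<open>r\<close>.\<close>

lemma character_norm:
  assumes "group \<Gamma>" "finite (carrier \<Gamma>)" "irreducible_rep \<Gamma> d \<rho>"
  shows "(\<Sum>g\<in>carrier \<Gamma>. mtrace (\<rho> g) * mtrace (\<rho> (inv\<^bsub>\<Gamma>\<^esub> g))) = of_nat (card (carrier \<Gamma>))"
proof -
  interpret group \<Gamma> by fact
  let ?r = "of_nat (card (carrier \<Gamma>)) :: complex"
  have d: "d > 0" using assms(3) by (simp add: irreducible_rep_def)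
  have rep: "matrix_rep \<Gamma> d \<rho>" using assms(3) by (rule irreducible_rep_matrix_rep)
  define T where "T c b = mat d d (\<lambda>(i, j). \<Sum>g\<in>carrier \<Gamma>. \<rho> g $$ (i, c) * \<rho> (inv\<^bsub>\<Gamma>\<^esub> g) $$ (b, j))" for c b
  have T: "T c b $$ (c, b) = (if c = b then ?r / of_nat d else 0)" if cb: "c < d" "b < d" for c b
  proof -
    have Tc: "T c b \<in> carrier_mat d d" by (simp add: T_def)
    have com: "T c b * \<rho> h = \<rho> h * T c b" if "h \<in> carrier \<Gamma>" for h
      unfolding T_def using averaged_intertwiner[OF assms(1) rep rep cb that] .
    obtain z where z: "T c b = z \<cdot>\<^sub>m 1\<^sub>m d" using schur_scalar[OF assms(3) Tc com] .
    \<comment> \<open>The trace determines \<open>z\<close>: by cyclicity every group element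
      contributes the entry \<open>(b, c)\<close> of
      \<open>\<rho> (inv g) * \<rho> g = I\<close>.\<close>
    have "of_nat d * z = (\<Sum>i<d. T c b $$ (i, i))" using z by simp
    also have "\<dots> = (\<Sum>i<d. \<Sum>g\<in>carrier \<Gamma>. \<rho> g $$ (i, c) * \<rho> (inv\<^bsub>\<Gamma>\<^esub> g) $$ (b, i))"
      by (intro sum.cong refl) (simp add: T_def)
    also have "\<dots> = (\<Sum>g\<in>carrier \<Gamma>. \<Sum>i<d. \<rho> (inv\<^bsub>\<Gamma>\<^esub> g) $$ (b, i) * \<rho> g $$ (i, c))"
      by (subst sum.swap) (simp add: mult.commute)
    also have "\<dots> = (\<Sum>g\<in>carrier \<Gamma>. (1\<^sub>m d :: complex mat) $$ (b, c))"
    proof (rule sum.cong[OF refl])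
      fix g assume g: "g \<in> carrier \<Gamma>"
      have "\<rho> (inv\<^bsub>\<Gamma>\<^esub> g) * \<rho> g = \<rho> (inv\<^bsub>\<Gamma>\<^esub> g \<otimes>\<^bsub>\<Gamma>\<^esub> g)"
        using rep g inv_closed[OF g] unfolding matrix_rep_def by metis
      also have "\<dots> = 1\<^sub>m d" using g matrix_rep_one[OF assms(1) rep] by simp
      finally show "(\<Sum>i<d. \<rho> (inv\<^bsub>\<Gamma>\<^esub> g) $$ (b, i) * \<rho> g $$ (i, c)) = (1\<^sub>m d :: complex mat) $$ (b, c)"
        using mult_mat_entry[of "\<rho> (inv\<^bsub>\<Gamma>\<^esub> g)" d d "\<rho> g" d b c] g cb irreducible_rep_carrier[OF assms(3)]
        by simp
    qed
    finally have "z = (if c = b then ?r / of_nat d else 0)" using d cb by (auto simp: field_simps)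
    thus ?thesis using z cb by auto
  qed
  have "(\<Sum>g\<in>carrier \<Gamma>. mtrace (\<rho> g) * mtrace (\<rho> (inv\<^bsub>\<Gamma>\<^esub> g))) =
      (\<Sum>g\<in>carrier \<Gamma>. \<Sum>c<d. \<Sum>b<d. \<rho> g $$ (c, c) * \<rho> (inv\<^bsub>\<Gamma>\<^esub> g) $$ (b, b))"
  proof (rule sum.cong[OF refl])
    fix g assume g: "g \<in> carrier \<Gamma>"
    show "mtrace (\<rho> g) * mtrace (\<rho> (inv\<^bsub>\<Gamma>\<^esub> g)) = (\<Sum>c<d. \<Sum>b<d. \<rho> g $$ (c, c) * \<rho> (inv\<^bsub>\<Gamma>\<^esub> g) $$ (b, b))"
      using irreducible_rep_carrier[OF assms(3), of "inv\<^bsub>\<Gamma>\<^esub> g"] irreducible_rep_carrier[OF assms(3) g] g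
      by (simp add: mtrace_def sum_product)
  qed
  also have "\<dots> = (\<Sum>c<d. \<Sum>b<d. \<Sum>g\<in>carrier \<Gamma>. \<rho> g $$ (c, c) * \<rho> (inv\<^bsub>\<Gamma>\<^esub> g) $$ (b, b))"
    by (subst sum.swap, intro sum.cong refl, rule sum.swap)
  also have "\<dots> = (\<Sum>c<d. \<Sum>b<d. T c b $$ (c, b))"
    by (intro sum.cong refl) (simp add: T_def)
  also have "\<dots> = (\<Sum>c<d. \<Sum>b<d. if c = b then ?r / of_nat d else 0)"
    by (intro sum.cong refl) (simp add: T)
  also have "\<dots> = ?r" using d by simp
  finally show ?thesis .
qed

text \<open>\<open>\<Sum>g. \<sigma> g \<otimes> X g\<close>, given entrywise.\<close>

definition twisted_mat ::
  "('g, 'b) monoid_scheme \<Rightarrow> nat \<Rightarrow> ('g \<Rightarrow> complex mat) \<Rightarrow> nat \<Rightarrow> ('g \<Rightarrow> complex mat) \<Rightarrow> complex mat" where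
  "twisted_mat \<Gamma> d \<sigma> N X = mat (d * N) (d * N)
     (\<lambda>(i, j). \<Sum>g\<in>carrier \<Gamma>. \<sigma> g $$ (i div N, j div N) * X g $$ (i mod N, j mod N))"

lemma twisted_mat_carrier [simp]: "twisted_mat \<Gamma> d \<sigma> N X \<in> carrier_mat (d * N) (d * N)"
  by (simp add: twisted_mat_def)

lemma mult_add_less: "a * N + b < d * N" if "a < d" "b < N" for a b d N :: nat
proof -
  have "a * N + b < Suc a * N" using that by simp
  also have "\<dots> \<le> d * N" using that by (intro mult_le_mono1) simp
  finally show ?thesis .
qed

lemma sum_div_mod:
  fixes F :: "nat \<Rightarrow> nat \<Rightarrow> 'c::comm_monoid_add"
  shows "(\<Sum>l<d * N. F (l div N) (l mod N)) = (\<Sum>a<d. \<Sum>b<N. F a b)"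
proof (cases "N = 0")
  case False
  have "(\<Sum>l<d * N. F (l div N) (l mod N)) = (\<Sum>(a, b)\<in>{..<d} \<times> {..<N}. F a b)"
    by (rule sum.reindex_bij_witness[where j = "\<lambda>l. (l div N, l mod N)" and i = "\<lambda>(a, b). a * N + b"])
       (use False in \<open>auto simp: less_mult_imp_div_less div_mult_mod_eq intro: mult_add_less\<close>)
  thus ?thesis by (simp add: sum.cartesian_product)
qed simp

lemma kronecker_one_carrier: "Q \<in> carrier_mat d e \<Longrightarrow> kronecker Q (1\<^sub>m N) \<in> carrier_mat (d * N) (e * N)"
  by (auto simp: kronecker_def)

text \<open>The mixed-product rule for Kronecker products. Together with its mirror image it turns a
  change of basis of the representation into a similarity of the large matrix.\<close>

lemma kronecker_one_mult_twisted:
  assumes "Q \<in> carrier_mat d d" "\<And>g. g \<in> carrier \<Gamma> \<Longrightarrow> \<sigma> g \<in> carrier_mat d d"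
  shows "kronecker Q (1\<^sub>m N) * twisted_mat \<Gamma> d \<sigma> N X = twisted_mat \<Gamma> d (\<lambda>g. Q * \<sigma> g) N X"
proof (rule eq_matI)
  fix i j assume "i < dim_row (twisted_mat \<Gamma> d (\<lambda>g. Q * \<sigma> g) N X)" "j < dim_col (twisted_mat \<Gamma> d (\<lambda>g. Q * \<sigma> g) N X)"
  hence ij: "i < d * N" "j < d * N" by (simp_all add: twisted_mat_def)
  hence N: "0 < N" by (cases N) auto
  have im: "i mod N < N" "j mod N < N" "i div N < d" "j div N < d"
    using ij N by (auto simp: less_mult_imp_div_less)
  have "(kronecker Q (1\<^sub>m N) * twisted_mat \<Gamma> d \<sigma> N X) $$ (i, j) =
    (\<Sum>l<d * N. kronecker Q (1\<^sub>m N) $$ (i, l) * twisted_mat \<Gamma> d \<sigma> N X $$ (l, j))"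
    using ij kronecker_one_carrier[OF assms(1)] twisted_mat_carrier by (intro mult_mat_entry) auto
  also have "\<dots> = (\<Sum>l<d * N. Q $$ (i div N, l div N) * (if i mod N = l mod N then 1 else 0) *
      (\<Sum>g\<in>carrier \<Gamma>. \<sigma> g $$ (l div N, j div N) * X g $$ (l mod N, j mod N)))"
    using ij assms(1) im N by (intro sum.cong refl) (auto simp: kronecker_def twisted_mat_def)
  also have "\<dots> = (\<Sum>a<d. \<Sum>b<N. Q $$ (i div N, a) * (if i mod N = b then 1 else 0) *
      (\<Sum>g\<in>carrier \<Gamma>. \<sigma> g $$ (a, j div N) * X g $$ (b, j mod N)))"
    by (rule sum_div_mod)
  also have "\<dots> = (\<Sum>a<d. Q $$ (i div N, a) * (\<Sum>g\<in>carrier \<Gamma>. \<sigma> g $$ (a, j div N) * X g $$ (i mod N, j mod N)))"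
  proof (rule sum.cong[OF refl])
    fix a
    have "(\<Sum>b<N. Q $$ (i div N, a) * (if i mod N = b then 1 else 0) *
      (\<Sum>g\<in>carrier \<Gamma>. \<sigma> g $$ (a, j div N) * X g $$ (b, j mod N))) =
      (\<Sum>b<N. if i mod N = b then Q $$ (i div N, a) *
      (\<Sum>g\<in>carrier \<Gamma>. \<sigma> g $$ (a, j div N) * X g $$ (b, j mod N)) else 0)"
      by (intro sum.cong refl) auto
    thus "(\<Sum>b<N. Q $$ (i div N, a) * (if i mod N = b then 1 else 0) *
      (\<Sum>g\<in>carrier \<Gamma>. \<sigma> g $$ (a, j div N) * X g $$ (b, j mod N))) =
      Q $$ (i div N, a) * (\<Sum>g\<in>carrier \<Gamma>. \<sigma> g $$ (a, j div N) * X g $$ (i mod N, j mod N))"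
      using im by simp
  qed
  also have "\<dots> = (\<Sum>g\<in>carrier \<Gamma>. (\<Sum>a<d. Q $$ (i div N, a) * \<sigma> g $$ (a, j div N)) * X g $$ (i mod N, j mod N))"
    unfolding sum_distrib_left sum_distrib_right by (subst sum.swap) (simp add: mult.assoc)
  also have "\<dots> = (\<Sum>g\<in>carrier \<Gamma>. (Q * \<sigma> g) $$ (i div N, j div N) * X g $$ (i mod N, j mod N))"
  proof (rule sum.cong[OF refl])
    fix g assume g: "g \<in> carrier \<Gamma>"
    show "(\<Sum>a<d. Q $$ (i div N, a) * \<sigma> g $$ (a, j div N)) * X g $$ (i mod N, j mod N) =
      (Q * \<sigma> g) $$ (i div N, j div N) * X g $$ (i mod N, j mod N)"
      unfolding mult_mat_entry[OF assms(1) assms(2)[OF g] im(3,4)] ..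
  qed
  also have "\<dots> = twisted_mat \<Gamma> d (\<lambda>g. Q * \<sigma> g) N X $$ (i, j)"
    using ij by (simp add: twisted_mat_def)
  finally show "(kronecker Q (1\<^sub>m N) * twisted_mat \<Gamma> d \<sigma> N X) $$ (i, j) =
    twisted_mat \<Gamma> d (\<lambda>g. Q * \<sigma> g) N X $$ (i, j)" .
qed (use assms in \<open>auto simp: twisted_mat_def kronecker_def\<close>)

lemma twisted_mult_kronecker_one:
  assumes "Q \<in> carrier_mat d d" "\<And>g. g \<in> carrier \<Gamma> \<Longrightarrow> \<sigma> g \<in> carrier_mat d d"
  shows "twisted_mat \<Gamma> d \<sigma> N X * kronecker Q (1\<^sub>m N) = twisted_mat \<Gamma> d (\<lambda>g. \<sigma> g * Q) N X"
proof (rule eq_matI)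
  fix i j assume "i < dim_row (twisted_mat \<Gamma> d (\<lambda>g. \<sigma> g * Q) N X)" "j < dim_col (twisted_mat \<Gamma> d (\<lambda>g. \<sigma> g * Q) N X)"
  hence ij: "i < d * N" "j < d * N" by (simp_all add: twisted_mat_def)
  hence N: "0 < N" by (cases N) auto
  have im: "i mod N < N" "j mod N < N" "i div N < d" "j div N < d"
    using ij N by (auto simp: less_mult_imp_div_less)
  have "(twisted_mat \<Gamma> d \<sigma> N X * kronecker Q (1\<^sub>m N)) $$ (i, j) =
    (\<Sum>l<d * N. twisted_mat \<Gamma> d \<sigma> N X $$ (i, l) * kronecker Q (1\<^sub>m N) $$ (l, j))"
    using ij kronecker_one_carrier[OF assms(1)] twisted_mat_carrier by (intro mult_mat_entry) auto
  also have "\<dots> = (\<Sum>l<d * N. (\<Sum>g\<in>carrier \<Gamma>. \<sigma> g $$ (i div N, l div N) * X g $$ (i mod N, l mod N)) *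
      (Q $$ (l div N, j div N) * (if l mod N = j mod N then 1 else 0)))"
    using ij assms(1) im N by (intro sum.cong refl) (auto simp: kronecker_def twisted_mat_def)
  also have "\<dots> = (\<Sum>a<d. \<Sum>b<N. (\<Sum>g\<in>carrier \<Gamma>. \<sigma> g $$ (i div N, a) * X g $$ (i mod N, b)) *
      (Q $$ (a, j div N) * (if b = j mod N then 1 else 0)))"
    by (rule sum_div_mod)
  also have "\<dots> = (\<Sum>a<d. (\<Sum>g\<in>carrier \<Gamma>. \<sigma> g $$ (i div N, a) * X g $$ (i mod N, j mod N)) * Q $$ (a, j div N))"
  proof (rule sum.cong[OF refl])
    fix a
    have "(\<Sum>b<N. (\<Sum>g\<in>carrier \<Gamma>. \<sigma> g $$ (i div N, a) * X g $$ (i mod N, b)) *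
      (Q $$ (a, j div N) * (if b = j mod N then 1 else 0))) =
      (\<Sum>b<N. if b = j mod N then (\<Sum>g\<in>carrier \<Gamma>. \<sigma> g $$ (i div N, a) * X g $$ (i mod N, b)) *
       Q $$ (a, j div N) else 0)"
      by (intro sum.cong refl) auto
    thus "(\<Sum>b<N. (\<Sum>g\<in>carrier \<Gamma>. \<sigma> g $$ (i div N, a) * X g $$ (i mod N, b)) *
      (Q $$ (a, j div N) * (if b = j mod N then 1 else 0))) =
      (\<Sum>g\<in>carrier \<Gamma>. \<sigma> g $$ (i div N, a) * X g $$ (i mod N, j mod N)) * Q $$ (a, j div N)"
      using im by simp
  qed
  also have "\<dots> = (\<Sum>g\<in>carrier \<Gamma>. (\<Sum>a<d. \<sigma> g $$ (i div N, a) * Q $$ (a, j div N)) * X g $$ (i mod N, j mod N))"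
    unfolding sum_distrib_left sum_distrib_right by (subst sum.swap) (simp add: mult_ac)
  also have "\<dots> = (\<Sum>g\<in>carrier \<Gamma>. (\<sigma> g * Q) $$ (i div N, j div N) * X g $$ (i mod N, j mod N))"
  proof (rule sum.cong[OF refl])
    fix g assume g: "g \<in> carrier \<Gamma>"
    show "(\<Sum>a<d. \<sigma> g $$ (i div N, a) * Q $$ (a, j div N)) * X g $$ (i mod N, j mod N) =
      (\<sigma> g * Q) $$ (i div N, j div N) * X g $$ (i mod N, j mod N)"
      unfolding mult_mat_entry[OF assms(2)[OF g] assms(1) im(3,4)] ..
  qed
  also have "\<dots> = twisted_mat \<Gamma> d (\<lambda>g. \<sigma> g * Q) N X $$ (i, j)"
    using ij by (simp add: twisted_mat_def)
  finally show "(twisted_mat \<Gamma> d \<sigma> N X * kronecker Q (1\<^sub>m N)) $$ (i, j) =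
    twisted_mat \<Gamma> d (\<lambda>g. \<sigma> g * Q) N X $$ (i, j)" .
qed (use assms in \<open>auto simp: twisted_mat_def kronecker_def\<close>)

section \<open>Composition factors and the group determinant\<close>

lemma invertible_matE:
  assumes "invertible_mat P" "P \<in> carrier_mat d d"
  obtains R where "R \<in> carrier_mat d d" "P * R = 1\<^sub>m d" "R * P = 1\<^sub>m d"
proof -
  obtain R where R: "P * R = 1\<^sub>m d" "R * P = 1\<^sub>m (dim_row R)"
    using assms by (auto simp: invertible_mat_def inverts_mat_def)
  have "dim_col R = d" using R(1) by (metis index_mult_mat(3) index_one_mat(3))
  moreover have "dim_row R = d"
    using R(2) assms(2) by (metis carrier_matD(2) index_mult_mat(3) index_one_mat(3))
  ultimately show ?thesis using R by (intro that[of R]) auto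
qed

lemma twisted_mat_cong:
  assumes "\<And>g. g \<in> carrier \<Gamma> \<Longrightarrow> \<sigma> g = \<sigma>' g"
  shows "twisted_mat \<Gamma> d \<sigma> N X = twisted_mat \<Gamma> d \<sigma>' N X"
  unfolding twisted_mat_def using assms by simp

lemma kronecker_inverse:
  assumes "Q \<in> carrier_mat d d" "R \<in> carrier_mat d d" "R * Q = 1\<^sub>m d"
  shows "kronecker R (1\<^sub>m N) * kronecker Q (1\<^sub>m N) = 1\<^sub>m (d * N)"
proof -
  \<comment> \<open>Over a one-element carrier \<open>twisted_mat\<close> is an ordinary Kronecker
    product, so the mixed-product rule applies to it.\<close>
  let ?\<Gamma> = "\<lparr>carrier = {()}, mult = (\<lambda>_ _. ()), one = ()\<rparr>"
  have im: "i div N < d" "i mod N < N" if "i < d * N" for i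
    using that by (auto simp: less_mult_imp_div_less) (cases N; auto)
  have k: "kronecker Q (1\<^sub>m N) = twisted_mat ?\<Gamma> d (\<lambda>_. Q) N (\<lambda>_. 1\<^sub>m N)"
    using assms(1) by (intro eq_matI) (auto simp: kronecker_def twisted_mat_def)
  have "kronecker R (1\<^sub>m N) * kronecker Q (1\<^sub>m N) = twisted_mat ?\<Gamma> d (\<lambda>_. R * Q) N (\<lambda>_. 1\<^sub>m N)"
    unfolding k using assms(1,2) by (intro kronecker_one_mult_twisted) auto
  also have "\<dots> = 1\<^sub>m (d * N)"
    unfolding assms(3)
  proof (rule eq_matI)
    fix i j assume "i < dim_row (1\<^sub>m (d * N) :: complex mat)" "j < dim_col (1\<^sub>m (d * N) :: complex mat)"
    hence ij: "i < d * N" "j < d * N" by auto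
    have "i = j \<longleftrightarrow> i div N = j div N \<and> i mod N = j mod N" by (metis div_mult_mod_eq)
    thus "twisted_mat ?\<Gamma> d (\<lambda>_. 1\<^sub>m d) N (\<lambda>_. 1\<^sub>m N) $$ (i, j) = 1\<^sub>m (d * N) $$ (i, j)"
      using ij im[OF ij(1)] im[OF ij(2)] by (auto simp: twisted_mat_def)
  qed (auto simp: twisted_mat_def)
  finally show ?thesis .
qed

lemma det_twisted_similar:
  assumes "Q \<in> carrier_mat d d" "R \<in> carrier_mat d d" "R * Q = 1\<^sub>m d"
    "\<And>g. g \<in> carrier \<Gamma> \<Longrightarrow> \<sigma> g \<in> carrier_mat d d"
  shows "det (twisted_mat \<Gamma> d (\<lambda>g. R * \<sigma> g * Q) N X) = det (twisted_mat \<Gamma> d \<sigma> N X)"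
proof -
  let ?R = "kronecker R (1\<^sub>m N)" and ?Q = "kronecker Q (1\<^sub>m N)" and ?T = "twisted_mat \<Gamma> d \<sigma> N X"
  have c: "?R \<in> carrier_mat (d * N) (d * N)" "?Q \<in> carrier_mat (d * N) (d * N)"
    using assms by (auto intro: kronecker_one_carrier)
  have "twisted_mat \<Gamma> d (\<lambda>g. R * \<sigma> g * Q) N X = twisted_mat \<Gamma> d (\<lambda>g. R * \<sigma> g) N X * ?Q"
    using assms by (intro twisted_mult_kronecker_one[symmetric]) auto
  also have "twisted_mat \<Gamma> d (\<lambda>g. R * \<sigma> g) N X = ?R * ?T"
    using assms by (intro kronecker_one_mult_twisted[symmetric]) auto
  finally have "det (twisted_mat \<Gamma> d (\<lambda>g. R * \<sigma> g * Q) N X) = (det ?R * det ?T) * det ?Q"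
    using c by (simp add: det_mult[of _ "d * N"])
  also have "\<dots> = det (?R * ?Q) * det ?T" using c by (simp add: det_mult[of _ "d * N"])
  also have "\<dots> = det ?T" using kronecker_inverse[OF assms(1-3)] by simp
  finally show ?thesis .
qed

text \<open>The representation index is \<open>i div N\<close>, so a block boundary at
  \<open>k\<close> in the representation becomes one at \<open>k * N\<close> in the twisted
  matrix.\<close>

lemma det_twisted_four_block:
  assumes "k \<le> d"
    and S: "\<And>g. g \<in> carrier \<Gamma> \<Longrightarrow> S g = four_block_mat (A g) (B g) (0\<^sub>m (d - k) k) (D g)"
    and AD: "\<And>g. g \<in> carrier \<Gamma> \<Longrightarrow> A g \<in> carrier_mat k k"
      "\<And>g. g \<in> carrier \<Gamma> \<Longrightarrow> D g \<in> carrier_mat (d - k) (d - k)"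
  shows "det (twisted_mat \<Gamma> d S N X) = det (twisted_mat \<Gamma> k A N X) * det (twisted_mat \<Gamma> (d - k) D N X)"
proof -
  define Y where "Y = mat (k * N) ((d - k) * N) (\<lambda>(i, j). twisted_mat \<Gamma> d S N X $$ (i, j + k * N))"
  have dN: "k * N + (d - k) * N = d * N" using assms(1) by (simp flip: add_mult_distrib)
  have "twisted_mat \<Gamma> d S N X =
      four_block_mat (twisted_mat \<Gamma> k A N X) Y (0\<^sub>m ((d - k) * N) (k * N)) (twisted_mat \<Gamma> (d - k) D N X)"
  proof (rule eq_matI)
    fix i j assume "i < dim_row (four_block_mat (twisted_mat \<Gamma> k A N X) Y (0\<^sub>m ((d - k) * N) (k * N)) (twisted_mat \<Gamma> (d - k) D N X))"
      "j < dim_col (four_block_mat (twisted_mat \<Gamma> k A N X) Y (0\<^sub>m ((d - k) * N) (k * N)) (twisted_mat \<Gamma> (d - k) D N X))"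
    hence ij: "i < d * N" "j < d * N" using dN by (auto simp: twisted_mat_def)
    hence N: "0 < N" by (cases N) auto
    have lt: "l div N < k \<longleftrightarrow> l < k * N" for l using N by (simp add: div_less_iff_less_mult)
    have sub: "(l - k * N) div N = l div N - k" "(l - k * N) mod N = l mod N" if "k * N \<le> l" for l
    proof -
      define l' where "l' = l - k * N"
      have l: "l = l' + k * N" using that by (simp add: l'_def)
      show "(l - k * N) div N = l div N - k" "(l - k * N) mod N = l mod N"
        using N unfolding l'_def[symmetric] l by simp_all
    qed
    have dv: "i div N < d" "j div N < d" using ij by (simp_all add: less_mult_imp_div_less)
    show "twisted_mat \<Gamma> d S N X $$ (i, j) =
      four_block_mat (twisted_mat \<Gamma> k A N X) Y (0\<^sub>m ((d - k) * N) (k * N)) (twisted_mat \<Gamma> (d - k) D N X) $$ (i, j)"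
    proof (cases "i < k * N"; cases "j < k * N")
      assume a: "i < k * N" "j < k * N"
      have "S g $$ (i div N, j div N) = A g $$ (i div N, j div N)" if g: "g \<in> carrier \<Gamma>" for g
        using S[OF g] AD[OF g] a dv assms(1) lt by simp
      thus ?thesis using a ij dN by (simp add: twisted_mat_def)
    next
      assume a: "i < k * N" "\<not> j < k * N"
      show ?thesis using a ij dN by (simp add: twisted_mat_def Y_def)
    next
      assume a: "\<not> i < k * N" "j < k * N"
      have "S g $$ (i div N, j div N) = 0" if g: "g \<in> carrier \<Gamma>" for g
        using S[OF g] AD[OF g] a dv assms(1) lt[of i] lt[of j] by simp
      thus ?thesis using a ij dN by (simp add: twisted_mat_def)
    next
      assume a: "\<not> i < k * N" "\<not> j < k * N"
      have "S g $$ (i div N, j div N) = D g $$ ((i - k * N) div N, (j - k * N) div N)"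
        if g: "g \<in> carrier \<Gamma>" for g
        using S[OF g] AD[OF g] a dv assms(1) lt[of i] lt[of j] sub(1)[of i] sub(1)[of j] by simp
      thus ?thesis using a ij dN sub(2)[of i] sub(2)[of j] by (simp add: twisted_mat_def)
    qed
  qed (use dN in \<open>auto simp: twisted_mat_def\<close>)
  moreover have "Y \<in> carrier_mat (k * N) ((d - k) * N)" by (simp add: Y_def)
  ultimately show ?thesis
    using det_four_block_mat_lower_left_zero[OF twisted_mat_carrier _ refl twisted_mat_carrier] by simp
qed

text \<open>In a basis adapted to a proper invariant subspace \<open>U\<close>, the blocks
  \<open>A\<close> and \<open>D\<close> are the subrepresentation on \<open>U\<close> and the
  quotient representation. No invariant complement is constructed, so \<open>B\<close> stays
  arbitrary.\<close>

lemma reducible_rep_block_triangular: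
  assumes "group \<Gamma>" and rep: "matrix_rep \<Gamma> d \<sigma>" and "0 < d" "\<not> irreducible_rep \<Gamma> d \<sigma>"
  obtains k Q R A B D where "0 < k" "k < d" "Q \<in> carrier_mat d d" "R \<in> carrier_mat d d" "R * Q = 1\<^sub>m d"
    "Q * R = 1\<^sub>m d" "matrix_rep \<Gamma> k A" "matrix_rep \<Gamma> (d - k) D"
    "\<And>g. g \<in> carrier \<Gamma> \<Longrightarrow> R * \<sigma> g * Q = four_block_mat (A g) (B g) (0\<^sub>m (d - k) k) (D g)"
proof -
  interpret group \<Gamma> by fact
  have sc: "\<sigma> g \<in> carrier_mat d d" if "g \<in> carrier \<Gamma>" for g
    using rep that by (simp add: matrix_rep_def)
  obtain U where U: "VectorSpace.subspace class_ring U (module_vec TYPE(complex) d)"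
    and inv: "\<And>g x. g \<in> carrier \<Gamma> \<Longrightarrow> x \<in> U \<Longrightarrow> \<sigma> g *\<^sub>v x \<in> U"
    and nt: "U \<noteq> {0\<^sub>v d}" "U \<noteq> carrier_vec d"
    using assms(3,4) rep unfolding irreducible_rep_def by blast
  have Uc: "U \<subseteq> carrier_vec d" using U by (simp add: subspace_module_vec_iff)
  obtain k Q R where k: "k \<le> d" and Q: "Q \<in> carrier_mat d d" and R: "R \<in> carrier_mat d d"
    and QR: "Q * R = 1\<^sub>m d" and RQ: "R * Q = 1\<^sub>m d"
    and col: "\<And>j. j < k \<Longrightarrow> col Q j \<in> U"
    and zero: "\<And>x i. x \<in> U \<Longrightarrow> k \<le> i \<Longrightarrow> i < d \<Longrightarrow> (R *\<^sub>v x) $ i = 0"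
    using adapted_basis[OF Uc] by metis
  have QRx: "Q *\<^sub>v (R *\<^sub>v x) = x" if "x \<in> carrier_vec d" for x
    using that Q R QR by (metis assoc_mult_mat_vec one_mult_mat_vec)
  have "k \<noteq> 0"
  proof
    assume "k = 0"
    have "x = 0\<^sub>v d" if x: "x \<in> U" for x
    proof -
      have "R *\<^sub>v x = 0\<^sub>v d" using zero[OF x] R \<open>k = 0\<close> by (intro eq_vecI) auto
      hence "x = Q *\<^sub>v 0\<^sub>v d" using QRx[of x] x Uc by auto
      thus ?thesis using Q by auto
    qed
    hence "U = {0\<^sub>v d}" using U by (auto simp: subspace_module_vec_iff)
    thus False using nt by simp
  qed
  have "k \<noteq> d"
  proof
    assume "k = d"
    have "x \<in> U" if x: "x \<in> carrier_vec d" for x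
    proof -
      have "Q *\<^sub>v (R *\<^sub>v x) \<in> U"
        by (rule mult_mat_vec_in_subspace[OF U Q]) (use R x col \<open>k = d\<close> in auto)
      thus ?thesis using QRx[OF x] by simp
    qed
    hence "U = carrier_vec d" using Uc by blast
    thus False using nt by simp
  qed
  define S where "S g = R * \<sigma> g * Q" for g
  have Sc: "S g \<in> carrier_mat d d" if "g \<in> carrier \<Gamma>" for g
    using sc[OF that] Q R by (auto simp: S_def)
  \<comment> \<open>Column \<open>j < k\<close> of \<open>Q\<close> lies in \<open>U\<close>,
    \<open>\<sigma> g\<close> keeps it there, and \<open>R\<close> gives elements of
    \<open>U\<close> no coordinates from \<open>k\<close> onwards.\<close>
  have Sz: "S g $$ (i, j) = 0" if g: "g \<in> carrier \<Gamma>" and ij: "k \<le> i" "i < d" "j < k" for g i j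
  proof -
    have jd: "j < d" using ij k by simp
    have "S g $$ (i, j) = col (S g) j $ i" using Sc[OF g] ij jd by simp
    also have "col (S g) j = S g *\<^sub>v unit_vec d j" using mult_mat_unit_vec[OF Sc[OF g] jd] by simp
    also have "\<dots> = R *\<^sub>v (\<sigma> g *\<^sub>v (Q *\<^sub>v unit_vec d j))"
    proof -
      have "Q *\<^sub>v unit_vec d j \<in> carrier_vec d" using Q by auto
      hence "R *\<^sub>v (\<sigma> g *\<^sub>v (Q *\<^sub>v unit_vec d j)) = (R * \<sigma> g) *\<^sub>v (Q *\<^sub>v unit_vec d j)"
        by (rule assoc_mult_mat_vec[OF R sc[OF g], symmetric])
      also have "\<dots> = S g *\<^sub>v unit_vec d j"
        unfolding S_def using R sc[OF g] by (intro assoc_mult_mat_vec[OF _ Q, symmetric]) auto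
      finally show ?thesis by simp
    qed
    also have "Q *\<^sub>v unit_vec d j = col Q j" by (rule mult_mat_unit_vec[OF Q jd])
    also have "(R *\<^sub>v (\<sigma> g *\<^sub>v col Q j)) $ i = 0" using zero inv[OF g col[OF ij(3)]] ij by blast
    finally show ?thesis .
  qed
  have S1: "S \<one>\<^bsub>\<Gamma>\<^esub> = 1\<^sub>m d" using matrix_rep_one[OF assms(1) rep] R RQ by (simp add: S_def)
  have Sm: "S (g \<otimes>\<^bsub>\<Gamma>\<^esub> h) = S g * S h" if g: "g \<in> carrier \<Gamma>" and h: "h \<in> carrier \<Gamma>" for g h
  proof -
    note c = sc[OF g] sc[OF h] Q R
    have "S g * S h = R * \<sigma> g * (Q * (R * (\<sigma> h * Q)))"
      unfolding S_def using c by (simp add: assoc_mult_mat[of _ d d _ d _ d])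
    also have "Q * (R * (\<sigma> h * Q)) = (Q * R) * (\<sigma> h * Q)"
      using c by (intro assoc_mult_mat[symmetric]) auto
    also have "\<dots> = \<sigma> h * Q" unfolding QR using c by simp
    also have "R * \<sigma> g * (\<sigma> h * Q) = R * (\<sigma> g * \<sigma> h) * Q"
      using c by (simp add: assoc_mult_mat[of _ d d _ d _ d])
    also have "\<sigma> g * \<sigma> h = \<sigma> (g \<otimes>\<^bsub>\<Gamma>\<^esub> h)" using rep g h by (simp add: matrix_rep_def)
    finally show ?thesis by (simp add: S_def)
  qed
  have Sent: "S (g \<otimes>\<^bsub>\<Gamma>\<^esub> h) $$ (i, j) = (\<Sum>l<d. S g $$ (i, l) * S h $$ (l, j))"
    if "g \<in> carrier \<Gamma>" "h \<in> carrier \<Gamma>" "i < d" "j < d" for g h i j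
    unfolding Sm[OF that(1,2)] using mult_mat_entry[OF Sc Sc] that by blast
  define A where "A g = mat k k (\<lambda>(i, j). S g $$ (i, j))" for g
  define B where "B g = mat k (d - k) (\<lambda>(i, j). S g $$ (i, j + k))" for g
  define D where "D g = mat (d - k) (d - k) (\<lambda>(i, j). S g $$ (i + k, j + k))" for g
  have A: "matrix_rep \<Gamma> k A"
  proof (rule matrix_repI[OF assms(1)])
    show "A \<one>\<^bsub>\<Gamma>\<^esub> = 1\<^sub>m k" using k by (intro eq_matI) (auto simp: A_def S1)
    fix g h assume g: "g \<in> carrier \<Gamma>" and h: "h \<in> carrier \<Gamma>"
    show "A (g \<otimes>\<^bsub>\<Gamma>\<^esub> h) = A g * A h"
    proof (rule eq_matI)
      fix i j assume "i < dim_row (A g * A h)" "j < dim_col (A g * A h)"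
      hence ij: "i < k" "j < k" by (auto simp: A_def)
      have "(A g * A h) $$ (i, j) = (\<Sum>l<k. S g $$ (i, l) * S h $$ (l, j))"
        using ij by (subst mult_mat_entry[of _ k k _ k]) (auto simp: A_def)
      also have "\<dots> = (\<Sum>l<d. S g $$ (i, l) * S h $$ (l, j))"
        using k ij by (intro sum.mono_neutral_left) (auto simp: Sz[OF h])
      also have "\<dots> = A (g \<otimes>\<^bsub>\<Gamma>\<^esub> h) $$ (i, j)"
        using Sent[OF g h, of i j] ij k by (simp add: A_def)
      finally show "A (g \<otimes>\<^bsub>\<Gamma>\<^esub> h) $$ (i, j) = (A g * A h) $$ (i, j)" by simp
    qed (auto simp: A_def)
  qed (auto simp: A_def)
  have D: "matrix_rep \<Gamma> (d - k) D"
  proof (rule matrix_repI[OF assms(1)])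
    show "D \<one>\<^bsub>\<Gamma>\<^esub> = 1\<^sub>m (d - k)" using k by (intro eq_matI) (auto simp: D_def S1)
    fix g h assume g: "g \<in> carrier \<Gamma>" and h: "h \<in> carrier \<Gamma>"
    show "D (g \<otimes>\<^bsub>\<Gamma>\<^esub> h) = D g * D h"
    proof (rule eq_matI)
      fix i j assume "i < dim_row (D g * D h)" "j < dim_col (D g * D h)"
      hence ij: "i < d - k" "j < d - k" by (auto simp: D_def)
      have "(D g * D h) $$ (i, j) = (\<Sum>l<d - k. S g $$ (i + k, l + k) * S h $$ (l + k, j + k))"
        using ij by (subst mult_mat_entry[of _ "d - k" "d - k" _ "d - k"]) (auto simp: D_def)
      also have "\<dots> = (\<Sum>l\<in>{k..<d}. S g $$ (i + k, l) * S h $$ (l, j + k))"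
        by (rule sum.reindex_bij_witness[where i = "\<lambda>l. l - k" and j = "\<lambda>l. l + k"]) auto
      also have "\<dots> = (\<Sum>l<d. S g $$ (i + k, l) * S h $$ (l, j + k))"
        using ij by (intro sum.mono_neutral_left) (auto simp: Sz[OF g])
      also have "\<dots> = D (g \<otimes>\<^bsub>\<Gamma>\<^esub> h) $$ (i, j)"
        using Sent[OF g h, of "i + k" "j + k"] ij by (simp add: D_def)
      finally show "D (g \<otimes>\<^bsub>\<Gamma>\<^esub> h) $$ (i, j) = (D g * D h) $$ (i, j)" by simp
    qed (auto simp: D_def)
  qed (auto simp: D_def)
  have "R * \<sigma> g * Q = four_block_mat (A g) (B g) (0\<^sub>m (d - k) k) (D g)" if g: "g \<in> carrier \<Gamma>" for g
    unfolding S_def[symmetric]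
    using Sc[OF g] k Sz[OF g] by (intro eq_matI) (auto simp: A_def B_def D_def)
  thus ?thesis using that[of k Q R A D B] \<open>k \<noteq> 0\<close> \<open>k \<noteq> d\<close> k Q R RQ QR A D by simp
qed

lemma mtrace_similar:
  assumes "Q \<in> carrier_mat d d" "R \<in> carrier_mat d d" "Q * R = 1\<^sub>m d" "S \<in> carrier_mat d d"
  shows "mtrace (R * S * Q) = mtrace S"
proof -
  have "mtrace (R * S * Q) = mtrace (Q * (R * S))" using assms by (intro mtrace_comm[of _ d d]) auto
  also have "Q * (R * S) = (Q * R) * S" using assms by (intro assoc_mult_mat[symmetric]) auto
  finally show ?thesis using assms by simp
qed

lemma mtrace_four_block:
  assumes "A \<in> carrier_mat k k" "D \<in> carrier_mat l l"
  shows "mtrace (four_block_mat A B C D) = mtrace A + mtrace D"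
proof -
  have "mtrace (four_block_mat A B C D) =
      (\<Sum>i<k + l. if i < k then A $$ (i, i) else D $$ (i - k, i - k))"
    unfolding mtrace_def using assms by (intro sum.cong) auto
  also have "\<dots> = (\<Sum>i<k. A $$ (i, i)) + (\<Sum>i<l. D $$ (i, i))"
    by (induction l) auto
  finally show ?thesis using assms by (simp add: mtrace_def)
qed

text \<open>Trace and twisted determinant are both invariant under conjugation, and over a
  block-triangular form one is additive and the other multiplicative. Hence the same multiplicities
  \<open>m\<close> serve for both and are independent of \<open>N\<close> and
  \<open>X\<close>.\<close>

lemma rep_composition_factors:
  assumes "group \<Gamma>" "complete_irreps \<Gamma> k f \<rho>" "matrix_rep \<Gamma> d \<sigma>"
  shows "\<exists>m. (\<forall>g\<in>carrier \<Gamma>. mtrace (\<sigma> g) = (\<Sum>i = 1..k. of_nat (m i) * mtrace (\<rho> i g))) \<and>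
    (\<forall>N X. det (twisted_mat \<Gamma> d \<sigma> N X) = (\<Prod>i = 1..k. det (twisted_mat \<Gamma> (f i) (\<rho> i) N X) ^ m i))"
  using assms(3)
proof (induction d arbitrary: \<sigma> rule: less_induct)
  case (less d)
  have sc: "\<sigma> g \<in> carrier_mat d d" if "g \<in> carrier \<Gamma>" for g
    using less.prems that by (simp add: matrix_rep_def)
  consider "d = 0" | "irreducible_rep \<Gamma> d \<sigma>" | "0 < d" "\<not> irreducible_rep \<Gamma> d \<sigma>" by blast
  thus ?case
  proof cases
    case 1
    have "mtrace (\<sigma> g) = 0" if "g \<in> carrier \<Gamma>" for g using sc[OF that] 1 by (simp add: mtrace_def)
    moreover have "det (twisted_mat \<Gamma> d \<sigma> N X) = 1" for N X
      using 1 by (intro det_dim_zero) (simp add: twisted_mat_def)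
    ultimately show ?thesis by (intro exI[of _ "\<lambda>_. 0"]) simp
  next
    case 2
    then obtain i where i: "i \<in> {1..k}" "equivalent_reps \<Gamma> d \<sigma> (f i) (\<rho> i)"
      using assms(2) unfolding complete_irreps_def by blast
    then obtain P where fi: "f i = d" and P: "P \<in> carrier_mat d d" "invertible_mat P"
      "\<And>g. g \<in> carrier \<Gamma> \<Longrightarrow> P * \<sigma> g = \<rho> i g * P" by (auto simp: equivalent_reps_def)
    obtain R where R: "R \<in> carrier_mat d d" "P * R = 1\<^sub>m d" "R * P = 1\<^sub>m d"
      using invertible_matE[OF P(2,1)] .
    have conj: "\<rho> i g = P * \<sigma> g * R" if g: "g \<in> carrier \<Gamma>" for g
    proof -
      have rc: "\<rho> i g \<in> carrier_mat d d"
        using assms(2) i(1) g fi irreducible_rep_carrier[of \<Gamma> "f i" "\<rho> i" g] by (auto simp: complete_irreps_def)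
      have "P * \<sigma> g * R = \<rho> i g * (P * R)"
        unfolding P(3)[OF g] using rc P R by (intro assoc_mult_mat) auto
      thus ?thesis using rc R by simp
    qed
    have tr: "mtrace (\<rho> i g) = mtrace (\<sigma> g)" if g: "g \<in> carrier \<Gamma>" for g
      unfolding conj[OF g] using P R sc[OF g] by (intro mtrace_similar) auto
    have "twisted_mat \<Gamma> (f i) (\<rho> i) N X = twisted_mat \<Gamma> d (\<lambda>g. P * \<sigma> g * R) N X" for N X
      unfolding fi by (rule twisted_mat_cong) (rule conj)
    hence dt: "det (twisted_mat \<Gamma> (f i) (\<rho> i) N X) = det (twisted_mat \<Gamma> d \<sigma> N X)" for N X
      using det_twisted_similar[OF R(1) P(1) R(2), of \<Gamma> \<sigma>] sc by simp
    let ?m = "\<lambda>j. if j = i then 1 else 0 :: nat"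
    have "(\<Sum>j = 1..k. of_nat (?m j) * mtrace (\<rho> j g)) = (\<Sum>j = 1..k. if j = i then mtrace (\<rho> j g) else 0)" for g
      by (intro sum.cong) auto
    moreover have "(\<Prod>j = 1..k. det (twisted_mat \<Gamma> (f j) (\<rho> j) N X) ^ ?m j) =
        (\<Prod>j = 1..k. if j = i then det (twisted_mat \<Gamma> (f j) (\<rho> j) N X) else 1)" for N X
      by (intro prod.cong) auto
    ultimately show ?thesis using i(1) tr dt by (intro exI[of _ ?m]) simp
  next
    case 3
    obtain l Q R A B D where l: "0 < l" "l < d" and Q: "Q \<in> carrier_mat d d" "R \<in> carrier_mat d d"
      "R * Q = 1\<^sub>m d" "Q * R = 1\<^sub>m d" and AD: "matrix_rep \<Gamma> l A" "matrix_rep \<Gamma> (d - l) D"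
      and blk: "\<And>g. g \<in> carrier \<Gamma> \<Longrightarrow> R * \<sigma> g * Q = four_block_mat (A g) (B g) (0\<^sub>m (d - l) l) (D g)"
      using reducible_rep_block_triangular[OF assms(1) less.prems 3] by metis
    have ADc: "A g \<in> carrier_mat l l" "D g \<in> carrier_mat (d - l) (d - l)" if "g \<in> carrier \<Gamma>" for g
      using AD that by (simp_all add: matrix_rep_def)
    obtain m1 where m1: "\<And>g. g \<in> carrier \<Gamma> \<Longrightarrow> mtrace (A g) = (\<Sum>i = 1..k. of_nat (m1 i) * mtrace (\<rho> i g))"
      "\<And>N X. det (twisted_mat \<Gamma> l A N X) = (\<Prod>i = 1..k. det (twisted_mat \<Gamma> (f i) (\<rho> i) N X) ^ m1 i)"
      using less.IH[OF l(2) AD(1)] by blast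
    have "d - l < d" using l by simp
    then obtain m2 where m2: "\<And>g. g \<in> carrier \<Gamma> \<Longrightarrow> mtrace (D g) = (\<Sum>i = 1..k. of_nat (m2 i) * mtrace (\<rho> i g))"
      "\<And>N X. det (twisted_mat \<Gamma> (d - l) D N X) = (\<Prod>i = 1..k. det (twisted_mat \<Gamma> (f i) (\<rho> i) N X) ^ m2 i)"
      using less.IH[OF _ AD(2)] by blast
    have "mtrace (\<sigma> g) = (\<Sum>i = 1..k. of_nat (m1 i + m2 i) * mtrace (\<rho> i g))" if g: "g \<in> carrier \<Gamma>" for g
    proof -
      have "mtrace (\<sigma> g) = mtrace (R * \<sigma> g * Q)" using mtrace_similar[OF Q(1,2,4) sc[OF g]] by simp
      also have "\<dots> = mtrace (A g) + mtrace (D g)"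
        unfolding blk[OF g] by (rule mtrace_four_block[OF ADc[OF g]])
      finally show ?thesis by (simp add: m1(1)[OF g] m2(1)[OF g] distrib_right sum.distrib)
    qed
    moreover have "det (twisted_mat \<Gamma> d \<sigma> N X) =
        (\<Prod>i = 1..k. det (twisted_mat \<Gamma> (f i) (\<rho> i) N X) ^ (m1 i + m2 i))" for N X
    proof -
      have "det (twisted_mat \<Gamma> d \<sigma> N X) = det (twisted_mat \<Gamma> d (\<lambda>g. R * \<sigma> g * Q) N X)"
        using det_twisted_similar[OF Q(1-3), of \<Gamma> \<sigma>] sc by simp
      also have "\<dots> = det (twisted_mat \<Gamma> l A N X) * det (twisted_mat \<Gamma> (d - l) D N X)"
        using l ADc by (intro det_twisted_four_block[where B = B] blk) auto
      finally show ?thesis by (simp add: m1(2) m2(2) power_add prod.distrib)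
    qed
    ultimately show ?thesis by (intro exI[of _ "\<lambda>i. m1 i + m2 i"]) blast
  qed
qed

text \<open>Row \<open>h\<close> has its 1 in column \<open>h g\<close>. This orientation is
  multiplicative without inverses and matches the arcs of the derived graph.\<close>

definition regular_rep :: "('g, 'b) monoid_scheme \<Rightarrow> 'g list \<Rightarrow> 'g \<Rightarrow> complex mat" where
  "regular_rep \<Gamma> gs g = mat (length gs) (length gs) (\<lambda>(i, j). if gs ! j = gs ! i \<otimes>\<^bsub>\<Gamma>\<^esub> g then 1 else 0)"

lemma matrix_rep_regular:
  assumes "group \<Gamma>" "distinct gs" "set gs = carrier \<Gamma>"
  shows "matrix_rep \<Gamma> (length gs) (regular_rep \<Gamma> gs)"
proof (rule matrix_repI[OF assms(1)])
  interpret group \<Gamma> by fact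
  have mem: "gs ! i \<in> carrier \<Gamma>" if "i < length gs" for i using that assms(3) nth_mem by blast
  show "regular_rep \<Gamma> gs \<one>\<^bsub>\<Gamma>\<^esub> = 1\<^sub>m (length gs)"
    using mem nth_eq_iff_index_eq[OF assms(2)] by (intro eq_matI) (auto simp: regular_rep_def)
  fix g h assume g: "g \<in> carrier \<Gamma>" and h: "h \<in> carrier \<Gamma>"
  show "regular_rep \<Gamma> gs (g \<otimes>\<^bsub>\<Gamma>\<^esub> h) = regular_rep \<Gamma> gs g * regular_rep \<Gamma> gs h"
  proof (rule eq_matI)
    fix i j assume "i < dim_row (regular_rep \<Gamma> gs g * regular_rep \<Gamma> gs h)"
      "j < dim_col (regular_rep \<Gamma> gs g * regular_rep \<Gamma> gs h)"
    hence ij: "i < length gs" "j < length gs" by (auto simp: regular_rep_def)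
    have "gs ! i \<otimes>\<^bsub>\<Gamma>\<^esub> g \<in> set gs" using mem[OF ij(1)] g assms(3) by simp
    then obtain l where l: "l < length gs" "gs ! l = gs ! i \<otimes>\<^bsub>\<Gamma>\<^esub> g" by (metis in_set_conv_nth)
    have "(regular_rep \<Gamma> gs g * regular_rep \<Gamma> gs h) $$ (i, j) =
      (\<Sum>l'<length gs. regular_rep \<Gamma> gs g $$ (i, l') * regular_rep \<Gamma> gs h $$ (l', j))"
      using ij by (intro mult_mat_entry) (auto simp: regular_rep_def)
    also have "\<dots> = (\<Sum>l'<length gs. if l' = l then if gs ! j = gs ! l' \<otimes>\<^bsub>\<Gamma>\<^esub> h then 1 else 0 else 0)"
      using ij l nth_eq_iff_index_eq[OF assms(2)]
      by (intro sum.cong refl) (auto simp: regular_rep_def simp flip: l(2))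
    also have "\<dots> = (if gs ! j = gs ! i \<otimes>\<^bsub>\<Gamma>\<^esub> g \<otimes>\<^bsub>\<Gamma>\<^esub> h then 1 else 0)" using l by simp
    also have "\<dots> = regular_rep \<Gamma> gs (g \<otimes>\<^bsub>\<Gamma>\<^esub> h) $$ (i, j)"
      using ij mem[OF ij(1)] g h by (simp add: regular_rep_def m_assoc)
    finally show "regular_rep \<Gamma> gs (g \<otimes>\<^bsub>\<Gamma>\<^esub> h) $$ (i, j) = (regular_rep \<Gamma> gs g * regular_rep \<Gamma> gs h) $$ (i, j)"
      by simp
  qed (auto simp: regular_rep_def)
qed (auto simp: regular_rep_def)

lemma mtrace_regular_rep:
  assumes "group \<Gamma>" "set gs = carrier \<Gamma>" "g \<in> carrier \<Gamma>"
  shows "mtrace (regular_rep \<Gamma> gs g) = (if g = \<one>\<^bsub>\<Gamma>\<^esub> then of_nat (length gs) else 0)"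
proof -
  interpret group \<Gamma> by fact
  have mem: "gs ! i \<in> carrier \<Gamma>" if "i < length gs" for i using that assms(2) nth_mem by blast
  have "gs ! i = gs ! i \<otimes>\<^bsub>\<Gamma>\<^esub> g \<longleftrightarrow> g = \<one>\<^bsub>\<Gamma>\<^esub>" if "i < length gs" for i
    by (rule l_cancel_one'[OF mem[OF that] assms(3)])
  thus ?thesis by (simp add: mtrace_def regular_rep_def)
qed

text \<open>
  Frobenius' factorisation of the group determinant. The multiplicities of the composition factors
  are read off from the characters, so complete reducibility is not needed.
\<close>

theorem group_determinant:
  assumes "group \<Gamma>" "finite (carrier \<Gamma>)" "complete_irreps \<Gamma> k f \<rho>" "distinct gs" "set gs = carrier \<Gamma>"
  shows "det (twisted_mat \<Gamma> (length gs) (regular_rep \<Gamma> gs) N X) =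
      (\<Prod>i = 1..k. det (twisted_mat \<Gamma> (f i) (\<rho> i) N X) ^ f i)"
    and "(\<Sum>i = 1..k. f i * f i) = card (carrier \<Gamma>)"
proof -
  interpret group \<Gamma> by fact
  let ?r = "of_nat (card (carrier \<Gamma>)) :: complex"
  have len: "length gs = card (carrier \<Gamma>)" using assms(4,5) distinct_card by force
  have r: "?r \<noteq> 0" using assms(2) one_closed by (auto simp: card_eq_0_iff)
  have irr: "irreducible_rep \<Gamma> (f i) (\<rho> i)" if "i \<in> {1..k}" for i
    using assms(3) that by (simp add: complete_irreps_def)
  have tr1: "mtrace (\<rho> i \<one>\<^bsub>\<Gamma>\<^esub>) = of_nat (f i)" if "i \<in> {1..k}" for i
    using matrix_rep_one[OF assms(1) irreducible_rep_matrix_rep[OF irr[OF that]]] by (simp add: mtrace_one)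
  obtain m where m: "\<And>g. g \<in> carrier \<Gamma> \<Longrightarrow>
      mtrace (regular_rep \<Gamma> gs g) = (\<Sum>i = 1..k. of_nat (m i) * mtrace (\<rho> i g))"
    "\<And>N X. det (twisted_mat \<Gamma> (length gs) (regular_rep \<Gamma> gs) N X) =
      (\<Prod>i = 1..k. det (twisted_mat \<Gamma> (f i) (\<rho> i) N X) ^ m i)"
    using rep_composition_factors[OF assms(1,3) matrix_rep_regular[OF assms(1,4,5)]] by blast
  have mf: "m i = f i" if i: "i \<in> {1..k}" for i
  proof -
    have orth: "(\<Sum>g\<in>carrier \<Gamma>. mtrace (\<rho> j g) * mtrace (\<rho> i (inv\<^bsub>\<Gamma>\<^esub> g))) = (if j = i then ?r else 0)"
      if j: "j \<in> {1..k}" for j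
    proof (cases "j = i")
      case True thus ?thesis using character_norm[OF assms(1,2) irr[OF i]] by simp
    next
      case False
      hence "\<not> equivalent_reps \<Gamma> (f i) (\<rho> i) (f j) (\<rho> j)"
        using assms(3) i j by (auto simp: complete_irreps_def)
      thus ?thesis using character_orthogonal[OF assms(1) irr[OF i] irr[OF j]] False by simp
    qed
    \<comment> \<open>The regular character is paired with the \<open>i\<close>-th one in two ways:
      it is concentrated at the identity, which gives \<open>r * f i\<close>, and its decomposition
      gives \<open>m i * r\<close> by orthogonality.\<close>
    have "?r * of_nat (f i) = (\<Sum>g\<in>carrier \<Gamma>. if g = \<one>\<^bsub>\<Gamma>\<^esub> then ?r * mtrace (\<rho> i (inv\<^bsub>\<Gamma>\<^esub> g)) else 0)"
      using assms(2) tr1[OF i] by simp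
    also have "\<dots> = (\<Sum>g\<in>carrier \<Gamma>. mtrace (regular_rep \<Gamma> gs g) * mtrace (\<rho> i (inv\<^bsub>\<Gamma>\<^esub> g)))"
      by (intro sum.cong refl) (auto simp: mtrace_regular_rep[OF assms(1,5)] len)
    also have "\<dots> = (\<Sum>g\<in>carrier \<Gamma>. \<Sum>j = 1..k. of_nat (m j) * (mtrace (\<rho> j g) * mtrace (\<rho> i (inv\<^bsub>\<Gamma>\<^esub> g))))"
      by (intro sum.cong refl) (simp add: m(1) sum_distrib_right mult.assoc)
    also have "\<dots> = (\<Sum>j = 1..k. of_nat (m j) * (\<Sum>g\<in>carrier \<Gamma>. mtrace (\<rho> j g) * mtrace (\<rho> i (inv\<^bsub>\<Gamma>\<^esub> g))))"
      by (subst sum.swap) (simp add: sum_distrib_left)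
    also have "\<dots> = (\<Sum>j = 1..k. if j = i then of_nat (m j) * ?r else 0)"
      by (intro sum.cong refl) (simp add: orth)
    also have "\<dots> = of_nat (m i) * ?r" using i by simp
    finally have "of_nat (m i) = (of_nat (f i) :: complex)" using r by simp
    thus ?thesis by simp
  qed
  show "det (twisted_mat \<Gamma> (length gs) (regular_rep \<Gamma> gs) N X) =
      (\<Prod>i = 1..k. det (twisted_mat \<Gamma> (f i) (\<rho> i) N X) ^ f i)"
    unfolding m(2) by (intro prod.cong refl) (simp add: mf)
  \<comment> \<open>The decomposition of the regular character, evaluated at the identity, is the
    sum of squares.\<close>
  have "(of_nat (card (carrier \<Gamma>)) :: complex) = (\<Sum>i = 1..k. of_nat (m i) * mtrace (\<rho> i \<one>\<^bsub>\<Gamma>\<^esub>))"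
    using m(1)[of "\<one>\<^bsub>\<Gamma>\<^esub>"] mtrace_regular_rep[OF assms(1,5), of "\<one>\<^bsub>\<Gamma>\<^esub>"] len by simp
  also have "\<dots> = of_nat (\<Sum>i = 1..k. f i * f i)"
    unfolding of_nat_sum by (intro sum.cong refl) (simp add: mf tr1)
  finally show "(\<Sum>i = 1..k. f i * f i) = card (carrier \<Gamma>)" by (metis of_nat_eq_iff)
qed

section \<open>Expansion of the weighted characteristic polynomial\<close>

definition weighted_charpoly :: "'v pair_pre_digraph \<Rightarrow> ('v \<times> 'v \<Rightarrow> complex) \<Rightarrow> ('v \<Rightarrow> complex) \<Rightarrow> complex \<Rightarrow> complex" where
  "weighted_charpoly G w c x = pdet (pverts G) (\<lambda>u v. lap G w u v + (if u = v then x * c u else 0))"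

text \<open>The coefficient of \<open>x ^ 2\<close> in
  \<open>weighted_charpoly G w c x\<close>.\<close>

definition pair_minor_sum :: "'v pair_pre_digraph \<Rightarrow> ('v \<times> 'v \<Rightarrow> complex) \<Rightarrow> ('v \<Rightarrow> complex) \<Rightarrow> complex" where
  "pair_minor_sum G w c = (\<Sum>T | T \<subseteq> pverts G \<and> card T = 2. prod c T * pdet (pverts G - T) (lap G w))"

context pair_graph
begin

lemma pdet_lap_eq_0:
  assumes "pverts G \<noteq> {}"
  shows "pdet (pverts G) (lap G w) = 0"
proof -
  obtain s where "s \<in> pverts G" using assms by blast
  thus ?thesis
  proof (rule pdet_eq_0_if_kernel[OF pair_finite_verts, where x = "\<lambda>_. 1"])
    fix u assume u: "u \<in> pverts G"
    show "(\<Sum>v\<in>pverts G. lap G w u v * 1) = 0"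
      using u pair_finite_verts by (simp add: lap_def sum_subtractf wdegree_eq_sum)
  qed simp
qed

text \<open>The full Laplacian is singular, so the constant term is zero and a factor
  \<open>x\<close> splits off. Value and derivative of the quotient \<open>q\<close> at 0 are then
  the two coefficients of interest, and products can be compared with the calculus rules
  alone.\<close>

lemma weighted_charpoly_expansion:
  assumes "pverts G \<noteq> {}" "symmetric_weight G w"
  obtains q where "\<And>x. weighted_charpoly G w c x = x * q x"
    "q 0 = kappa G w * (\<Sum>v\<in>pverts G. c v)"
    "(q has_field_derivative pair_minor_sum G w c) (at 0)"
proof -
  let ?V = "pverts G" and ?K = "\<lambda>T. prod c T * pdet (pverts G - T) (lap G w)"
  define q where "q x = (\<Sum>T\<in>Pow ?V - {{}}. x ^ (card T - 1) * ?K T)" for x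
  have fin: "finite (Pow ?V)" using pair_finite_verts by simp
  have cpos: "card T > 0" if "T \<in> Pow ?V - {{}}" for T
    using that pair_finite_verts by (auto simp: card_gt_0_iff intro: finite_subset)
  have 1: "weighted_charpoly G w c x = x * q x" for x
  proof -
    have "weighted_charpoly G w c x = (\<Sum>T\<in>Pow ?V. (\<Prod>v\<in>T. x * c v) * pdet (?V - T) (lap G w))"
      unfolding weighted_charpoly_def by (rule pdet_add_diag[OF pair_finite_verts])
    also have "\<dots> = pdet ?V (lap G w) + (\<Sum>T\<in>Pow ?V - {{}}. (\<Prod>v\<in>T. x * c v) * pdet (?V - T) (lap G w))"
      using fin by (subst sum.remove[of _ "{}"]) auto
    also have "\<dots> = (\<Sum>T\<in>Pow ?V - {{}}. x * (x ^ (card T - 1) * ?K T))"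
      unfolding pdet_lap_eq_0[OF assms(1)] add_0
    proof (rule sum.cong[OF refl])
      fix T assume "T \<in> Pow ?V - {{}}"
      hence "x ^ card T = x * x ^ (card T - 1)" using cpos[of T] by (metis power_eq_if neq0_conv)
      thus "(\<Prod>v\<in>T. x * c v) * pdet (?V - T) (lap G w) = x * (x ^ (card T - 1) * ?K T)"
        by (simp add: prod.distrib mult_ac)
    qed
    finally show ?thesis by (simp add: q_def sum_distrib_left)
  qed
  \<comment> \<open>Since \<open>0 ^ 0 = 1\<close>, exactly the singletons survive at 0.\<close>
  have "q 0 = (\<Sum>T\<in>(\<lambda>v. {v}) ` ?V. ?K T)"
    unfolding q_def
  proof (rule sum.mono_neutral_cong_right)
    show "\<forall>T\<in>Pow ?V - {{}} - (\<lambda>v. {v}) ` ?V. 0 ^ (card T - 1) * ?K T = 0"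
    proof
      fix T assume T: "T \<in> Pow ?V - {{}} - (\<lambda>v. {v}) ` ?V"
      have "card T \<noteq> 1" using T by (auto simp: card_1_singleton_iff)
      hence "card T - 1 \<noteq> 0" using cpos[of T] T by simp
      thus "0 ^ (card T - 1) * ?K T = 0" by simp
    qed
  qed (use fin in auto)
  also have "\<dots> = (\<Sum>v\<in>?V. c v * pdet (?V - {v}) (lap G w))"
    by (subst sum.reindex) auto
  also have "\<dots> = (\<Sum>v\<in>?V. c v * kappa G w)"
  proof (rule sum.cong[OF refl])
    fix v assume v: "v \<in> ?V"
    interpret rooted_graph G v using v by unfold_locales
    show "c v * pdet (?V - {v}) (lap G w) = c v * kappa G w" using matrix_tree[OF assms(2)] by simp
  qed
  finally have 2: "q 0 = kappa G w * (\<Sum>v\<in>?V. c v)" by (simp add: sum_distrib_left mult.commute)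
  \<comment> \<open>For singletons the truncated exponent gives \<open>0 ^ 0 = 1\<close>, but the
    factor \<open>of_nat (card T - 1)\<close> is 0; for three or more elements the power is 0. Only
    the pairs remain.\<close>
  have "(q has_field_derivative (\<Sum>T\<in>Pow ?V - {{}}. of_nat (card T - 1) * 0 ^ (card T - 1 - 1) * ?K T)) (at 0)"
    unfolding q_def by (auto intro!: derivative_eq_intros sum.cong)
  also have "(\<Sum>T\<in>Pow ?V - {{}}. of_nat (card T - 1) * 0 ^ (card T - 1 - 1) * ?K T) = pair_minor_sum G w c"
    unfolding pair_minor_sum_def
  proof (rule sum.mono_neutral_cong_right)
    show "\<forall>T\<in>Pow ?V - {{}} - {T. T \<subseteq> ?V \<and> card T = 2}. of_nat (card T - 1) * 0 ^ (card T - 1 - 1) * ?K T = 0"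
    proof
      fix T assume T: "T \<in> Pow ?V - {{}} - {T. T \<subseteq> ?V \<and> card T = 2}"
      hence "card T - 1 = 0 \<or> card T - 1 - 1 \<noteq> 0" using cpos[of T] by auto
      thus "of_nat (card T - 1) * 0 ^ (card T - 1 - 1) * ?K T = 0" by auto
    qed
  qed (use fin in auto)
  finally show ?thesis using that[OF 1 2] by blast
qed

lemma laplacian_index:
  assumes "distinct vs" "i < length vs" "j < length vs"
  shows "laplacian G w vs $$ (i, j) = lap G w (vs ! i) (vs ! j)"
  using assms by (simp add: laplacian_def degree_mat_def weight_mat_def lap_def nth_eq_iff_index_eq)

text \<open>Index pairs \<open>p < q\<close> enumerate the two-element vertex sets once each, and
  the denominator of \<open>resistance\<close> cancels.\<close>

lemma pair_minor_sum_eq_Kfz: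
  assumes "distinct vs" "set vs = pverts G" "kappa G w \<noteq> 0"
  shows "pair_minor_sum G w (\<lambda>v. wdegree G w v * t - 2) = kappa G w * Kfz G w vs t"
proof -
  let ?N = "length vs" and ?c = "\<lambda>v. wdegree G w v * t - 2" and ?V = "pverts G"
  have bij: "bij_betw ((!) vs) {0..<?N} ?V"
    using bij_betw_nth[OF assms(1), of "{0..<?N}" ?V] assms(2) by (simp add: atLeast0LessThan)
  have minor: "det (submatrix (laplacian G w vs) (- {p, q}) (- {p, q})) = pdet (?V - {vs ! p, vs ! q}) (lap G w)"
    if pq: "p < ?N" "q < ?N" for p q
  proof -
    let ?S = "{0..<?N} \<inter> - {p, q}"
    have inj: "inj_on ((!) vs) {0..<?N}" using bij by (simp add: bij_betw_def)
    have "(!) vs ` ({0..<?N} - {p, q}) = (!) vs ` {0..<?N} - (!) vs ` {p, q}"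
      using pq by (intro inj_on_image_set_diff[OF inj]) auto
    also have "\<dots> = ?V - {vs ! p, vs ! q}" using bij by (simp add: bij_betw_def)
    finally have im: "(!) vs ` ?S = ?V - {vs ! p, vs ! q}" by (simp add: Diff_eq)
    have b: "bij_betw ((!) vs) ?S (?V - {vs ! p, vs ! q})"
      using im inj by (auto simp: bij_betw_def intro: inj_on_subset)
    have "laplacian G w vs \<in> carrier_mat ?N ?N"
      by (auto simp: laplacian_def degree_mat_def weight_mat_def)
    hence "det (submatrix (laplacian G w vs) (- {p, q}) (- {p, q})) = pdet ?S (\<lambda>i j. laplacian G w vs $$ (i, j))"
      by (rule det_submatrix_eq_pdet)
    also have "\<dots> = pdet ?S (\<lambda>i j. lap G w (vs ! i) (vs ! j))"
      by (rule pdet_cong) (simp add: laplacian_index[OF assms(1)])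
    also have "\<dots> = pdet (?V - {vs ! p, vs ! q}) (lap G w)"
      by (rule pdet_reindex[OF b, symmetric]) simp
    finally show ?thesis .
  qed
  let ?P = "SIGMA q:{..<?N}. {..<q}"
  have inj: "inj_on (\<lambda>(q, p). {vs ! p, vs ! q}) ?P"
    by (rule inj_onI) (auto simp: doubleton_eq_iff nth_eq_iff_index_eq[OF assms(1)])
  have im: "(\<lambda>(q, p). {vs ! p, vs ! q}) ` ?P = {T. T \<subseteq> ?V \<and> card T = 2}"
  proof (intro equalityI subsetI)
    fix T assume "T \<in> (\<lambda>(q, p). {vs ! p, vs ! q}) ` ?P"
    then obtain p q where pq: "p < q" "q < ?N" "T = {vs ! p, vs ! q}" by auto
    hence "vs ! p \<noteq> vs ! q" by (simp add: nth_eq_iff_index_eq[OF assms(1)])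
    moreover have "vs ! p \<in> ?V" "vs ! q \<in> ?V"
      using pq nth_mem[of p vs] nth_mem[of q vs] unfolding assms(2) by auto
    ultimately show "T \<in> {T. T \<subseteq> ?V \<and> card T = 2}" using pq(3) by simp
  next
    fix T assume "T \<in> {T. T \<subseteq> ?V \<and> card T = 2}"
    then obtain x y where xy: "T = {x, y}" "x \<noteq> y" "x \<in> set vs" "y \<in> set vs"
      unfolding assms(2) by (auto simp: card_2_iff)
    then obtain i j where ij: "i < ?N" "j < ?N" "x = vs ! i" "y = vs ! j" by (metis in_set_conv_nth)
    have "i \<noteq> j" using xy ij by auto
    hence "i < j \<or> j < i" by auto
    thus "T \<in> (\<lambda>(q, p). {vs ! p, vs ! q}) ` ?P"
    proof
      assume "i < j" thus ?thesis using ij xy by (intro rev_image_eqI[of "(j, i)"]) auto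
    next
      assume "j < i" thus ?thesis using ij xy by (intro rev_image_eqI[of "(i, j)"]) auto
    qed
  qed
  have "pair_minor_sum G w ?c = (\<Sum>(q, p)\<in>?P. prod ?c {vs ! p, vs ! q} * pdet (?V - {vs ! p, vs ! q}) (lap G w))"
    unfolding pair_minor_sum_def im[symmetric] by (subst sum.reindex[OF inj]) (simp add: o_def split_def)
  also have "\<dots> = (\<Sum>(q, p)\<in>?P. kappa G w * (?c (vs ! p) * ?c (vs ! q) * resistance G w vs p q))"
  proof (rule sum.cong[OF refl])
    fix z assume "z \<in> ?P"
    then obtain p q where z: "z = (q, p)" and pq: "p < q" "q < ?N" by auto
    have "vs ! p \<noteq> vs ! q" using pq by (simp add: nth_eq_iff_index_eq[OF assms(1)])
    thus "(case z of (q, p) \<Rightarrow> prod ?c {vs ! p, vs ! q} * pdet (?V - {vs ! p, vs ! q}) (lap G w)) =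
      (case z of (q, p) \<Rightarrow> kappa G w * (?c (vs ! p) * ?c (vs ! q) * resistance G w vs p q))"
      using assms(3) minor[of p q] pq by (simp add: z resistance_def)
  qed
  also have "\<dots> = kappa G w * Kfz G w vs t"
    unfolding Kfz_def sum_distrib_left by (rule sum.Sigma[symmetric]) auto
  finally show ?thesis .
qed

text \<open>The handshake lemma: the two arcs of an edge carry the same weight.\<close>

lemma sum_wdegree:
  assumes "symmetric_weight G w"
  shows "(\<Sum>v\<in>pverts G. wdegree G w v) = 2 * total_weight G w"
proof -
  let ?h = "\<lambda>(u, v). {u, v}"
  have "(\<Sum>v\<in>pverts G. wdegree G w v) = (\<Sum>e\<in>parcs G. w e)"
    unfolding wdegree_def using pair_finite_verts pair_finite_arcs arc_fst_in_verts
    by (intro sum.group) blast+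
  also have "\<dots> = (\<Sum>y\<in>uedges G. \<Sum>e\<in>{e \<in> parcs G. ?h e = y}. w e)"
    unfolding uedges_def by (rule sum.image_gen[OF pair_finite_arcs])
  also have "\<dots> = (\<Sum>y\<in>uedges G. 2 * uweight w y)"
  proof (rule sum.cong[OF refl])
    fix y assume "y \<in> uedges G"
    then obtain u v where uv: "(u, v) \<in> parcs G" "y = {u, v}" by (auto simp: uedges_def)
    have "u \<noteq> v" using pair_no_loops[OF uv(1)] by simp
    have "{e \<in> parcs G. ?h e = y} = {(u, v), (v, u)}"
      using uv symmetric_arcs by (auto simp: doubleton_eq_iff)
    moreover have "w (v, u) = w (u, v)" using assms uv(1) by (auto simp: symmetric_weight_def)
    ultimately show "(\<Sum>e\<in>{e \<in> parcs G. ?h e = y}. w e) = 2 * uweight w y"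
      using \<open>u \<noteq> v\<close> uweight_arc[OF assms uv(1)] uv(2) by simp
  qed
  finally show ?thesis by (simp add: total_weight_def sum_distrib_left)
qed

end

section \<open>Derived graphs and twisted Laplacians\<close>

locale voltage_graph = pair_graph G + group \<Gamma>
  for G :: "'v pair_pre_digraph" and \<Gamma> :: "('g, 'b) monoid_scheme" +
  fixes \<alpha> :: "'v \<times> 'v \<Rightarrow> 'g" and w :: "'v \<times> 'v \<Rightarrow> complex"
  assumes finite_group: "finite (carrier \<Gamma>)"
    and voltage: "ordinary_voltage G \<Gamma> \<alpha>"
    and weight: "symmetric_weight G w"
begin

abbreviation "dG \<equiv> derived_graph G \<Gamma> \<alpha>"
abbreviation "dw \<equiv> derived_weight G \<Gamma> \<alpha> w"

lemma voltage_closed: "(u, v) \<in> parcs G \<Longrightarrow> \<alpha> (u, v) \<in> carrier \<Gamma>"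
  using voltage by (auto simp: ordinary_voltage_def)

lemma voltage_inv: "(u, v) \<in> parcs G \<Longrightarrow> \<alpha> (v, u) = inv\<^bsub>\<Gamma>\<^esub> (\<alpha> (u, v))"
  using voltage by (auto simp: ordinary_voltage_def)

lemma pverts_derived [simp]: "pverts dG = pverts G \<times> carrier \<Gamma>"
  by (simp add: derived_graph_def)

lemma derived_arc_iff:
  "((u, h), (v, k)) \<in> parcs dG \<longleftrightarrow> (u, v) \<in> parcs G \<and> h \<in> carrier \<Gamma> \<and> k = h \<otimes>\<^bsub>\<Gamma>\<^esub> \<alpha> (u, v)"
  by (auto simp: derived_graph_def)

lemma derived_weight_arc:
  "((u, h), (v, k)) \<in> parcs dG \<Longrightarrow> dw ((u, h), (v, k)) = w (u, v)"
  by (simp add: derived_weight_def derived_arc_iff)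

lemma derived_arc_sym: "((u, h), (v, k)) \<in> parcs dG \<Longrightarrow> ((v, k), (u, h)) \<in> parcs dG"
proof -
  assume "((u, h), (v, k)) \<in> parcs dG"
  hence a: "(u, v) \<in> parcs G" "h \<in> carrier \<Gamma>" "k = h \<otimes>\<^bsub>\<Gamma>\<^esub> \<alpha> (u, v)"
    by (auto simp: derived_arc_iff)
  have "k \<otimes>\<^bsub>\<Gamma>\<^esub> \<alpha> (v, u) = h"
    unfolding a(3) voltage_inv[OF a(1)] using a(2) voltage_closed[OF a(1)] by (simp add: m_assoc)
  thus ?thesis using a symmetric_arcs[OF a(1)] voltage_closed[OF a(1)] by (simp add: derived_arc_iff)
qed

lemma pair_graph_derived: "pair_graph dG"
proof
  have arcs: "parcs dG \<subseteq> (pverts G \<times> carrier \<Gamma>) \<times> (pverts G \<times> carrier \<Gamma>)"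
    using wellformed' voltage_closed by (auto simp: derived_arc_iff)
  show "finite (pverts dG)" using finite_group pair_finite_verts by simp
  show "finite (parcs dG)"
    by (rule finite_subset[OF arcs]) (use finite_group pair_finite_verts in simp)
  show "fst e \<in> pverts dG" "snd e \<in> pverts dG" if "e \<in> parcs dG" for e
    using arcs that by auto
  show "fst e \<noteq> snd e" if "e \<in> parcs dG" for e
    using that pair_no_loops by (cases e) (fastforce simp: derived_arc_iff)
  show "symmetric (with_proj dG)"
    using derived_arc_sym by (auto simp: symmetric_def sym_def)
qed

lemma symmetric_weight_derived: "symmetric_weight dG dw"
  unfolding symmetric_weight_def
proof (clarify)
  fix u h v k assume a: "((u, h), (v, k)) \<in> parcs dG"
  show "dw ((v, k), (u, h)) = dw ((u, h), (v, k))"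
    using derived_weight_arc[OF a] derived_weight_arc[OF derived_arc_sym[OF a]] a weight
    by (auto simp: derived_arc_iff symmetric_weight_def)
qed

text \<open>Every arc leaving \<open>u\<close> has exactly one lift leaving
  \<open>(u, h)\<close>.\<close>

lemma wdegree_derived:
  assumes "h \<in> carrier \<Gamma>"
  shows "wdegree dG dw (u, h) = wdegree G w u"
proof -
  have "{e \<in> parcs dG. fst e = (u, h)} =
      (\<lambda>e. ((u, h), (snd e, h \<otimes>\<^bsub>\<Gamma>\<^esub> \<alpha> (u, snd e)))) ` {e \<in> parcs G. fst e = u}"
    using assms by (force simp: derived_arc_iff image_iff)
  hence "wdegree dG dw (u, h) =
      (\<Sum>e\<in>{e \<in> parcs G. fst e = u}. dw ((u, h), (snd e, h \<otimes>\<^bsub>\<Gamma>\<^esub> \<alpha> (u, snd e))))"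
    unfolding wdegree_def by (subst sum.reindex_cong[OF _ _ refl]) (auto simp: inj_on_def)
  also have "\<dots> = wdegree G w u"
    unfolding wdegree_def by (intro sum.cong) (auto simp: derived_weight_def)
  finally show ?thesis .
qed

lemma lap_derived:
  assumes "h \<in> carrier \<Gamma>"
  shows "lap dG dw (u, h) (v, k) = (if u = v \<and> h = k then wdegree G w u else 0) -
    (if (u, v) \<in> parcs G \<and> k = h \<otimes>\<^bsub>\<Gamma>\<^esub> \<alpha> (u, v) then w (u, v) else 0)"
proof -
  have "(if ((u, h), (v, k)) \<in> parcs dG then dw ((u, h), (v, k)) else 0) =
      (if (u, v) \<in> parcs G \<and> k = h \<otimes>\<^bsub>\<Gamma>\<^esub> \<alpha> (u, v) then w (u, v) else 0)"
    using assms by (simp add: derived_arc_iff derived_weight_def)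
  thus ?thesis by (simp only: lap_def prod.inject wdegree_derived[OF assms])
qed

end

text \<open>Dimensions and entries go through one induction, because reading an entry of a matrix
  sum requires the dimensions of the summands.\<close>

lemma finsum_module_mat_index:
  assumes "finite A" "\<And>a. a \<in> A \<Longrightarrow> F a \<in> carrier_mat nr nc" "i < nr" "j < nc"
  shows "finsum (module_mat TYPE(complex) nr nc) F A \<in> carrier_mat nr nc \<and>
    finsum (module_mat TYPE(complex) nr nc) F A $$ (i, j) = (\<Sum>a\<in>A. F a $$ (i, j))"
  using assms(1,2)
proof (induction A rule: finite_induct)
  interpret abelian_group "module_mat TYPE(complex) nr nc" by (rule abelian_group_mat)
  case empty
  thus ?case using assms(3,4) by (simp add: module_mat_simps)
next
  interpret abelian_group "module_mat TYPE(complex) nr nc" by (rule abelian_group_mat)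
  case (insert a A)
  have "finsum (module_mat TYPE(complex) nr nc) F (insert a A) = F a + finsum (module_mat TYPE(complex) nr nc) F A"
    using insert by (subst finsum_insert) (auto simp: module_mat_simps)
  thus ?case using insert assms(3,4) by auto
qed

section \<open>Entries of the twisted Laplacians and the matrix defining \<open>K i\<close>\<close>

context voltage_graph
begin

text \<open>An entry of the sum of the Kronecker products of \<open>\<rho> g\<close> with the
  voltage weight matrix of \<open>g\<close>.\<close>

definition adj :: "'v list \<Rightarrow> ('g \<Rightarrow> complex mat) \<Rightarrow> nat \<Rightarrow> nat \<Rightarrow> complex" where
  "adj vs \<rho> i j = (\<Sum>g\<in>carrier \<Gamma>. \<rho> g $$ (i div length vs, j div length vs) *
     voltage_weight_mat G \<alpha> w vs g $$ (i mod length vs, j mod length vs))"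

text \<open>The family \<open>X g\<close> whose twisted matrix is the twisted Laplacian plus
  \<open>c\<close>. The diagonal part sits at the identity, where the representation is the identity
  matrix.\<close>

definition shifted_lap :: "'v list \<Rightarrow> ('v \<Rightarrow> complex) \<Rightarrow> 'g \<Rightarrow> complex mat" where
  "shifted_lap vs c g = mat (length vs) (length vs) (\<lambda>(a, b).
     (if g = \<one>\<^bsub>\<Gamma>\<^esub> \<and> a = b then wdegree G w (vs ! a) + c (vs ! a) else 0) - voltage_weight_mat G \<alpha> w vs g $$ (a, b))"

text \<open>The matrix \<open>L\<^sub>i\<close> of the overview; \<open>i mod length vs\<close>
  recovers the vertex from the Kronecker index.\<close>

definition rep_lap :: "'v list \<Rightarrow> ('g \<Rightarrow> complex mat) \<Rightarrow> nat \<Rightarrow> nat \<Rightarrow> complex" where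
  "rep_lap vs \<rho> i j = (if i = j then wdegree G w (vs ! (i mod length vs)) else 0) - adj vs \<rho> i j"

definition rep_diag :: "'v list \<Rightarrow> ('v \<Rightarrow> complex) \<Rightarrow> nat \<Rightarrow> nat \<Rightarrow> complex" where
  "rep_diag vs c i j = (if i = j then c (vs ! (i mod length vs)) else 0)"

lemma twisted_shifted_lap_index:
  assumes rep: "matrix_rep \<Gamma> d \<rho>" and ij: "i < d * length vs" "j < d * length vs"
  shows "twisted_mat \<Gamma> d \<rho> (length vs) (shifted_lap vs c) $$ (i, j) = rep_lap vs \<rho> i j + rep_diag vs c i j"
proof -
  let ?n = "length vs"
  have n: "0 < ?n" using ij by (cases "?n = 0") auto
  have im: "i mod ?n < ?n" "j mod ?n < ?n" "i div ?n < d" "j div ?n < d"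
    using ij n by (auto simp: less_mult_imp_div_less)
  let ?D = "\<lambda>g. if g = \<one>\<^bsub>\<Gamma>\<^esub> \<and> i mod ?n = j mod ?n then wdegree G w (vs ! (i mod ?n)) + c (vs ! (i mod ?n)) else 0"
  have "twisted_mat \<Gamma> d \<rho> ?n (shifted_lap vs c) $$ (i, j) =
      (\<Sum>g\<in>carrier \<Gamma>. \<rho> g $$ (i div ?n, j div ?n) * ?D g) - adj vs \<rho> i j"
    using ij im unfolding adj_def sum_subtractf[symmetric]
    by (simp add: twisted_mat_def shifted_lap_def right_diff_distrib)
  also have "(\<Sum>g\<in>carrier \<Gamma>. \<rho> g $$ (i div ?n, j div ?n) * ?D g) =
      (\<Sum>g\<in>carrier \<Gamma>. if g = \<one>\<^bsub>\<Gamma>\<^esub> then \<rho> g $$ (i div ?n, j div ?n) *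
        (if i mod ?n = j mod ?n then wdegree G w (vs ! (i mod ?n)) + c (vs ! (i mod ?n)) else 0) else 0)"
    by (intro sum.cong) auto
  also have "\<dots> = (1\<^sub>m d :: complex mat) $$ (i div ?n, j div ?n) *
        (if i mod ?n = j mod ?n then wdegree G w (vs ! (i mod ?n)) + c (vs ! (i mod ?n)) else 0)"
    using finite_group matrix_rep_one[OF group_axioms rep] by simp
  also have "\<dots> = (if i = j then wdegree G w (vs ! (i mod ?n)) + c (vs ! (i mod ?n)) else 0)"
  proof -
    have "i = j \<longleftrightarrow> i div ?n = j div ?n \<and> i mod ?n = j mod ?n" by (metis div_mult_mod_eq)
    thus ?thesis using im by auto
  qed
  finally show ?thesis by (simp add: rep_lap_def rep_diag_def)
qed

lemma det_twisted_shifted_lap: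
  assumes "matrix_rep \<Gamma> d \<rho>"
  shows "det (twisted_mat \<Gamma> d \<rho> (length vs) (shifted_lap vs c)) =
    pdet {0..<d * length vs} (\<lambda>i j. rep_lap vs \<rho> i j + rep_diag vs c i j)"
  unfolding det_eq_pdet[OF twisted_mat_carrier]
  by (rule pdet_cong) (simp add: twisted_shifted_lap_index[OF assms])

lemma Kdet_eq_pdet:
  assumes rep: "matrix_rep \<Gamma> d \<rho>"
  shows "Kdet G \<Gamma> \<alpha> w vs d \<rho> u s = pdet {0..<d * length vs} (\<lambda>i j.
    (if i = j then 1 + (1 - u) * s\<^sup>2 * (wdegree G w (vs ! (i mod length vs)) - (1 - u)) else 0) - s * adj vs \<rho> i j)"
proof -
  let ?n = "length vs"
  let ?F = "\<lambda>g. kronecker (\<rho> g) (voltage_weight_mat G \<alpha> w vs g)"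
  define S where "S = finsum (module_mat TYPE(complex) (?n * d) (?n * d)) ?F (carrier \<Gamma>)"
  define B where "B = kronecker (1\<^sub>m d) (degree_mat G w vs - (1 - u) \<cdot>\<^sub>m 1\<^sub>m ?n)"
  have rc: "\<rho> g \<in> carrier_mat d d" if "g \<in> carrier \<Gamma>" for g using rep that by (simp add: matrix_rep_def)
  have Wc: "voltage_weight_mat G \<alpha> w vs g \<in> carrier_mat ?n ?n" for g by (simp add: voltage_weight_mat_def)
  have Fc: "?F g \<in> carrier_mat (?n * d) (?n * d)" if "g \<in> carrier \<Gamma>" for g
    using rc[OF that] Wc[of g] by (auto simp: kronecker_def mult.commute)
  have S: "S \<in> carrier_mat (?n * d) (?n * d) \<and> S $$ (i, j) = adj vs \<rho> i j" if ij: "i < d * ?n" "j < d * ?n" for i j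
  proof -
    have ij': "i < ?n * d" "j < ?n * d" using ij by (simp_all add: mult.commute)
    have fi: "S \<in> carrier_mat (?n * d) (?n * d) \<and> S $$ (i, j) = (\<Sum>g\<in>carrier \<Gamma>. ?F g $$ (i, j))"
      unfolding S_def by (rule finsum_module_mat_index[OF finite_group Fc ij'])
    hence "S $$ (i, j) = (\<Sum>g\<in>carrier \<Gamma>. ?F g $$ (i, j))" ..
    also have "\<dots> = adj vs \<rho> i j"
      unfolding adj_def
    proof (rule sum.cong[OF refl])
      fix g assume "g \<in> carrier \<Gamma>"
      thus "?F g $$ (i, j) = \<rho> g $$ (i div ?n, j div ?n) * voltage_weight_mat G \<alpha> w vs g $$ (i mod ?n, j mod ?n)"
        using rc[of g] Wc[of g] ij by (auto simp: kronecker_def)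
    qed
    finally show ?thesis using fi by simp
  qed
  have Bc: "B \<in> carrier_mat (?n * d) (?n * d)"
    by (auto simp: B_def kronecker_def degree_mat_def mult.commute)
  let ?M = "1\<^sub>m (?n * d) - s \<cdot>\<^sub>m S + ((1 - u) * s\<^sup>2) \<cdot>\<^sub>m B"
  have M: "?M \<in> carrier_mat (d * ?n) (d * ?n)" using Bc by (auto simp: mult.commute)
  have "Kdet G \<Gamma> \<alpha> w vs d \<rho> u s = det ?M" by (simp add: Kdet_def S_def B_def Let_def)
  also have "\<dots> = pdet {0..<d * ?n} (\<lambda>i j. ?M $$ (i, j))" by (rule det_eq_pdet[OF M])
  also have "\<dots> = pdet {0..<d * ?n} (\<lambda>i j.
    (if i = j then 1 + (1 - u) * s\<^sup>2 * (wdegree G w (vs ! (i mod ?n)) - (1 - u)) else 0) - s * adj vs \<rho> i j)"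
  proof (rule pdet_cong)
    fix i j assume "i \<in> {0..<d * ?n}" "j \<in> {0..<d * ?n}"
    hence ij: "i < d * ?n" "j < d * ?n" by auto
    hence ij': "i < ?n * d" "j < ?n * d" by (simp_all add: mult.commute)
    have n: "0 < ?n" using ij by (cases "?n = 0") auto
    have im: "i mod ?n < ?n" "j mod ?n < ?n" "i div ?n < d" "j div ?n < d"
      using ij n by (auto simp: less_mult_imp_div_less)
    have eq: "i = j \<longleftrightarrow> i div ?n = j div ?n \<and> i mod ?n = j mod ?n" by (metis div_mult_mod_eq)
    have "B $$ (i, j) = (1\<^sub>m d :: complex mat) $$ (i div ?n, j div ?n) *
        (degree_mat G w vs - (1 - u) \<cdot>\<^sub>m 1\<^sub>m ?n) $$ (i mod ?n, j mod ?n)"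
      using ij by (simp add: B_def kronecker_def degree_mat_def)
    also have "\<dots> = (if i = j then wdegree G w (vs ! (i mod ?n)) - (1 - u) else 0)"
      using im eq by (auto simp: degree_mat_def)
    finally have B: "B $$ (i, j) = (if i = j then wdegree G w (vs ! (i mod ?n)) - (1 - u) else 0)" .
    have "?M $$ (i, j) = (if i = j then 1 else 0) - s * S $$ (i, j) + (1 - u) * s\<^sup>2 * B $$ (i, j)"
      using carrier_matD[OF S[OF ij, THEN conjunct1]] carrier_matD[OF Bc] ij' by simp
    thus "?M $$ (i, j) = (if i = j then 1 + (1 - u) * s\<^sup>2 * (wdegree G w (vs ! (i mod ?n)) - (1 - u)) else 0) - s * adj vs \<rho> i j"
      using S[OF ij] B by simp
  qed
  finally show ?thesis .
qed

text \<open>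
  At \<open>u = 1 - 1/t\<close> the matrix \<open>M\<close> defining \<open>K\<close> equals \<open>t L\<close> for the twisted Laplacian \<open>L\<close>, and its
  partial derivatives are \<open>- t C\<close> with respect to \<open>u\<close> and \<open>L + C / t\<close> with respect to \<open>t\<close>, where \<open>C\<close>
  is the diagonal matrix of the \<open>d t - 2\<close>.
\<close>

lemma dlog_Kdet:
  fixes t :: complex and vs :: "'v list"
  assumes rep: "matrix_rep \<Gamma> d \<rho>" and t: "t \<noteq> 0"
  defines "S \<equiv> {0..<d * length vs}"
  defines "C \<equiv> rep_diag vs (\<lambda>v. wdegree G w v * t - 2)"
  assumes nz: "pdet S (rep_lap vs \<rho>) \<noteq> 0"
  shows "dlog (\<lambda>u. Kdet G \<Gamma> \<alpha> w vs d \<rho> u t) (1 - 1 / t) =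
      - (pdet_deriv S (rep_lap vs \<rho>) C / pdet S (rep_lap vs \<rho>))"
    and "t\<^sup>2 * dlog (\<lambda>s. Kdet G \<Gamma> \<alpha> w vs d \<rho> (1 - 1 / t) s) t =
      of_nat (d * length vs) * t + pdet_deriv S (rep_lap vs \<rho>) C / pdet S (rep_lap vs \<rho>)"
proof -
  let ?L = "rep_lap vs \<rho>" and ?\<delta> = "pdet_deriv S (rep_lap vs \<rho>) C" and ?\<Delta> = "pdet S (rep_lap vs \<rho>)"
  let ?wd = "\<lambda>i. wdegree G w (vs ! (i mod length vs))"
  define M where "M u s i j = (if i = j then 1 + (1 - u) * s\<^sup>2 * (?wd i - (1 - u)) else 0) - s * adj vs \<rho> i j"
    for u s :: complex and i j
  have K: "Kdet G \<Gamma> \<alpha> w vs d \<rho> u s = pdet S (M u s)" for u s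
    unfolding Kdet_eq_pdet[OF rep] S_def M_def ..
  have cS: "card S = d * length vs" "finite S" by (simp_all add: S_def)
  \<comment> \<open>With \<open>1 - u = 1 / t\<close> the constant 1 cancels:
    \<open>1 + t * (d - 1 / t) = t * d\<close>.\<close>
  have M0: "M (1 - 1 / t) t = (\<lambda>i j. t * ?L i j)"
    using t by (intro ext) (simp add: M_def rep_lap_def field_simps power2_eq_square)
  have K0: "Kdet G \<Gamma> \<alpha> w vs d \<rho> (1 - 1 / t) t = t ^ card S * ?\<Delta>"
    unfolding K M0 by (rule pdet_scale)
  have tC: "t * pdet_deriv S (\<lambda>i j. t * ?L i j) C = t ^ card S * ?\<delta>"
    using pdet_deriv_scale_both[OF cS(2), of t ?L C] by (simp add: pdet_deriv_scale)
  have tL: "t * pdet_deriv S (\<lambda>i j. t * ?L i j) ?L = of_nat (card S) * (t ^ card S * ?\<Delta>)"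
    using pdet_deriv_self[OF cS(2), of "\<lambda>i j. t * ?L i j"] by (simp add: pdet_deriv_scale pdet_scale)
  \<comment> \<open>Both factors \<open>1 - u\<close> contribute:
    \<open>- t\<^sup>2 * (d - 1 / t) + t = - t * (d * t - 2)\<close>.\<close>
  have "((\<lambda>u. pdet S (M u t)) has_field_derivative pdet_deriv S (M (1 - 1 / t) t) (\<lambda>i j. (- 1) * (t * C i j))) (at (1 - 1 / t))"
  proof (rule has_field_derivative_pdet)
    fix i j
    have "((\<lambda>u. M u t i j) has_field_derivative
        (if i = j then - t\<^sup>2 * (?wd i - 1 / t) + 1 / t * t\<^sup>2 else 0)) (at (1 - 1 / t))"
      unfolding M_def by (cases "i = j") (auto intro!: derivative_eq_intros simp: field_simps)
    also have "(if i = j then - t\<^sup>2 * (?wd i - 1 / t) + 1 / t * t\<^sup>2 else 0) = (- 1) * (t * C i j)"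
      using t by (simp add: C_def rep_diag_def field_simps power2_eq_square)
    finally show "((\<lambda>u. M u t i j) has_field_derivative (- 1) * (t * C i j)) (at (1 - 1 / t))" .
  qed
  hence "deriv (\<lambda>u. Kdet G \<Gamma> \<alpha> w vs d \<rho> u t) (1 - 1 / t) = - (t ^ card S * ?\<delta>)"
    unfolding K M0 pdet_deriv_scale tC by (simp add: DERIV_imp_deriv)
  thus "dlog (\<lambda>u. Kdet G \<Gamma> \<alpha> w vs d \<rho> u t) (1 - 1 / t) = - (?\<delta> / ?\<Delta>)"
    unfolding dlog_def K0 using t by simp
  \<comment> \<open>The diagonal derivative is \<open>2 * (d - 1 / t) = d + (d * t - 2) / t\<close>.
    Writing the direction through \<open>t * L\<close> and \<open>t * C\<close> lets Euler's
    identity and homogeneity evaluate the two parts.\<close>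
  have "((\<lambda>s. pdet S (M (1 - 1 / t) s)) has_field_derivative pdet_deriv S (M (1 - 1 / t) t)
      (\<lambda>i j. 1 / t * (t * ?L i j) + 1 / t\<^sup>2 * (t * C i j))) (at t)"
  proof (rule has_field_derivative_pdet)
    fix i j
    have "((\<lambda>s. M (1 - 1 / t) s i j) has_field_derivative
        (if i = j then 2 * (?wd i - 1 / t) else 0) - adj vs \<rho> i j) (at t)"
      unfolding M_def using t by (cases "i = j") (auto intro!: derivative_eq_intros simp: field_simps)
    also have "(if i = j then 2 * (?wd i - 1 / t) else 0) - adj vs \<rho> i j =
        1 / t * (t * ?L i j) + 1 / t\<^sup>2 * (t * C i j)"
      using t by (simp add: C_def rep_diag_def rep_lap_def field_simps power2_eq_square)
    finally show "((\<lambda>s. M (1 - 1 / t) s i j) has_field_derivative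
      1 / t * (t * ?L i j) + 1 / t\<^sup>2 * (t * C i j)) (at t)" .
  qed
  hence "deriv (\<lambda>s. Kdet G \<Gamma> \<alpha> w vs d \<rho> (1 - 1 / t) s) t =
      1 / t * (of_nat (card S) * (t ^ card S * ?\<Delta>)) + 1 / t\<^sup>2 * (t ^ card S * ?\<delta>)"
    unfolding K M0 pdet_deriv_add pdet_deriv_scale tC tL
    by (rule DERIV_imp_deriv)
  thus "t\<^sup>2 * dlog (\<lambda>s. Kdet G \<Gamma> \<alpha> w vs d \<rho> (1 - 1 / t) s) t = of_nat (d * length vs) * t + ?\<delta> / ?\<Delta>"
    unfolding dlog_def K0 using t nz by (simp add: cS(1) field_simps power2_eq_square)
qed

text \<open>The trivial representation forgets the voltages: each arc has exactly one voltage, so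
  the matrices \<open>voltage_weight_mat\<close> add up to the weight matrix of
  \<open>G\<close>.\<close>

lemma weighted_charpoly_eq_trivial:
  assumes "distinct vs" "set vs = pverts G" "matrix_rep \<Gamma> 1 \<rho>" "\<forall>g\<in>carrier \<Gamma>. \<rho> g = 1\<^sub>m 1"
  shows "det (twisted_mat \<Gamma> 1 \<rho> (length vs) (shifted_lap vs (\<lambda>v. x * c v))) = weighted_charpoly G w c x"
proof -
  let ?n = "length vs"
  have "det (twisted_mat \<Gamma> 1 \<rho> ?n (shifted_lap vs (\<lambda>v. x * c v))) =
      pdet {0..<1 * ?n} (\<lambda>i j. rep_lap vs \<rho> i j + rep_diag vs (\<lambda>v. x * c v) i j)"
    by (rule det_twisted_shifted_lap[OF assms(3)])
  also have "\<dots> = pdet {0..<?n} (\<lambda>i j. lap G w (vs ! i) (vs ! j) + (if vs ! i = vs ! j then x * c (vs ! i) else 0))"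
    unfolding mult_1
  proof (rule pdet_cong)
    fix i j assume "i \<in> {0..<?n}" "j \<in> {0..<?n}"
    hence ij: "i < ?n" "j < ?n" by auto
    have "adj vs \<rho> i j = (\<Sum>g\<in>carrier \<Gamma>. if g = \<alpha> (vs ! i, vs ! j) then
        if (vs ! i, vs ! j) \<in> parcs G then w (vs ! i, vs ! j) else 0 else 0)"
      unfolding adj_def using ij assms(4) by (intro sum.cong refl) (auto simp: voltage_weight_mat_def)
    also have "\<dots> = (if (vs ! i, vs ! j) \<in> parcs G then w (vs ! i, vs ! j) else 0)"
      using finite_group voltage_closed by simp
    finally show "rep_lap vs \<rho> i j + rep_diag vs (\<lambda>v. x * c v) i j =
        lap G w (vs ! i) (vs ! j) + (if vs ! i = vs ! j then x * c (vs ! i) else 0)"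
      using ij nth_eq_iff_index_eq[OF assms(1)] by (simp add: rep_lap_def rep_diag_def lap_def)
  qed
  also have "\<dots> = weighted_charpoly G w c x"
    unfolding weighted_charpoly_def
    using bij_betw_nth[OF assms(1), of "{0..<?n}" "pverts G"] assms(2)
    by (intro pdet_reindex[symmetric]) (auto simp: atLeast0LessThan)
  finally show ?thesis .
qed

text \<open>The Kronecker index \<open>i\<close> stands for the vertex \<open>vs ! (i mod n)\<close>
  in the layer \<open>gs ! (i div n)\<close>. The voltage of an arc picks the one matrix of the
  regular representation that moves between the layers as the lifted arc does.\<close>

lemma weighted_charpoly_derived:
  assumes "distinct vs" "set vs = pverts G" "distinct gs" "set gs = carrier \<Gamma>"
  shows "det (twisted_mat \<Gamma> (length gs) (regular_rep \<Gamma> gs) (length vs) (shifted_lap vs (\<lambda>v. x * c v))) =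
    weighted_charpoly dG dw (\<lambda>(v, g). c v) x"
proof -
  let ?n = "length vs" and ?r = "length gs"
  let ?h = "\<lambda>i. (vs ! (i mod ?n), gs ! (i div ?n))"
  let ?S = "{0..<?r * ?n}"
  have "det (twisted_mat \<Gamma> ?r (regular_rep \<Gamma> gs) ?n (shifted_lap vs (\<lambda>v. x * c v))) =
      pdet ?S (\<lambda>i j. rep_lap vs (regular_rep \<Gamma> gs) i j + rep_diag vs (\<lambda>v. x * c v) i j)"
    by (rule det_twisted_shifted_lap[OF matrix_rep_regular[OF group_axioms assms(3,4)]])
  also have "\<dots> = pdet ?S (\<lambda>i j. lap dG dw (?h i) (?h j) +
      (if ?h i = ?h j then x * (case ?h i of (v, g) \<Rightarrow> c v) else 0))"
  proof (rule pdet_cong)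
    fix i j assume "i \<in> ?S" "j \<in> ?S"
    hence ij: "i < ?r * ?n" "j < ?r * ?n" by auto
    have n: "0 < ?n" using ij by (cases "?n = 0") auto
    have im: "i mod ?n < ?n" "j mod ?n < ?n" "i div ?n < ?r" "j div ?n < ?r"
      using ij n by (auto simp: less_mult_imp_div_less)
    let ?u = "vs ! (i mod ?n)" and ?v = "vs ! (j mod ?n)" and ?g = "gs ! (i div ?n)" and ?k = "gs ! (j div ?n)"
    have g: "?g \<in> carrier \<Gamma>" using im(3) assms(4) nth_mem by blast
    have eq: "i = j \<longleftrightarrow> ?u = ?v \<and> ?g = ?k"
    proof -
      have "i = j \<longleftrightarrow> i div ?n = j div ?n \<and> i mod ?n = j mod ?n" by (metis div_mult_mod_eq)
      thus ?thesis using im nth_eq_iff_index_eq[OF assms(1)] nth_eq_iff_index_eq[OF assms(3)] by auto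
    qed
    have "adj vs (regular_rep \<Gamma> gs) i j = (\<Sum>g\<in>carrier \<Gamma>. if g = \<alpha> (?u, ?v) then
        if (?u, ?v) \<in> parcs G \<and> ?k = ?g \<otimes>\<^bsub>\<Gamma>\<^esub> \<alpha> (?u, ?v) then w (?u, ?v) else 0 else 0)"
      unfolding adj_def using im
      by (intro sum.cong refl) (auto simp: voltage_weight_mat_def regular_rep_def)
    also have "\<dots> = (if (?u, ?v) \<in> parcs G \<and> ?k = ?g \<otimes>\<^bsub>\<Gamma>\<^esub> \<alpha> (?u, ?v) then w (?u, ?v) else 0)"
      using finite_group voltage_closed by simp
    finally have "rep_lap vs (regular_rep \<Gamma> gs) i j = lap dG dw (?h i) (?h j)"
      unfolding rep_lap_def lap_derived[OF g] eq by simp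
    moreover have "rep_diag vs (\<lambda>v. x * c v) i j = (if ?h i = ?h j then x * (case ?h i of (v, g) \<Rightarrow> c v) else 0)"
      unfolding rep_diag_def eq by simp
    ultimately show "rep_lap vs (regular_rep \<Gamma> gs) i j + rep_diag vs (\<lambda>v. x * c v) i j =
      lap dG dw (?h i) (?h j) + (if ?h i = ?h j then x * (case ?h i of (v, g) \<Rightarrow> c v) else 0)" by simp
  qed
  also have "\<dots> = weighted_charpoly dG dw (\<lambda>(v, g). c v) x"
    unfolding weighted_charpoly_def
  proof (rule pdet_reindex[symmetric])
    show "bij_betw ?h ?S (pverts dG)"
    proof -
      have inj: "inj_on ?h ?S"
      proof (rule inj_onI)
        fix i j assume "i \<in> ?S" "j \<in> ?S" and h: "?h i = ?h j"
        hence ij: "i < ?r * ?n" "j < ?r * ?n" by auto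
        have n: "0 < ?n" using ij by (cases "?n = 0") auto
        have "i mod ?n < ?n" "j mod ?n < ?n" "i div ?n < ?r" "j div ?n < ?r"
          using ij n by (auto simp: less_mult_imp_div_less)
        hence "i div ?n = j div ?n" "i mod ?n = j mod ?n"
          using h nth_eq_iff_index_eq[OF assms(1)] nth_eq_iff_index_eq[OF assms(3)] by auto
        thus "i = j" by (metis div_mult_mod_eq)
      qed
      have "?h ` ?S = pverts dG"
      proof (intro equalityI subsetI)
        fix y assume "y \<in> ?h ` ?S"
        then obtain i where i: "i < ?r * ?n" "y = ?h i" by auto
        have n: "0 < ?n" using i by (cases "?n = 0") auto
        have "i mod ?n < ?n" "i div ?n < ?r" using i n by (auto simp: less_mult_imp_div_less)
        thus "y \<in> pverts dG" using i(2) assms(2,4) nth_mem by auto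
      next
        fix y assume "y \<in> pverts dG"
        then obtain a b where ab: "a < ?n" "b < ?r" "y = (vs ! a, gs ! b)"
          unfolding pverts_derived assms(2)[symmetric] assms(4)[symmetric] by (auto simp: in_set_conv_nth)
        have "b * ?n + a < ?r * ?n" using ab by (intro mult_add_less)
        moreover have "vs \<noteq> []" using ab by auto
        hence "?h (b * ?n + a) = y" using ab by simp
        ultimately show "y \<in> ?h ` ?S" by (intro rev_image_eqI[of "b * ?n + a"]) auto
      qed
      thus ?thesis using inj by (simp add: bij_betw_def)
    qed
  qed simp
  finally show ?thesis .
qed

end

section \<open>Comparison of the graph with its covering\<close>

lemma has_field_derivative_prod_power:
  fixes F :: "'i \<Rightarrow> complex \<Rightarrow> complex"
  assumes "finite I" "\<And>i. i \<in> I \<Longrightarrow> (F i has_field_derivative F' i) (at z)" "\<And>i. i \<in> I \<Longrightarrow> F i z \<noteq> 0"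
  shows "((\<lambda>x. \<Prod>i\<in>I. F i x ^ e i) has_field_derivative
    (\<Prod>i\<in>I. F i z ^ e i) * (\<Sum>i\<in>I. of_nat (e i) * (F' i / F i z))) (at z)"
proof -
  have "((\<lambda>x. \<Prod>i\<in>I. F i x ^ e i) has_field_derivative
      (\<Sum>i\<in>I. (of_nat (e i) * (F' i * F i z ^ (e i - Suc 0))) * (\<Prod>j\<in>I - {i}. F j z ^ e j))) (at z)"
    using assms(2) by (intro has_field_derivative_prod DERIV_power)
  also have "(\<Sum>i\<in>I. (of_nat (e i) * (F' i * F i z ^ (e i - Suc 0))) * (\<Prod>j\<in>I - {i}. F j z ^ e j)) =
      (\<Prod>i\<in>I. F i z ^ e i) * (\<Sum>i\<in>I. of_nat (e i) * (F' i / F i z))"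
    unfolding sum_distrib_left
  proof (rule sum.cong[OF refl])
    fix i assume i: "i \<in> I"
    have "of_nat (e i) * F i z ^ (e i - Suc 0) = of_nat (e i) * (F i z ^ e i / F i z)"
      using assms(3)[OF i] by (cases "e i") auto
    moreover have "(\<Prod>i\<in>I. F i z ^ e i) = F i z ^ e i * (\<Prod>j\<in>I - {i}. F j z ^ e j)"
      using assms(1) i by (rule prod.remove)
    ultimately show "(of_nat (e i) * (F' i * F i z ^ (e i - Suc 0))) * (\<Prod>j\<in>I - {i}. F j z ^ e j) =
      (\<Prod>i\<in>I. F i z ^ e i) * (of_nat (e i) * (F' i / F i z))"
      by (simp add: field_simps)
  qed
  finally show ?thesis .
qed

context voltage_graph
begin

lemma weighted_charpoly_factorization:
  assumes "distinct vs" "set vs = pverts G" "complete_irreps \<Gamma> k f \<rho>" "f 1 = 1"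
    "\<forall>g\<in>carrier \<Gamma>. \<rho> 1 g = 1\<^sub>m 1"
  shows "weighted_charpoly dG dw (\<lambda>(v, g). c v) x = weighted_charpoly G w c x *
    (\<Prod>i = 2..k. pdet {0..<f i * length vs}
       (\<lambda>a b. rep_lap vs (\<rho> i) a b + rep_diag vs (\<lambda>v. x * c v) a b) ^ f i)"
proof -
  obtain gs where gs: "distinct gs" "set gs = carrier \<Gamma>" using finite_group finite_distinct_list by blast
  have rep: "matrix_rep \<Gamma> (f i) (\<rho> i)" if "i \<in> {1..k}" for i
    using assms(3) that unfolding complete_irreps_def by (blast intro: irreducible_rep_matrix_rep)
  note gd = group_determinant[OF group_axioms finite_group assms(3) gs]
  \<comment> \<open>The sum of the squares of the degrees is the positive group order, so there is
    at least one representation and the factor \<open>i = 1\<close> can be split off.\<close>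
  have "card (carrier \<Gamma>) \<noteq> 0" using finite_group one_closed by auto
  hence "k \<noteq> 0" using gd(2) by (intro notI) simp
  hence k: "1 \<le> k" by simp
  have "weighted_charpoly dG dw (\<lambda>(v, g). c v) x =
      (\<Prod>i = 1..k. det (twisted_mat \<Gamma> (f i) (\<rho> i) (length vs) (shifted_lap vs (\<lambda>v. x * c v))) ^ f i)"
    using weighted_charpoly_derived[OF assms(1,2) gs, of x c]
      gd(1)[where N = "length vs" and X = "shifted_lap vs (\<lambda>v. x * c v)"] by simp
  also have "\<dots> = det (twisted_mat \<Gamma> (f 1) (\<rho> 1) (length vs) (shifted_lap vs (\<lambda>v. x * c v))) ^ f 1 *
      (\<Prod>i = 2..k. det (twisted_mat \<Gamma> (f i) (\<rho> i) (length vs) (shifted_lap vs (\<lambda>v. x * c v))) ^ f i)"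
    using prod.atLeast_Suc_atMost[OF k] by (simp add: numeral_2_eq_2)
  also have "det (twisted_mat \<Gamma> (f 1) (\<rho> 1) (length vs) (shifted_lap vs (\<lambda>v. x * c v))) ^ f 1 =
      weighted_charpoly G w c x"
    using weighted_charpoly_eq_trivial[OF assms(1,2) _ assms(5), of x c] rep[of 1] k assms(4) by simp
  also have "(\<Prod>i = 2..k. det (twisted_mat \<Gamma> (f i) (\<rho> i) (length vs) (shifted_lap vs (\<lambda>v. x * c v))) ^ f i) =
      (\<Prod>i = 2..k. pdet {0..<f i * length vs}
       (\<lambda>a b. rep_lap vs (\<rho> i) a b + rep_diag vs (\<lambda>v. x * c v) a b) ^ f i)"
    by (intro prod.cong refl) (simp add: det_twisted_shifted_lap rep)
  finally show ?thesis .
qed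

text \<open>\<open>P c\<close> collects the factors for \<open>i \<ge> 2\<close>. After division by
  \<open>x\<close> the factorization reads \<open>p = q * P c\<close>; its value at 0 for the weight
  1 relates the two tree sums, and its derivative at 0 for the given weight relates the sums over
  pairs.\<close>

lemma pair_minor_sum_derived:
  fixes c :: "'v \<Rightarrow> complex"
  assumes V: "pverts G \<noteq> {}" and vs: "distinct vs" "set vs = pverts G"
    and irr: "complete_irreps \<Gamma> k f \<rho>" "f 1 = 1" "\<forall>g\<in>carrier \<Gamma>. \<rho> 1 g = 1\<^sub>m 1"
    and nz: "kappa dG dw \<noteq> 0"
  defines "\<Delta> \<equiv> \<lambda>i. pdet {0..<f i * length vs} (rep_lap vs (\<rho> i))"
  defines "\<delta> \<equiv> \<lambda>i. pdet_deriv {0..<f i * length vs} (rep_lap vs (\<rho> i)) (rep_diag vs c)"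
  defines "r \<equiv> of_nat (card (carrier \<Gamma>)) :: complex"
  shows "\<forall>i\<in>{2..k}. \<Delta> i \<noteq> 0"
    and "pair_minor_sum dG dw (\<lambda>(v, g). c v) = (r * kappa dG dw / kappa G w) *
      (pair_minor_sum G w c + kappa G w * (\<Sum>v\<in>pverts G. c v) * (\<Sum>i = 2..k. of_nat (f i) * (\<delta> i / \<Delta> i)))"
proof -
  interpret D: pair_graph dG by (rule pair_graph_derived)
  have VD: "pverts dG \<noteq> {}" using V one_closed by auto
  define P where "P c x = (\<Prod>i = 2..k. pdet {0..<f i * length vs}
       (\<lambda>a b. rep_lap vs (\<rho> i) a b + rep_diag vs (\<lambda>v. x * c v) a b) ^ f i)" for c and x :: complex
  have P0: "P c 0 = (\<Prod>i = 2..k. \<Delta> i ^ f i)" for c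
    by (simp add: P_def \<Delta>_def rep_diag_def)
  have fact: "weighted_charpoly dG dw (\<lambda>(v, g). c v) x = weighted_charpoly G w c x * P c x" for c x
    unfolding P_def by (rule weighted_charpoly_factorization[OF vs irr])
  have sumD: "(\<Sum>z\<in>pverts dG. case z of (v, g) \<Rightarrow> c v) = r * (\<Sum>v\<in>pverts G. c v)" for c :: "'v \<Rightarrow> complex"
    by (simp add: sum.cartesian_product[symmetric] r_def sum_distrib_left)
  have r: "r \<noteq> 0" using finite_group one_closed by (auto simp: r_def)
  \<comment> \<open>Continuity is kept apart from the derivative formula: it helps to show that no
    \<open>\<Delta> i\<close> vanishes, while the formula divides by the
    \<open>\<Delta> i\<close>.\<close>
  have Pd: "isCont (P c) 0"
    and Pd': "(\<And>i. i \<in> {2..k} \<Longrightarrow> \<Delta> i \<noteq> 0) \<Longrightarrow> (P c has_field_derivative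
      (\<Prod>i = 2..k. \<Delta> i ^ f i) * (\<Sum>i = 2..k. of_nat (f i) *
        (pdet_deriv {0..<f i * length vs} (rep_lap vs (\<rho> i)) (rep_diag vs c) / \<Delta> i))) (at 0)" for c
  proof -
    define F where "F i x = pdet {0..<f i * length vs}
       (\<lambda>a b. rep_lap vs (\<rho> i) a b + rep_diag vs (\<lambda>v. x * c v) a b)" for i and x :: complex
    have F0: "F i 0 = \<Delta> i" for i by (simp add: F_def \<Delta>_def rep_diag_def)
    have M0: "(\<lambda>a b. rep_lap vs (\<rho> i) a b + rep_diag vs (\<lambda>v. 0 * c v) a b) = rep_lap vs (\<rho> i)" for i
      by (intro ext) (simp add: rep_diag_def)
    have Fd: "(F i has_field_derivative pdet_deriv {0..<f i * length vs} (rep_lap vs (\<rho> i)) (rep_diag vs c)) (at 0)" for i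
    proof -
      have "((\<lambda>x. pdet {0..<f i * length vs} (\<lambda>a b. rep_lap vs (\<rho> i) a b + rep_diag vs (\<lambda>v. x * c v) a b))
        has_field_derivative pdet_deriv {0..<f i * length vs}
          (\<lambda>a b. rep_lap vs (\<rho> i) a b + rep_diag vs (\<lambda>v. 0 * c v) a b) (rep_diag vs c)) (at 0)"
        by (rule has_field_derivative_pdet) (auto simp: rep_diag_def intro!: derivative_eq_intros)
      thus ?thesis unfolding M0 F_def[abs_def] .
    qed
    have PF: "P c = (\<lambda>x. \<Prod>i = 2..k. F i x ^ f i)"
      by (intro ext) (simp add: P_def F_def)
    show "isCont (P c) 0"
      unfolding PF isCont_def
      by (intro tendsto_prod tendsto_power) (use DERIV_isCont[OF Fd] in \<open>simp add: isCont_def\<close>)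
    show "(P c has_field_derivative
      (\<Prod>i = 2..k. \<Delta> i ^ f i) * (\<Sum>i = 2..k. of_nat (f i) *
        (pdet_deriv {0..<f i * length vs} (rep_lap vs (\<rho> i)) (rep_diag vs c) / \<Delta> i))) (at 0)"
      if "\<And>i. i \<in> {2..k} \<Longrightarrow> \<Delta> i \<noteq> 0"
      unfolding PF F0[symmetric]
      by (rule has_field_derivative_prod_power) (use that Fd in \<open>auto simp: F0\<close>)
  qed
  have compare: "kappa dG dw * (r * (\<Sum>v\<in>pverts G. c v)) = kappa G w * (\<Sum>v\<in>pverts G. c v) * P c 0 \<and>
      (\<forall>P'. (P c has_field_derivative P') (at 0) \<longrightarrow>
        pair_minor_sum dG dw (\<lambda>(v, g). c v) =
        pair_minor_sum G w c * P c 0 + kappa G w * (\<Sum>v\<in>pverts G. c v) * P')" for c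
  proof -
    obtain q where q: "\<And>x. weighted_charpoly G w c x = x * q x" "q 0 = kappa G w * (\<Sum>v\<in>pverts G. c v)"
      "(q has_field_derivative pair_minor_sum G w c) (at 0)"
      using weighted_charpoly_expansion[OF V weight] by blast
    obtain p where p: "\<And>x. weighted_charpoly dG dw (\<lambda>(v, g). c v) x = x * p x"
      "p 0 = kappa dG dw * (r * (\<Sum>v\<in>pverts G. c v))"
      "(p has_field_derivative pair_minor_sum dG dw (\<lambda>(v, g). c v)) (at 0)"
      using D.weighted_charpoly_expansion[OF VD symmetric_weight_derived, of "\<lambda>(v, g). c v"]
      unfolding sumD by blast
    have ne: "p x = q x * P c x" if "x \<noteq> 0" for x
      using fact[of c x] that by (simp add: p(1) q(1))
    \<comment> \<open>Cancelling \<open>x\<close> yields the identity only away from 0; continuity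
      extends it to 0.\<close>
    have "p \<midarrow>0\<rightarrow> p 0" using DERIV_isCont[OF p(3)] by (simp add: isCont_def)
    moreover have "(\<lambda>x. q x * P c x) \<midarrow>0\<rightarrow> q 0 * P c 0"
      using DERIV_isCont[OF q(3)] Pd[of c] by (intro tendsto_mult) (simp_all add: isCont_def)
    hence "p \<midarrow>0\<rightarrow> q 0 * P c 0"
      by (rule Lim_transform_eventually) (auto simp: eventually_at_filter ne)
    ultimately have e0: "p 0 = q 0 * P c 0" by (rule LIM_unique)
    have eq: "p = (\<lambda>x. q x * P c x)" using ne e0 by (metis ext)
    have "pair_minor_sum dG dw (\<lambda>(v, g). c v) =
        pair_minor_sum G w c * P c 0 + kappa G w * (\<Sum>v\<in>pverts G. c v) * P'"
      if "(P c has_field_derivative P') (at 0)" for P'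
    proof -
      have "(p has_field_derivative pair_minor_sum G w c * P c 0 + P' * q 0) (at 0)"
        unfolding eq by (rule DERIV_mult[OF q(3) that])
      thus ?thesis using DERIV_unique[OF p(3)] q(2) by (simp add: mult.commute)
    qed
    thus ?thesis using e0 p(2) q(2) by simp
  qed
  \<comment> \<open>For the weight 1 the common factor is the number of vertices, which can be
    cancelled.\<close>
  have "of_nat (card (pverts G)) \<noteq> (0 :: complex)" using V pair_finite_verts by simp
  hence kP: "kappa dG dw * r = kappa G w * (\<Prod>i = 2..k. \<Delta> i ^ f i)"
    using conjunct1[OF compare[of "\<lambda>_. 1"]] unfolding P0 by (simp add: mult_ac)
  hence "kappa G w * (\<Prod>i = 2..k. \<Delta> i ^ f i) \<noteq> 0" using nz r by (metis mult_eq_0_iff)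
  hence "(\<Prod>i = 2..k. \<Delta> i ^ f i) \<noteq> 0" and kG: "kappa G w \<noteq> 0" using mult_eq_0_iff by blast+
  \<comment> \<open>A positive exponent is what lets a vanishing \<open>\<Delta> i\<close>
    annihilate the product, since \<open>0 ^ 0 = 1\<close>.\<close>
  moreover have "f i \<noteq> 0" if "i \<in> {2..k}" for i
  proof -
    have "irreducible_rep \<Gamma> (f i) (\<rho> i)" using irr(1) that by (simp add: complete_irreps_def)
    thus ?thesis by (simp add: irreducible_rep_def)
  qed
  ultimately show \<Delta>: "\<forall>i\<in>{2..k}. \<Delta> i \<noteq> 0" by simp
  have Pd'': "(P c has_field_derivative
      (\<Prod>i = 2..k. \<Delta> i ^ f i) * (\<Sum>i = 2..k. of_nat (f i) * (\<delta> i / \<Delta> i))) (at 0)"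
    unfolding \<delta>_def by (rule Pd') (use \<Delta> in blast)
  have "pair_minor_sum dG dw (\<lambda>(v, g). c v) = (\<Prod>i = 2..k. \<Delta> i ^ f i) *
      (pair_minor_sum G w c + kappa G w * (\<Sum>v\<in>pverts G. c v) * (\<Sum>i = 2..k. of_nat (f i) * (\<delta> i / \<Delta> i)))"
    using compare[THEN conjunct2, rule_format, OF Pd''] unfolding P0 by (simp add: algebra_simps)
  also have "(\<Prod>i = 2..k. \<Delta> i ^ f i) = r * kappa dG dw / kappa G w"
    using kP kG by (simp add: field_simps)
  finally show "pair_minor_sum dG dw (\<lambda>(v, g). c v) = (r * kappa dG dw / kappa G w) *
      (pair_minor_sum G w c + kappa G w * (\<Sum>v\<in>pverts G. c v) * (\<Sum>i = 2..k. of_nat (f i) * (\<delta> i / \<Delta> i)))" .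
qed

end

theorem theorem16:
  fixes G :: "'v pair_pre_digraph"
    and \<Gamma> :: "('g, 'b) monoid_scheme"
    and \<alpha> :: "'v \<times> 'v \<Rightarrow> 'g"
    and w :: "'v \<times> 'v \<Rightarrow> complex"
    and vs :: "'v list"
    and xs :: "('v \<times> 'g) list"
    and n m r k :: nat
    and f :: "nat \<Rightarrow> nat"
    and \<rho> :: "nat \<Rightarrow> 'g \<Rightarrow> complex mat"
    and K :: "nat \<Rightarrow> complex \<Rightarrow> complex \<Rightarrow> complex"
    and t :: complex
  assumes "pair_graph G" and "Digraph_Component.connected (with_proj G)"
    and "card (pverts G) = n" and "card (uedges G) = m"
    and "group \<Gamma>" and "finite (carrier \<Gamma>)" and "card (carrier \<Gamma>) = r"
    and "ordinary_voltage G \<Gamma> \<alpha>"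
    and "symmetric_weight G w"
    and "distinct vs" and "set vs = pverts G"
    and "distinct xs" and "set xs = pverts (derived_graph G \<Gamma> \<alpha>)"
    and "complete_irreps \<Gamma> k f \<rho>"
    and "f 1 = 1" and "\<forall>g \<in> carrier \<Gamma>. \<rho> 1 g = 1\<^sub>m 1"
    and "Digraph_Component.connected (with_proj (derived_graph G \<Gamma> \<alpha>))"
    and "kappa G w \<noteq> 0"
    and "kappa (derived_graph G \<Gamma> \<alpha>) (derived_weight G \<Gamma> \<alpha> w) \<noteq> 0"
    and "\<forall>i \<in> {2..k}. \<forall>u s. K i u s = Kdet G \<Gamma> \<alpha> w vs (f i) (\<rho> i) u s"
    and "t \<noteq> 0"
  shows
    "Kfz (derived_graph G \<Gamma> \<alpha>) (derived_weight G \<Gamma> \<alpha> w) xs t =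
       of_nat r * Kfz G w vs t
       - 2 * of_nat r * (total_weight G w * t - of_nat n) *
         ((of_nat r - 1) * of_nat n * t
          - t\<^sup>2 * (\<Sum>i = 2..k. of_nat (f i) * dlog (\<lambda>s. K i (1 - 1 / t) s) t))
     \<and> Kfz (derived_graph G \<Gamma> \<alpha>) (derived_weight G \<Gamma> \<alpha> w) xs t =
       of_nat r * Kfz G w vs t
       + of_nat r * (of_nat n - total_weight G w * t) *
         ((of_nat r - 1) * of_nat n * t
          - t\<^sup>2 * (\<Sum>i = 2..k. of_nat (f i) * dlog (\<lambda>s. K i (1 - 1 / t) s) t)
          + (\<Sum>i = 2..k. of_nat (f i) * dlog (\<lambda>u. K i u t) (1 - 1 / t)))
     \<and> Kfz (derived_graph G \<Gamma> \<alpha>) (derived_weight G \<Gamma> \<alpha> w) xs t =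
       of_nat r * Kfz G w vs t
       - 2 * of_nat r * (total_weight G w * t - of_nat n) *
         (\<Sum>i = 2..k. of_nat (f i) * dlog (\<lambda>u. K i u t) (1 - 1 / t))"
proof -
  interpret voltage_graph G \<Gamma> \<alpha> w
    using assms(1,5,6,8,9) by (simp add: voltage_graph_def voltage_graph_axioms_def)
  interpret D: pair_graph "derived_graph G \<Gamma> \<alpha>" by (rule pair_graph_derived)
  define c where "c v = wdegree G w v * t - 2" for v
  define \<Delta> where "\<Delta> i = pdet {0..<f i * length vs} (rep_lap vs (\<rho> i))" for i
  define \<delta> where "\<delta> i = pdet_deriv {0..<f i * length vs} (rep_lap vs (\<rho> i)) (rep_diag vs c)" for i
  define \<Sigma> where "\<Sigma> = (\<Sum>i = 2..k. of_nat (f i) * (\<delta> i / \<Delta> i))"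
  have V: "pverts G \<noteq> {}" using assms(2) connected_iff_reachable by blast
  have len: "length vs = n" using assms(3,10,11) distinct_card by fastforce
  have r: "of_nat (card (carrier \<Gamma>)) = (of_nat r :: complex)" by (simp add: assms(7))
  note main = pair_minor_sum_derived[OF V assms(10,11,14,15,16,19)]
  have \<Delta>: "\<Delta> i \<noteq> 0" if "i \<in> {2..k}" for i
    using main(1) that by (simp add: \<Delta>_def)
  have sc: "(\<Sum>v\<in>pverts G. c v) = 2 * (total_weight G w * t - of_nat n)"
  proof -
    have "(\<Sum>v\<in>pverts G. c v) = (\<Sum>v\<in>pverts G. wdegree G w v) * t - 2 * of_nat n"
      by (simp add: c_def sum_subtractf sum_distrib_right assms(3))
    thus ?thesis by (simp add: sum_wdegree[OF assms(9)] algebra_simps)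
  qed
  \<comment> \<open>Degrees are constant along fibres, so the weight belonging to the covering is
    the pullback of \<open>c\<close>, as the comparison requires.\<close>
  have "pair_minor_sum dG dw (\<lambda>z. wdegree dG dw z * t - 2) = pair_minor_sum dG dw (\<lambda>(v, g). c v)"
    unfolding pair_minor_sum_def
  proof (intro sum.cong refl arg_cong2[of _ _ _ _ "(*)"] prod.cong)
    fix T z assume "T \<in> {T. T \<subseteq> pverts dG \<and> card T = 2}" "z \<in> T"
    hence "z \<in> pverts G \<times> carrier \<Gamma>" by auto
    thus "wdegree dG dw z * t - 2 = (case z of (v, g) \<Rightarrow> c v)" by (auto simp: c_def wdegree_derived)
  qed
  hence "kappa dG dw * Kfz dG dw xs t = pair_minor_sum dG dw (\<lambda>(v, g). c v)"
    using D.pair_minor_sum_eq_Kfz[OF assms(12,13,19), of t] by simp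
  also have "\<dots> = (of_nat r * kappa dG dw / kappa G w) * (pair_minor_sum G w c + kappa G w * (\<Sum>v\<in>pverts G. c v) * \<Sigma>)"
    using main(2)[of c] by (simp add: \<Sigma>_def \<delta>_def \<Delta>_def r)
  also have "pair_minor_sum G w c = kappa G w * Kfz G w vs t"
    unfolding c_def by (rule pair_minor_sum_eq_Kfz[OF assms(10,11,18)])
  also have "(of_nat r * kappa dG dw / kappa G w) * (kappa G w * Kfz G w vs t + kappa G w * (\<Sum>v\<in>pverts G. c v) * \<Sigma>) =
      kappa dG dw * (of_nat r * Kfz G w vs t + 2 * of_nat r * (total_weight G w * t - of_nat n) * \<Sigma>)"
    using assms(18) by (simp add: sc field_simps)
  finally have Kfz: "Kfz dG dw xs t = of_nat r * Kfz G w vs t + 2 * of_nat r * (total_weight G w * t - of_nat n) * \<Sigma>"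
    using assms(19) by simp
  have rep: "matrix_rep \<Gamma> (f i) (\<rho> i)" if "i \<in> {2..k}" for i
    using assms(14) that unfolding complete_irreps_def by (auto intro!: irreducible_rep_matrix_rep)
  have dl: "dlog (\<lambda>u. K i u t) (1 - 1 / t) = - (\<delta> i / \<Delta> i)"
    "t\<^sup>2 * dlog (\<lambda>s. K i (1 - 1 / t) s) t = of_nat (f i * n) * t + \<delta> i / \<Delta> i" if i: "i \<in> {2..k}" for i
  proof -
    have "K i = Kdet G \<Gamma> \<alpha> w vs (f i) (\<rho> i)" using assms(20) i by (intro ext) blast
    thus "dlog (\<lambda>u. K i u t) (1 - 1 / t) = - (\<delta> i / \<Delta> i)"
      "t\<^sup>2 * dlog (\<lambda>s. K i (1 - 1 / t) s) t = of_nat (f i * n) * t + \<delta> i / \<Delta> i"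
      using dlog_Kdet[OF rep[OF i] assms(21), of vs] \<Delta>[OF i]
      unfolding \<delta>_def \<Delta>_def c_def[abs_def] len by simp_all
  qed
  have du: "(\<Sum>i = 2..k. of_nat (f i) * dlog (\<lambda>u. K i u t) (1 - 1 / t)) = - \<Sigma>"
    unfolding \<Sigma>_def sum_negf[symmetric] by (intro sum.cong refl) (simp add: dl(1))
  obtain gs where gs: "distinct gs" "set gs = carrier \<Gamma>" using finite_group finite_distinct_list by blast
  \<comment> \<open>Removing the trivial representation from the sum of squares leaves
    \<open>r - 1\<close>. The squares occur because the twisted Laplacian has size
    \<open>f i * n\<close> and its logarithmic derivative is counted \<open>f i\<close>
    times.\<close>
  have sq: "(\<Sum>i = 2..k. of_nat (f i * f i)) = (of_nat r - 1 :: complex)"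
  proof -
    have s: "(\<Sum>i = 1..k. f i * f i) = r"
      using group_determinant(2)[OF assms(5,6,14) gs] assms(7) by simp
    have "r \<noteq> 0" using assms(7) finite_group one_closed by (metis card_eq_0_iff empty_iff)
    hence "k \<noteq> 0" using s by (intro notI) simp
    hence k: "1 \<le> k" by simp
    have "r = 1 + (\<Sum>i = 2..k. f i * f i)"
      using s sum.atLeast_Suc_atMost[OF k, of "\<lambda>i. f i * f i"] assms(15) by (simp add: numeral_2_eq_2)
    thus ?thesis by simp
  qed
  have "t\<^sup>2 * (\<Sum>i = 2..k. of_nat (f i) * dlog (\<lambda>s. K i (1 - 1 / t) s) t) =
      (\<Sum>i = 2..k. of_nat (f i) * (t\<^sup>2 * dlog (\<lambda>s. K i (1 - 1 / t) s) t))"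
    unfolding sum_distrib_left by (simp add: mult_ac)
  also have "\<dots> = (\<Sum>i = 2..k. of_nat (f i * f i) * (of_nat n * t) + of_nat (f i) * (\<delta> i / \<Delta> i))"
    by (intro sum.cong refl) (simp add: dl(2) algebra_simps)
  also have "\<dots> = (of_nat r - 1) * of_nat n * t + \<Sigma>"
    unfolding sum.distrib sum_distrib_right[symmetric] sq \<Sigma>_def by (simp add: mult_ac)
  finally have dt: "t\<^sup>2 * (\<Sum>i = 2..k. of_nat (f i) * dlog (\<lambda>s. K i (1 - 1 / t) s) t) =
      (of_nat r - 1) * of_nat n * t + \<Sigma>" .
  show ?thesis unfolding Kfz du dt by (simp add: algebra_simps)
qed

end
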